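(* Let $0<\varepsilon<1/2$. There exists a constant $c>0$ such that, as $x\to\infty$, $$\sum_{n\le x}\mathbf{1}_{\mathbf E}(n)=\frac{1}{\pi}\int_{1/2+\varepsilon}^1 G(\sigma)\frac{x^\sigma}{\sigma|\sigma-1|^{1/2}}\,d\sigma+O\big(x\exp(-c\sqrt{\log x})\big),$$ where $G(s)=(\zeta(s)(s-1))^{1/2}L(s,\chi_4)^{1/2}(1-2^{-s})^{-1/2}\prod_{p\equiv3\,(4)}(1-p^{-2s})^{-1/2}$. If the Riemann Hypothesis holds for $\zeta(s)$ and $L(s,\chi_4)$, the error term can be replaced by $O(x^{1/2+\varepsilon})$.
   Context: $\mathbf{1}_{\mathbf E}$ is the indicator function of the set $\mathbf E=\{a^2+b^2:a,b\in\mathbb{Z}\}$ of sums of two squares; $\chi_4$ is the non-principal Dirichlet character mod 4. For real $\sigma\in(1/2,1]$ the quantities $\zeta(\sigma)(\sigma-1)$, $L(\sigma,\chi_4)$, $1-2^{-\sigma}$, $1-p^{-2\sigma}$ are positive and the square roots are the positive ones. *)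

theory Defs
  imports "HOL-Analysis.Analysis" "HOL-Library.Landau_Symbols" "HOL-Computational_Algebra.Primes"
begin

definition sum2sq :: "nat set" where
  "sum2sq = {n. \<exists>a b :: int. int n = a^2 + b^2}"

definition chi4 :: "nat \<Rightarrow> int" where
  "chi4 n = (if n mod 4 = 1 then 1 else if n mod 4 = 3 then -1 else 0)"

text \<open>Dirichlet eta function; the series converges for Re s > 0.\<close>
definition eta :: "complex \<Rightarrow> complex" where
  "eta s = (\<Sum>n. (-1) ^ n * (of_nat (Suc n)) powr (- s))"

text \<open>Riemann zeta function on the half plane Re s > 0 (s not 1),
  via the analytic continuation zeta(s) = eta(s) / (1 - 2^(1-s)).\<close>
definition zeta :: "complex \<Rightarrow> complex" where
  "zeta s = eta s / (1 - 2 powr (1 - s))"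

text \<open>L(s, chi_4) on Re s > 0, where its Dirichlet series converges.\<close>
definition L_chi4 :: "complex \<Rightarrow> complex" where
  "L_chi4 s = (\<Sum>n. of_int (chi4 (Suc n)) * (of_nat (Suc n)) powr (- s))"

text \<open>The real function zeta(sigma)(sigma - 1), extended continuously by its value 1 at sigma = 1.\<close>
definition zeta_sm1 :: "real \<Rightarrow> real" where
  "zeta_sm1 \<sigma> = (if \<sigma> = 1 then 1 else (\<sigma> - 1) * Re (zeta (complex_of_real \<sigma>)))"

definition G :: "real \<Rightarrow> real" where
  "G \<sigma> = sqrt (zeta_sm1 \<sigma>) * sqrt (Re (L_chi4 (complex_of_real \<sigma>)))
          * (1 - 2 powr (- \<sigma>)) powr (- 1/2)
          * prodinf (\<lambda>p. if prime p \<and> p mod 4 = 3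
                           then (1 - real p powr (- 2 * \<sigma>)) powr (- 1/2) else 1)"

definition countE :: "real \<Rightarrow> real" where
  "countE x = real (card {n \<in> {1..nat \<lfloor>x\<rfloor>}. n \<in> sum2sq})"

definition mainterm :: "real \<Rightarrow> real \<Rightarrow> real" where
  "mainterm \<epsilon> x = (1 / pi) * integral {1/2 + \<epsilon>..1}
      (\<lambda>\<sigma>. G \<sigma> * x powr \<sigma> / (\<sigma> * sqrt \<bar>\<sigma> - 1\<bar>))"

definition RH_zeta_L4 :: bool where
  "RH_zeta_L4 \<longleftrightarrow>
     (\<forall>s. 0 < Re s \<and> Re s < 1 \<and> zeta s = 0 \<longrightarrow> Re s = 1/2) \<and>
     (\<forall>s. 0 < Re s \<and> Re s < 1 \<and> L_chi4 s = 0 \<longrightarrow> Re s = 1/2)"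

end

theory Submission
  imports Defs "HOL-Complex_Analysis.Complex_Analysis" "HOL-Number_Theory.Number_Theory"
begin

text \<open>
  Write \<open>F(s) = \<Sum> 1\<^sub>E(n) n\<^sup>-\<^sup>s\<close>. Comparing Euler products gives
  \<open>F(s)\<^sup>2 = \<zeta>(s) L(s, \<chi>\<^sub>4) (1 - 2\<^sup>-\<^sup>s)\<^sup>-\<^sup>1 \<Prod> (1 - p\<^sup>-\<^sup>2\<^sup>s)\<^sup>-\<^sup>1\<close>, so \<open>F(s) = G(s) (s - 1)\<^sup>-\<^sup>1\<^sup>/\<^sup>2\<close> continues to every
  region, starlike about 1, in which \<open>Z(s) = \<zeta>(s) L(s, \<chi>\<^sub>4)\<close> has no zeros. Since \<open>log Z\<close> has
  nonnegative Dirichlet coefficients, the 3-4-1 inequality can be applied to \<open>Z\<close> as a whole; with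
  Landau's lemma on logarithmic derivatives it gives the classical zero-free region.

  The counting function \<open>A(x)\<close> differs by at most \<open>h + 1\<close> from the difference quotient
  \<open>(A\<^sub>1(x + h) - A\<^sub>1(x)) / h\<close> of its primitive, for which Perron's integral converges absolutely.
  Under the substitution \<open>s = 1 + w\<^sup>2\<close> the integrand becomes holomorphic across the branch cut, so
  the contour can be moved by means of a primitive in the \<open>w\<close>-plane, and the two sides of the cut
  contribute the integral over \<open>\<sigma>\<close>. The error terms come from the choices
  \<open>h = x exp (- \<kappa> (log x)\<^sup>1\<^sup>/\<^sup>2)\<close> and, under the Riemann hypothesis, \<open>h = x\<^sup>1\<^sup>/\<^sup>2\<close>, where
  differencing inside the integral avoids the usual loss of a square root.
\<close>

section \<open>Sums of two squares\<close>

text \<open>The singularity of F at 1 is a branch point, so no residue gives the main term, and the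
  lower end 1/2 + \<epsilon> of the integral has no intrinsic meaning: shifting it within (1/2, 1)
  costs only a power of x with exponent below 1. Treating Z as a whole avoids separate arguments for
  zeros of zeta and of L. Beyond positivity of coefficients the only arithmetic input is L(1, chi4)
  > 0, visible from pairing the terms of an alternating series. Convergence on the contour is a
  matter of exponents. Elementary bounds give zeta and L the order |t|^(3/4) for Re s > 1/2; so F,
  the square root of their product up to bounded factors, has order |t|^(3/4) as well, and a single
  smoothing, with kernel decay |t|^(-2), suffices. In the zero-free region a loss of |t|^(1/8) makes
  the saving uniform in t. Under the Riemann hypothesis the full decay would cost a factor x/h =
  x^(1/2); but there F grows slower than any power of |t|, so a small power of x/h already buys
  integrability.\<close>

lemma sum2sq_mult:
  assumes "m \<in> sum2sq" "n \<in> sum2sq"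
  shows "m * n \<in> sum2sq"
proof -
  obtain a b c d :: int where "int m = a^2 + b^2" "int n = c^2 + d^2"
    using assms unfolding sum2sq_def by auto
  hence "int (m * n) = (a*c - b*d)^2 + (a*d + b*c)^2"
    by (simp add: power2_eq_square algebra_simps)
  thus ?thesis unfolding sum2sq_def by blast
qed

lemma square_mem_sum2sq: "m ^ 2 \<in> sum2sq"
proof -
  have "int (m ^ 2) = (int m)^2 + 0^2" by simp
  thus ?thesis unfolding sum2sq_def by blast
qed

text \<open>If p did not divide a, Fermat's theorem would apply to a and b. Raising a^2 = -b^2 to
  the power k = (p - 1)/2, which is odd because p = 3 mod 4, then yields 1 = -1 mod p.\<close>

lemma prime_3_mod_4_dvd_sum_squares:
  fixes a b :: int
  assumes p: "prime p" "p mod 4 = (3::nat)" and dvd: "int p dvd a^2 + b^2"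
  shows "int p dvd a"
proof (rule ccontr)
  assume na: "\<not> int p dvd a"
  have pi: "prime (int p)" using p by simp
  have nb: "\<not> int p dvd b"
  proof
    assume "int p dvd b"
    hence "int p dvd b^2" by (simp add: power2_eq_square)
    hence "int p dvd a^2" using dvd by (simp add: dvd_add_left_iff)
    thus False using na pi prime_dvd_power by blast
  qed
  define k where "k = (p - 1) div 2"
  have k: "p - 1 = 2 * k" "odd k" unfolding k_def using p(2) by presburger+
  have fermat: "[c ^ (p - 1) = 1] (mod int p)" if "\<not> int p dvd c" for c :: int
  proof -
    \<comment> \<open>\<open>fermat_theorem\<close> is about naturals; the sign of c drops out
      because the exponent p - 1 is even.\<close>
    have "\<not> p dvd nat \<bar>c\<bar>" using that by (simp add: nat_dvd_iff flip: int_dvd_int_iff)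
    hence "[(nat \<bar>c\<bar>) ^ (p - 1) = 1] (mod p)" using fermat_theorem p by blast
    hence "[int ((nat \<bar>c\<bar>) ^ (p - 1)) = int 1] (mod int p)" by (simp only: cong_int_iff)
    thus ?thesis using k by (simp add: power_even_abs)
  qed
  have "[a^2 = - (b^2)] (mod int p)" using dvd by (simp add: cong_iff_dvd_diff)
  hence "[(a^2)^k = (- (b^2))^k] (mod int p)" by (rule cong_pow)
  hence "[a^(p-1) = - (b^(p-1))] (mod int p)" using k by (simp add: power_mult)
  moreover have "[- (b^(p-1)) = - 1] (mod int p)" using fermat[OF nb] by (simp add: cong_minus_minus_iff)
  ultimately have "[1 = -1] (mod int p)" using fermat[OF na] by (meson cong_sym cong_trans)
  hence "int p dvd 2" by (simp add: cong_iff_dvd_diff)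
  hence "p dvd 2" by (metis int_dvd_int_iff of_nat_numeral)
  hence "p \<le> 2" by (rule dvd_imp_le) auto
  hence "p = 0 \<or> p = 1 \<or> p = 2" by linarith
  thus False using p(2) by auto
qed

text \<open>Thue's pigeonhole argument. Euler's criterion supplies x with x^2 = -1 mod p. Two of the
  (k + 1)^2 > p pairs (i, j) share the value x i - j mod p; their difference (u, v) satisfies p |
  u^2 + v^2 and 0 < u^2 + v^2 < 2p, so u^2 + v^2 = p.\<close>

lemma prime_1_mod_4_mem_sum2sq:
  assumes p: "prime p" "p mod 4 = (1::nat)"
  shows "p \<in> sum2sq"
proof -
  have "p \<noteq> 2" using p(2) by auto
  hence p2: "2 < p" using prime_ge_2_nat[OF p(1)] by simp
  have ev: "even ((p - 1) div 2)" using p(2) by presburger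
  have "[Legendre (-1) (int p) = (-1) ^ ((p - 1) div 2)] (mod int p)"
    using euler_criterion[OF p(1) p2] by simp
  hence "[Legendre (-1) (int p) = 1] (mod int p)" using ev by simp
  moreover have "\<not> [0 = 1] (mod int p)" using p2 by (simp add: cong_def)
  moreover have "\<not> [-1 = 1] (mod int p)"
  proof
    assume "[-1 = 1] (mod int p)"
    hence "int p dvd 2" by (simp add: cong_iff_dvd_diff)
    from zdvd_imp_le[OF this] p2 show False by simp
  qed
  ultimately have "QuadRes (int p) (-1)" unfolding Legendre_def by (auto split: if_splits)
  then obtain x where "[x^2 = -1] (mod int p)" unfolding QuadRes_def by auto
  hence x: "int p dvd x^2 + 1" by (simp add: cong_iff_dvd_diff)
  \<comment> \<open>The integer part of sqrt p serves twice: (k + 1)^2 > p forces the collision, and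
    k^2 < p (p is not a square) gives the strict bound 2p.\<close>
  define k where "k = nat \<lfloor>sqrt p\<rfloor>"
  have "real k = of_int \<lfloor>sqrt p\<rfloor>" unfolding k_def by simp
  hence kle: "real k \<le> sqrt p" "sqrt p < real k + 1" by linarith+
  have "(sqrt p)^2 < (real k + 1)^2" using kle by (intro power_strict_mono) auto
  hence "real p < real ((k + 1)^2)" by (simp add: algebra_simps)
  hence kp: "p < (k + 1)^2" by (simp only: of_nat_less_iff)
  have "real k ^ 2 \<le> (sqrt p)^2" using kle by (intro power_mono) auto
  hence "real (k^2) \<le> real p" by simp
  hence kp2: "k^2 \<le> p" by (simp only: of_nat_le_iff)
  have "k^2 \<noteq> p" using p(1) by (auto simp: prime_power_iff)
  with kp2 have kp3: "k^2 < p" by simp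
  define f where "f = (\<lambda>(i::nat,j::nat). (x * int i - int j) mod int p)"
  have "f ` ({0..k} \<times> {0..k}) \<subseteq> {0..<int p}" using p2 by (auto simp: f_def)
  hence "card (f ` ({0..k} \<times> {0..k})) \<le> card {0..<int p}" by (intro card_mono) auto
  also have "\<dots> = p" by simp
  also have "\<dots> < card ({0..k} \<times> {0..k})" using kp by (simp add: power2_eq_square)
  finally have "\<not> inj_on f ({0..k} \<times> {0..k})" by (rule pigeonhole)
  then obtain i j i' j' where ij: "i \<le> k" "j \<le> k" "i' \<le> k" "j' \<le> k" "(i,j) \<noteq> (i',j')" "f (i,j) = f (i',j')"
    unfolding inj_on_def by auto
  define u v where "u = int i - int i'" and "v = int j - int j'"
  have "int p dvd (x * int i - int j) - (x * int i' - int j')"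
    using ij(6) by (simp add: f_def mod_eq_dvd_iff)
  hence d: "int p dvd x * u - v" by (simp add: u_def v_def algebra_simps)
  have "int p dvd (x^2 + 1) * u^2 - (x * u - v) * (x * u + v)"
    by (intro dvd_diff dvd_mult2 d x)
  hence d2: "int p dvd u^2 + v^2" by (simp add: power2_eq_square algebra_simps)
  have "\<bar>u\<bar> \<le> int k" "\<bar>v\<bar> \<le> int k" using ij unfolding u_def v_def by auto
  hence "u^2 \<le> int k^2" "v^2 \<le> int k^2" by (metis abs_le_square_iff abs_of_nat)+
  moreover have "int k^2 < int p" using kp3 by (metis of_nat_less_iff of_nat_power)
  ultimately have lt: "u^2 + v^2 < 2 * int p" by linarith
  have "u \<noteq> 0 \<or> v \<noteq> 0" using ij(5) unfolding u_def v_def by auto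
  hence pos: "u^2 + v^2 > 0" by (simp add: sum_power2_gt_zero_iff)
  obtain c where c: "u^2 + v^2 = int p * c" using d2 by (auto elim: dvdE)
  have "0 < int p * c" using pos c by simp
  hence "c > 0" using p2 by (simp add: zero_less_mult_iff)
  moreover have "int p * c < int p * 2" using lt c by simp
  hence "c < 2" using p2 by (simp only: mult_less_cancel_left_pos)
  ultimately have "c = 1" by simp
  hence "int p = u^2 + v^2" using c by simp
  thus ?thesis unfolding sum2sq_def by blast
qed

text \<open>Descent: if p divides a^2 + b^2 it divides both a and b, so n = p^2 m with m again a sum
  of two squares and the multiplicity lowered by 2.\<close>

lemma sum2sq_imp_even_multiplicity:
  assumes p: "prime p" "p mod 4 = (3::nat)" and "n \<in> sum2sq" "n > 0"
  shows "even (multiplicity p n)"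
  using assms(3,4)
proof (induction n rule: less_induct)
  case (less n)
  show ?case
  proof (cases "p dvd n")
    case False
    thus ?thesis by (simp add: not_dvd_imp_multiplicity_0)
  next
    case True
    obtain a b :: int where ab: "int n = a^2 + b^2" using less.prems unfolding sum2sq_def by auto
    have "int p dvd a^2 + b^2" using True ab by (metis int_dvd_int_iff)
    hence "int p dvd a" "int p dvd b"
      using prime_3_mod_4_dvd_sum_squares[OF p, of a b] prime_3_mod_4_dvd_sum_squares[OF p, of b a]
      by (simp_all add: add.commute[of "b^2"])
    then obtain c d where cd: "a = int p * c" "b = int p * d" by (auto elim!: dvdE)
    have "int n = int p^2 * (c^2 + d^2)" unfolding ab cd by (simp add: power2_eq_square algebra_simps)
    moreover define m where "m = nat (c^2 + d^2)"
    moreover have mi: "int m = c^2 + d^2" unfolding m_def by simp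
    ultimately have "int n = int (p^2 * m)" by simp
    hence n: "n = p^2 * m" by (simp only: of_nat_eq_iff)
    have m: "m \<in> sum2sq" unfolding sum2sq_def using mi by blast
    have m0: "m > 0" using n less.prems by (cases "m = 0") auto
    have "p > 1" using p(1) prime_gt_1_nat by blast
    hence "1 < p ^ 2" by (rule one_less_power) simp
    hence "m < n" using n m0 by simp
    hence "even (multiplicity p m)" using less.IH m m0 by blast
    moreover have "multiplicity p n = 2 + multiplicity p m"
      using p(1) m0 unfolding n
      by (subst prime_elem_multiplicity_mult_distrib) (auto simp: multiplicity_same_power)
    ultimately show ?thesis by simp
  qed
qed

text \<open>Prime factors are stripped off one at a time: 2 and the primes 1 mod 4 are themselves
  sums of two squares, while a prime 3 mod 4 is removed as p^2. Both operations keep the relevant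
  multiplicities even.\<close>

lemma even_multiplicity_imp_sum2sq:
  assumes "\<And>p. prime p \<Longrightarrow> p mod 4 = (3::nat) \<Longrightarrow> even (multiplicity p n)" "n > 0"
  shows "n \<in> sum2sq"
  using assms
proof (induction n rule: less_induct)
  case (less n)
  show ?case
  proof (cases "n = 1")
    case True
    thus ?thesis using square_mem_sum2sq[of 1] by simp
  next
    case False
    then obtain p where p: "prime p" "p dvd n" using prime_factor_nat by blast
    have p1: "p > 1" using p(1) prime_gt_1_nat by blast
    show ?thesis
    proof (cases "p mod 4 = 3")
      case False
      obtain m where m: "n = p * m" using p(2) by (auto elim: dvdE)
      have m0: "m > 0" using m less.prems by (cases "m = 0") auto
      have "m < n" using m p1 m0 by simp
      moreover have "even (multiplicity q m)" if "prime q" "q mod 4 = 3" for q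
      proof -
        have "q \<noteq> p" using that False by auto
        hence "multiplicity q n = multiplicity q m" using that p m0 unfolding m
          by (subst prime_elem_multiplicity_mult_distrib) (auto simp: prime_multiplicity_other)
        thus ?thesis using less.prems(1)[OF that] by simp
      qed
      ultimately have "m \<in> sum2sq" using less.IH m0 by blast
      moreover have "p \<in> sum2sq"
      proof (cases "p = 2")
        case True
        thus ?thesis unfolding sum2sq_def by (auto intro!: exI[of _ 1])
      next
        case False
        hence "odd p" using p(1) prime_odd_nat p1 by force
        hence "p mod 4 = 1" using \<open>p mod 4 \<noteq> 3\<close> by presburger
        thus ?thesis using prime_1_mod_4_mem_sum2sq p by blast
      qed
      ultimately show ?thesis using m sum2sq_mult by simp
    next
      case True
      have "even (multiplicity p n)" using less.prems p True by blast
      moreover have "multiplicity p n \<noteq> 0" using p less.prems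
        by (metis prime_multiplicity_gt_zero_iff neq0_conv less_irrefl prime_imp_prime_elem)
      ultimately have "2 \<le> multiplicity p n" by presburger
      hence "p^2 dvd n" by (rule multiplicity_dvd')
      then obtain m where m: "n = p^2 * m" by (auto elim: dvdE)
      have m0: "m > 0" using m less.prems by (cases "m = 0") auto
      have "1 < p ^ 2" using p1 by (rule one_less_power) simp
      hence "m < n" using m m0 by simp
      moreover have "even (multiplicity q m)" if "prime q" "q mod 4 = 3" for q
      proof -
        have "multiplicity q n = multiplicity q (p^2) + multiplicity q m" using that p m0 unfolding m
          by (subst prime_elem_multiplicity_mult_distrib) auto
        moreover have "even (multiplicity q (p^2))" using that p
          by (simp add: prime_elem_multiplicity_power_distrib)
        ultimately show ?thesis using less.prems(1)[OF that] by simp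
      qed
      ultimately have "m \<in> sum2sq" using less.IH m0 by blast
      thus ?thesis using m sum2sq_mult square_mem_sum2sq by simp
    qed
  qed
qed

lemma sum2sq_iff:
  assumes "n > 0"
  shows "n \<in> sum2sq \<longleftrightarrow> (\<forall>p. prime p \<longrightarrow> p mod 4 = 3 \<longrightarrow> even (multiplicity p n))"
proof (intro iffI allI impI)
  fix p :: nat
  assume "n \<in> sum2sq" "prime p" "p mod 4 = 3"
  thus "even (multiplicity p n)" using sum2sq_imp_even_multiplicity assms by simp
next
  assume "\<forall>p. prime p \<longrightarrow> p mod 4 = 3 \<longrightarrow> even (multiplicity p n)"
  thus "n \<in> sum2sq" using assms by (intro even_multiplicity_imp_sum2sq) auto
qed

text \<open>Multiplicativity of the indicator, as its Euler product requires. At each prime one of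
  the two multiplicities is 0, so the parity of their sum decides both.\<close>

lemma sum2sq_mult_coprime_iff:
  assumes "coprime m n" "m > 0" "n > 0"
  shows "m * n \<in> sum2sq \<longleftrightarrow> m \<in> sum2sq \<and> n \<in> sum2sq"
proof -
  have "even (multiplicity p (m * n)) \<longleftrightarrow> even (multiplicity p m) \<and> even (multiplicity p n)"
    if p: "prime p" for p
  proof -
    have "multiplicity p (m * n) = multiplicity p m + multiplicity p n"
      using assms p by (subst prime_elem_multiplicity_mult_distrib) auto
    moreover have "multiplicity p m = 0 \<or> multiplicity p n = 0"
      using assms p by (metis coprime_common_divisor not_dvd_imp_multiplicity_0 not_prime_unit)
    ultimately show ?thesis by auto
  qed
  thus ?thesis using assms by (auto simp: sum2sq_iff)
qed

lemma prime_power_mem_sum2sq_iff: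
  assumes "prime p"
  shows "p ^ k \<in> sum2sq \<longleftrightarrow> (p mod 4 = 3 \<longrightarrow> even k)"
proof -
  have "p ^ k > 0" using assms prime_gt_0_nat by simp
  moreover have "multiplicity q (p ^ k) = (if q = p then k else 0)" if "prime q" for q
    using that assms by (auto simp: prime_elem_multiplicity_power_distrib prime_multiplicity_other)
  ultimately show ?thesis using assms by (auto simp: sum2sq_iff)
qed

section \<open>Euler products\<close>

text \<open>Induction on A: every n with prime factors in \<open>insert p A\<close> is p^k m for a
  unique k and a unique m free of p. Unconditional sums (\<open>infsum\<close>) permit this
  reindexing and the splitting of the double sum.\<close>

lemma infsum_smooth_euler_product:
  fixes f :: "nat \<Rightarrow> complex"
  assumes f1: "f 1 = 1"
    and mult: "\<And>m n. coprime m n \<Longrightarrow> m > 0 \<Longrightarrow> n > 0 \<Longrightarrow> f (m * n) = f m * f n"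
    and summ: "summable (\<lambda>n. norm (f n))"
    and "finite A" "\<And>p. p \<in> A \<Longrightarrow> prime p"
  shows "infsum f {n. n > 0 \<and> prime_factors n \<subseteq> A} = (\<Prod>p\<in>A. \<Sum>k. f (p ^ k))"
  using assms(4,5)
proof (induction A rule: finite_induct)
  case empty
  have "n = 1" if "n > 0" "prime_factors n \<subseteq> {}" for n :: nat
    using that by (metis subset_empty prime_factorization_empty_iff set_mset_eq_empty_iff nat_dvd_1_iff_1 less_irrefl)
  hence "{n. n > 0 \<and> prime_factors n \<subseteq> {}} = {1::nat}" by auto
  thus ?case using f1 by simp
next
  case (insert p A)
  have p: "prime p" using insert by auto
  have pgt: "p > 1" using p prime_gt_1_nat by blast
  define S where "S = (\<lambda>A. {n::nat. n > 0 \<and> prime_factors n \<subseteq> A})"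
  define h where "h = (\<lambda>(k, m). p ^ k * m)"
  have fsum: "f summable_on X" for X
    using norm_summable_imp_summable_on[OF summ] summable_on_subset_banach by blast
  have ndvd: "\<not> p dvd m" if "m \<in> S A" for m
    using that insert(2) p by (auto simp: S_def in_prime_factors_iff subset_iff)
  have inj: "inj_on h (UNIV \<times> S A)"
  proof (rule inj_onI, clarsimp simp: h_def)
    fix k k' m m' assume m: "m \<in> S A" "m' \<in> S A" and eq: "p ^ k * m = p ^ k' * m'"
    have "multiplicity p (p ^ j * n) = j" if "n \<in> S A" for j n
      using ndvd[OF that] p that
      by (subst prime_elem_multiplicity_mult_distrib)
         (auto simp: not_dvd_imp_multiplicity_0 multiplicity_same_power S_def)
    hence "k = k'" using m eq by metis
    thus "k = k' \<and> m = m'" using eq pgt by simp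
  qed
  have img: "h ` (UNIV \<times> S A) = S (insert p A)"
  proof (intro equalityI subsetI)
    fix n assume "n \<in> h ` (UNIV \<times> S A)"
    then obtain k m where km: "n = p ^ k * m" "m \<in> S A" by (auto simp: h_def)
    have "q \<in> insert p A" if "prime q" "q dvd n" for q
    proof -
      have "q dvd p ^ k \<or> q dvd m" using that km by (simp add: prime_dvd_mult_iff)
      thus ?thesis
      proof
        assume "q dvd p ^ k"
        hence "q dvd p" using that(1) by (rule prime_dvd_power[rotated])
        thus ?thesis using that(1) p by (simp add: primes_dvd_imp_eq)
      next
        assume "q dvd m"
        thus ?thesis using km that(1) by (auto simp: S_def in_prime_factors_iff subset_iff)
      qed
    qed
    thus "n \<in> S (insert p A)" using km pgt
      unfolding S_def by (auto simp: in_prime_factors_iff)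
  next
    fix n assume n: "n \<in> S (insert p A)"
    obtain m where m: "n = p ^ multiplicity p n * m" "\<not> p dvd m"
      using multiplicity_decompose'[of n p] n pgt by (auto simp: S_def)
    have "m > 0" using m(2) by (cases "m = 0") auto
    moreover have "prime_factors m \<subseteq> A"
    proof
      fix q assume "q \<in> prime_factors m"
      hence q: "prime q" "q dvd m" by (auto simp: in_prime_factors_iff)
      have "q \<noteq> p" using q m by auto
      moreover have "q \<in> prime_factors n" using q m(1) n
        by (metis (mono_tags, lifting) S_def dvd_mult in_prime_factors_iff less_numeral_extra(3) mem_Collect_eq)
      ultimately show "q \<in> A" using n by (auto simp: S_def)
    qed
    ultimately have "m \<in> S A" by (simp add: S_def)
    thus "n \<in> h ` (UNIV \<times> S A)" using m(1) by (auto simp: h_def intro!: image_eqI[of _ _ "(multiplicity p n, m)"])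
  qed
  have fh: "(f \<circ> h) summable_on (UNIV \<times> S A)"
    using fsum[of "S (insert p A)"] summable_on_reindex[OF inj, of f] img by simp
  have eq: "(f \<circ> h) (k, m) = f (p ^ k) * f m" if "m \<in> S A" for k m
  proof -
    have "coprime (p ^ k) m" using ndvd[OF that] p by (simp add: prime_imp_coprime)
    thus ?thesis using mult[of "p ^ k" m] that pgt by (simp add: h_def S_def)
  qed
  have "infsum f (S (insert p A)) = infsum (f \<circ> h) (UNIV \<times> S A)"
    using infsum_reindex[OF inj, of f] img by simp
  also have "\<dots> = (\<Sum>\<^sub>\<infinity>k. \<Sum>\<^sub>\<infinity>m\<in>S A. (f \<circ> h) (k, m))"
    using infsum_Sigma_banach[of "f \<circ> h" UNIV "\<lambda>_. S A"] fh by simp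
  also have "\<dots> = (\<Sum>\<^sub>\<infinity>k. f (p ^ k) * infsum f (S A))"
  proof (intro infsum_cong)
    fix k
    have "(\<Sum>\<^sub>\<infinity>m\<in>S A. (f \<circ> h) (k, m)) = (\<Sum>\<^sub>\<infinity>m\<in>S A. f (p ^ k) * f m)"
      using eq by (intro infsum_cong)
    thus "(\<Sum>\<^sub>\<infinity>m\<in>S A. (f \<circ> h) (k, m)) = f (p ^ k) * infsum f (S A)"
      by (simp only: infsum_cmult_right')
  qed
  also have "\<dots> = (\<Sum>\<^sub>\<infinity>k. f (p ^ k)) * infsum f (S A)"
    by (rule infsum_cmult_left')
  also have "(\<Sum>\<^sub>\<infinity>k. f (p ^ k)) = (\<Sum>k. f (p ^ k))"
  proof (rule infsumI, rule norm_summable_imp_has_sum)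
    have "inj (\<lambda>k. p ^ k)" using pgt by (auto intro!: injI)
    hence "summable ((\<lambda>n. norm (f n)) \<circ> (\<lambda>k. p ^ k))"
      using summ by (intro summable_reindex[of "\<lambda>n. norm (f n)"]) auto
    thus s: "summable (\<lambda>k. norm (f (p ^ k)))" by (simp add: o_def)
    show "(\<lambda>k. f (p ^ k)) sums (\<Sum>k. f (p ^ k))"
      using summable_norm_cancel[OF s] by (rule summable_sums)
  qed
  finally show ?case using insert by (simp add: S_def)
qed

text \<open>Tannery's theorem: restricted to the N-smooth n, the terms are dominated by
  \<open>norm (f n)\<close>, and every n > 0 is N-smooth once N \<ge> n. The index 0 never becomes
  smooth, hence the condition \<open>f 0 = 0\<close>.\<close>

theorem euler_product_tendsto:
  fixes f :: "nat \<Rightarrow> complex"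
  assumes f0: "f 0 = 0" and f1: "f 1 = 1"
    and mult: "\<And>m n. coprime m n \<Longrightarrow> m > 0 \<Longrightarrow> n > 0 \<Longrightarrow> f (m * n) = f m * f n"
    and summ: "summable (\<lambda>n. norm (f n))"
  shows "(\<lambda>N. \<Prod>p | prime p \<and> p \<le> N. \<Sum>k. f (p ^ k)) \<longlonglongrightarrow> (\<Sum>n. f n)"
proof -
  define S where "S = (\<lambda>N. {n::nat. n > 0 \<and> prime_factors n \<subseteq> {p. prime p \<and> p \<le> N}})"
  define a where "a = (\<lambda>n N. if n \<in> S N then f n else 0)"
  have "(\<Sum>n. a n N) = (\<Prod>p | prime p \<and> p \<le> N. \<Sum>k. f (p ^ k))" for N
  proof -
    have s: "summable (\<lambda>n. norm (a n N))"
      by (rule summable_comparison_test'[OF summ, of 0]) (auto simp: a_def)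
    have "((\<lambda>n. a n N) has_sum (\<Sum>n. a n N)) UNIV"
      using s summable_norm_cancel[OF s] by (intro norm_summable_imp_has_sum summable_sums)
    hence "(\<Sum>n. a n N) = infsum (\<lambda>n. a n N) UNIV" by (simp add: infsumI)
    also have "\<dots> = infsum f (S N)"
      by (rule infsum_cong_neutral) (auto simp: a_def)
    also have "\<dots> = (\<Prod>p | prime p \<and> p \<le> N. \<Sum>k. f (p ^ k))"
      unfolding S_def by (rule infsum_smooth_euler_product[OF f1 mult summ]) auto
    finally show ?thesis .
  qed
  moreover have "(\<lambda>N. \<Sum>n. a n N) \<longlonglongrightarrow> (\<Sum>n. f n)"
  proof (rule tannerys_theorem[THEN conjunct2, THEN conjunct2])
    fix n
    have "eventually (\<lambda>N. a n N = f n) sequentially"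
      using eventually_ge_at_top[of n]
    proof eventually_elim
      case (elim N)
      have "p \<le> N" if "p \<in> prime_factors n" for p
        using that elim by (metis dvd_imp_le in_prime_factors_iff le_trans neq0_conv)
      thus ?case using f0 by (auto simp: a_def S_def in_prime_factors_iff)
    qed
    thus "(\<lambda>N. a n N) \<longlonglongrightarrow> f n" by (rule tendsto_eventually)
  next
    show "\<forall>\<^sub>F (k, n) in sequentially \<times>\<^sub>F sequentially. cmod (a k n) \<le> norm (f k)"
      by (intro always_eventually) (auto simp: a_def)
  qed (use summ in auto)
  ultimately show ?thesis by simp
qed

section \<open>Logarithmic derivatives and zeros\<close>

text \<open>The map w / (2M - w) sends the half plane Re w < M into the unit disc and fixes 0, so
  the Schwarz lemma applies to its composite with f. The two conclusions of Schwarz give the bound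
  on f and the one on its derivative at the centre.\<close>

lemma Borel_Caratheodory:
  assumes holf: "f holomorphic_on ball z0 R" and R: "R > 0" and M: "M > 0" and f0: "f z0 = 0"
    and bound: "\<And>z. z \<in> ball z0 R \<Longrightarrow> Re (f z) < M"
  shows "z \<in> ball z0 R \<Longrightarrow> norm (f z) \<le> 2 * M * dist z0 z / (R - dist z0 z)"
    and "norm (deriv f z0) \<le> 2 * M / R"
proof -
  define g where "g = (\<lambda>w. f (z0 + of_real R * w))"
  define \<phi> where "\<phi> = (\<lambda>w. g w / (2 * of_real M - g w))"
  have in_ball: "z0 + of_real R * w \<in> ball z0 R" if "norm w < 1" for w
    using that R by (simp add: dist_norm norm_mult)
  have Reg: "Re (g w) < M" if "norm w < 1" for w
    unfolding g_def using bound in_ball that by blast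
  have ne: "2 * of_real M - g w \<noteq> 0" if "norm w < 1" for w
  proof
    assume "2 * of_real M - g w = 0"
    hence "Re (2 * of_real M - g w) = 0" by simp
    thus False using Reg[OF that] M by simp
  qed
  have holg: "g holomorphic_on ball 0 1" unfolding g_def
    using in_ball
    by (intro holomorphic_on_compose_gen[OF _ holf, unfolded o_def]) (auto intro!: holomorphic_intros)
  have hol: "\<phi> holomorphic_on ball 0 1"
    unfolding \<phi>_def by (intro holomorphic_intros holg) (use ne in auto)
  have \<phi>0: "\<phi> 0 = 0" by (simp add: \<phi>_def g_def f0)
  have less: "norm (\<phi> w) < 1" if "norm w < 1" for w
  proof -
    have "(norm (2 * of_real M - g w))\<^sup>2 - (norm (g w))\<^sup>2 = 4 * M * (M - Re (g w))"
      unfolding cmod_power2 by (simp add: power2_eq_square algebra_simps)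
    also have "\<dots> > 0" using M Reg[OF that] by simp
    finally have "(norm (g w))\<^sup>2 < (norm (2 * of_real M - g w))\<^sup>2" by simp
    hence "norm (g w) < norm (2 * of_real M - g w)" by (rule power2_less_imp_less) simp
    thus ?thesis unfolding \<phi>_def using ne[OF that] by (simp add: norm_divide)
  qed
  have Schwarz: "norm (\<phi> w) \<le> norm w" if "norm w < 1" for w
    using Schwarz_Lemma(1)[of \<phi> w] hol \<phi>0 less that by blast
  have Schwarz': "norm (deriv \<phi> 0) \<le> 1"
    using Schwarz_Lemma(2)[of \<phi> 0] hol \<phi>0 less by simp
  {
    assume z: "z \<in> ball z0 R"
    define w where "w = (z - z0) / of_real R"
    have nw: "norm w = dist z0 z / R" using R by (simp add: w_def norm_divide dist_norm norm_minus_commute)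
    have w1: "norm w < 1" using z R by (simp add: nw)
    have zw: "f z = g w" using R by (simp add: g_def w_def)
    have "norm (g w) = norm (\<phi> w) * norm (2 * of_real M - g w)"
      using ne[OF w1] by (simp add: \<phi>_def norm_divide)
    also have "\<dots> \<le> norm w * (2 * M + norm (g w))"
      using Schwarz[OF w1] M norm_triangle_ineq4[of "2 * of_real M" "g w"]
      by (intro mult_mono) (auto simp: norm_mult)
    finally have "norm (g w) * (1 - norm w) \<le> 2 * M * norm w" by (simp add: algebra_simps)
    hence "norm (g w) \<le> 2 * M * norm w / (1 - norm w)" using w1 by (simp add: field_simps)
    also have "\<dots> = 2 * M * dist z0 z / (R - dist z0 z)" using R w1 z unfolding nw by (simp add: field_simps)
    finally show "norm (f z) \<le> 2 * M * dist z0 z / (R - dist z0 z)" using zw by simp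
  }
  have "(f has_field_derivative deriv f z0) (at z0)"
    using holf R by (metis centre_in_ball holomorphic_derivI open_ball)
  hence "(f has_field_derivative deriv f z0) (at (z0 + of_real R * 0))" by simp
  hence g': "(g has_field_derivative deriv f z0 * of_real R) (at 0)"
    unfolding g_def by (rule DERIV_chain2) (auto intro!: derivative_eq_intros)
  have g0: "g 0 = 0" by (simp add: g_def f0)
  have "(\<phi> has_field_derivative deriv f z0 * of_real R / (2 * of_real M)) (at 0)"
    unfolding \<phi>_def using M by (auto intro!: derivative_eq_intros g' simp: g0 field_simps)
  hence "norm (deriv f z0 * of_real R / (2 * of_real M)) \<le> 1"
    using Schwarz' by (simp add: DERIV_imp_deriv)
  thus "norm (deriv f z0) \<le> 2 * M / R" using R M by (simp add: norm_divide norm_mult field_simps)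
qed

section \<open>Holomorphic logarithms, removal of zeros, and Landau's lemma\<close>

lemma starlike_holomorphic_log:
  assumes "starlike S" "open S" "f holomorphic_on S" "\<And>z. z \<in> S \<Longrightarrow> f z \<noteq> 0"
  obtains g where "g holomorphic_on S" "\<And>z. z \<in> S \<Longrightarrow> f z = exp (g z)"
proof -
  have "simply_connected S"
    using assms(1) by (simp add: contractible_imp_simply_connected starlike_imp_contractible)
  thus ?thesis using that assms simply_connected_eq_holomorphic_log[OF assms(2)] by blast
qed

lemma holomorphic_divide_out_zero:
  assumes holf: "f holomorphic_on S" and S: "open S" "connected S"
    and a: "a \<in> S" "f a = 0" and b: "b \<in> S" "f b \<noteq> 0"
  shows "\<exists>n g. n > 0 \<and> g holomorphic_on S \<and> g a \<noteq> 0 \<and> (\<forall>z\<in>S. f z = (z - a) ^ n * g z)"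
proof -
  have "\<not> f constant_on S" using a b by (metis constant_on_def)
  then obtain g r n where g: "0 < n" "0 < r" "ball a r \<subseteq> S" "g holomorphic_on ball a r"
      "\<And>w. w \<in> ball a r \<Longrightarrow> f w = (w - a)^n * g w" "\<And>w. w \<in> ball a r \<Longrightarrow> g w \<noteq> 0"
    using holomorphic_factor_zero_nonconstant[OF holf S a] by metis
  define h where "h = (\<lambda>z. if z = a then g a else f z / (z - a) ^ n)"
  have hg: "h z = g z" if "z \<in> ball a r" for z using g(5)[OF that] by (simp add: h_def)
  have "h holomorphic_on ball a r" by (rule holomorphic_transform[OF g(4)]) (simp add: hg)
  moreover have "(\<lambda>z. f z / (z - a) ^ n) holomorphic_on (S - {a})"
    by (intro holomorphic_intros holomorphic_on_subset[OF holf]) auto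
  hence "h holomorphic_on (S - {a})"
    by (rule holomorphic_transform) (auto simp: h_def)
  ultimately have "h holomorphic_on (ball a r \<union> (S - {a}))"
    using S by (intro holomorphic_on_Un) auto
  moreover have "ball a r \<union> (S - {a}) = S" using g(2,3) a by auto
  ultimately have "h holomorphic_on S" by simp
  moreover have "h a \<noteq> 0" using g(6)[of a] g(2) by (simp add: h_def)
  moreover have "f z = (z - a) ^ n * h z" if "z \<in> S" for z
    using a g(1) by (simp add: h_def)
  ultimately show ?thesis using g(1) by blast
qed

text \<open>Dividing by (z - a)^n does not worsen the constant M: a lies in the disc of radius R/2,
  so |z - a| \<ge> R/2 \<ge> |s0 - a| on the circle of radius R. Zeros can therefore be removed one
  after another.\<close>

lemma Re_log_deriv_ge_of_divided_zero:
  assumes R: "0 < R" "R < R'" and holg: "g holomorphic_on ball s0 R'"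
    and fg: "\<And>z. z \<in> ball s0 R' \<Longrightarrow> f z = (z - a) ^ n * g z"
    and a: "a \<in> cball s0 (R / 2)" "a \<noteq> s0" and f0: "f s0 \<noteq> 0"
    and bound: "\<And>z. dist s0 z = R \<Longrightarrow> norm (f z) \<le> exp M * norm (f s0)"
  shows "g s0 \<noteq> 0" "dist s0 z = R \<Longrightarrow> norm (g z) \<le> exp M * norm (g s0)"
    "deriv f s0 / f s0 = of_nat n / (s0 - a) + deriv g s0 / g s0"
proof -
  have s0: "s0 \<in> ball s0 R'" using R by simp
  show g0: "g s0 \<noteq> 0" using fg[OF s0] f0 by auto
  {
    assume z: "dist s0 z = R"
    have "dist s0 a \<le> dist a z" using a z dist_triangle[of s0 z a] by simp
    hence 1: "norm (s0 - a) ^ n \<le> norm (z - a) ^ n"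
      by (intro power_mono) (auto simp: dist_norm norm_minus_commute)
    have 2: "0 < norm (s0 - a) ^ n" using a by simp
    have "norm (z - a) ^ n * norm (g z) \<le> exp M * (norm (s0 - a) ^ n * norm (g s0))"
      using bound[OF z] fg[of z] fg[OF s0] z R by (simp add: norm_mult norm_power)
    hence "norm (s0 - a) ^ n * norm (g z) \<le> exp M * (norm (s0 - a) ^ n * norm (g s0))"
      using mult_right_mono[OF 1, of "norm (g z)"] by simp
    hence "norm (s0 - a) ^ n * norm (g z) \<le> norm (s0 - a) ^ n * (exp M * norm (g s0))"
      by (simp add: mult_ac)
    thus "norm (g z) \<le> exp M * norm (g s0)" using 2 by (simp only: mult_le_cancel_left_pos)
  }
  have g': "(g has_field_derivative deriv g s0) (at s0)"
    using holg s0 by (metis holomorphic_derivI open_ball)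
  have "((\<lambda>z. (z - a) ^ n * g z) has_field_derivative
          of_nat n * (s0 - a) ^ (n - 1) * g s0 + (s0 - a) ^ n * deriv g s0) (at s0)"
    by (auto intro!: derivative_eq_intros g')
  hence "(f has_field_derivative of_nat n * (s0 - a) ^ (n - 1) * g s0 + (s0 - a) ^ n * deriv g s0) (at s0)"
    by (rule has_field_derivative_transform_within_open[OF _ open_ball s0]) (simp add: fg)
  hence "deriv f s0 = of_nat n * (s0 - a) ^ (n - 1) * g s0 + (s0 - a) ^ n * deriv g s0"
    by (rule DERIV_imp_deriv)
  moreover define d where "d = s0 - a"
  moreover have "d \<noteq> 0" using a by (simp add: d_def)
  ultimately show "deriv f s0 / f s0 = of_nat n / (s0 - a) + deriv g s0 / g s0"
    using fg[OF s0] g0 by (cases n) (simp_all add: add_divide_distrib)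
qed

text \<open>Landau's lemma. A zero a in the half disc contributes Re (n / (s0 - a)) \<ge> 0, because
  it lies to the left of s0, and may be dropped from a lower bound. Induction on the number of
  distinct zeros reduces to a zero-free half disc, where Borel-Caratheodory bounds the derivative of
  log f.\<close>

lemma Re_log_deriv_ge:
  assumes R: "0 < R" "R < R'" and M: "M > 0" and holf: "f holomorphic_on ball s0 R'"
    and f0: "f s0 \<noteq> 0" and bound: "\<And>z. dist s0 z = R \<Longrightarrow> norm (f z) \<le> exp M * norm (f s0)"
    and zeros: "\<And>z. z \<in> cball s0 (R / 2) \<Longrightarrow> f z = 0 \<Longrightarrow> Re z < Re s0"
  shows "Re (deriv f s0 / f s0) \<ge> - (8 * M / R)"
  using holf f0 bound zeros
proof (induction "card {z \<in> cball s0 (R / 2). f z = 0}" arbitrary: f rule: less_induct)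
  case less
  have s0: "s0 \<in> ball s0 R'" using R by simp
  have sub: "cball s0 (R / 2) \<subseteq> ball s0 R'" using R by auto
  show ?case
  proof (cases "\<exists>a \<in> cball s0 (R / 2). f a = 0")
    case False
    have le: "norm (f z) \<le> exp M * norm (f s0)" if "z \<in> ball s0 R" for z
    proof (rule maximum_modulus_frontier[of f "ball s0 R"])
      show "f holomorphic_on interior (ball s0 R)" using R
        by (auto intro: holomorphic_on_subset[OF less.prems(1)])
      show "continuous_on (closure (ball s0 R)) f" using R
        by (intro holomorphic_on_imp_continuous_on holomorphic_on_subset[OF less.prems(1)]) auto
    qed (use that R less.prems(3) in \<open>auto simp: dist_commute\<close>)
    obtain g where g: "g holomorphic_on ball s0 (R/2)" "\<And>z. z \<in> ball s0 (R/2) \<Longrightarrow> f z = exp (g z)"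
      using False R
      by (rule_tac starlike_holomorphic_log[of "ball s0 (R/2)" f])
         (auto intro!: convex_imp_starlike holomorphic_on_subset[OF less.prems(1)])
    have s0': "s0 \<in> ball s0 (R/2)" using R by simp
    define h where "h = (\<lambda>z. g z - g s0)"
    \<comment> \<open>The estimate gives M; doubling it supplies the strict inequality that
      \<open>Borel_Caratheodory\<close> asks for, and with radius R/2 leads to 2 * 2M / (R/2) =
      8M/R.\<close>
    have "Re (h z) < 2 * M" if "z \<in> ball s0 (R/2)" for z
    proof -
      have "exp (Re (h z)) = norm (f z) / norm (f s0)"
        using g(2)[OF that] g(2)[OF s0'] by (simp add: h_def exp_diff norm_divide flip: norm_exp_eq_Re)
      also have "\<dots> \<le> exp M" using le[of z] that R less.prems(2)
        by (simp add: divide_le_eq)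
      finally show ?thesis using M by simp
    qed
    hence "norm (deriv h s0) \<le> 2 * (2 * M) / (R / 2)"
      using R M g(1) by (intro Borel_Caratheodory(2)) (auto simp: h_def intro!: holomorphic_intros)
    moreover have "deriv h s0 = deriv f s0 / f s0"
    proof -
      have g': "(g has_field_derivative deriv g s0) (at s0)"
        using g(1) s0' by (metis holomorphic_derivI open_ball)
      have "((\<lambda>z. exp (g z)) has_field_derivative exp (g s0) * deriv g s0) (at s0)"
        by (auto intro!: derivative_eq_intros g')
      hence "(f has_field_derivative exp (g s0) * deriv g s0) (at s0)"
        by (rule has_field_derivative_transform_within_open[OF _ open_ball s0']) (simp add: g(2))
      hence "deriv f s0 = f s0 * deriv g s0" using g(2)[OF s0'] by (simp add: DERIV_imp_deriv)
      moreover have "deriv h s0 = deriv g s0" unfolding h_def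
        by (intro DERIV_imp_deriv) (auto intro!: derivative_eq_intros g')
      ultimately show ?thesis using less.prems(2) by simp
    qed
    ultimately have "norm (deriv f s0 / f s0) \<le> 8 * M / R" using R by simp
    thus ?thesis using complex_Re_le_cmod[of "- (deriv f s0 / f s0)"] by simp
  next
    case True
    then obtain a where a: "a \<in> cball s0 (R / 2)" "f a = 0" by blast
    have as: "a \<noteq> s0" using a less.prems by auto
    obtain n g where g: "n > 0" "g holomorphic_on ball s0 R'" "g a \<noteq> 0"
        "\<And>z. z \<in> ball s0 R' \<Longrightarrow> f z = (z - a) ^ n * g z"
      using holomorphic_divide_out_zero[OF less.prems(1) open_ball connected_ball subsetD[OF sub a(1)] a(2) s0 less.prems(2)]
      by metis
    note step = Re_log_deriv_ge_of_divided_zero[OF R g(2,4) a(1) as less.prems(2,3)]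
    have "\<not> f constant_on ball s0 R'" using a s0 less.prems(2) sub by (metis constant_on_def subsetD)
    hence fin: "finite {z \<in> cball s0 (R / 2). f z = 0}"
      by (intro holomorphic_compact_finite_zeros[OF less.prems(1) open_ball connected_ball _ sub]) auto
    have "{z \<in> cball s0 (R / 2). g z = 0} \<subseteq> {z \<in> cball s0 (R / 2). f z = 0} - {a}"
      using g sub by auto
    hence "card {z \<in> cball s0 (R / 2). g z = 0} \<le> card ({z \<in> cball s0 (R / 2). f z = 0} - {a})"
      using fin by (intro card_mono) auto
    also have "\<dots> < card {z \<in> cball s0 (R / 2). f z = 0}"
      using a fin by (intro psubset_card_mono) auto
    finally have "- (8 * M / R) \<le> Re (deriv g s0 / g s0)"
      using g(2,4) step(1,2) less.prems(4) sub by (intro less.hyps) auto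
    moreover have "Re (of_nat n / (s0 - a)) \<ge> 0"
      using less.prems(4)[OF a] by (simp add: Re_divide)
    ultimately show ?thesis using step(3) by simp
  qed
qed

text \<open>The known zero at distance d is kept and contributes n/d \<ge> 1/d; the quotient by its
  linear factors satisfies the same assumptions and is handled by
  \<open>Re_log_deriv_ge\<close>.\<close>

lemma Re_log_deriv_ge_zero:
  assumes R: "0 < R" "R < R'" and M: "M > 0" and holf: "f holomorphic_on ball s0 R'"
    and f0: "f s0 \<noteq> 0" and bound: "\<And>z. dist s0 z = R \<Longrightarrow> norm (f z) \<le> exp M * norm (f s0)"
    and zeros: "\<And>z. z \<in> cball s0 (R / 2) \<Longrightarrow> f z = 0 \<Longrightarrow> Re z < Re s0"
    and d: "0 < d" "d \<le> R / 2" "f (s0 - of_real d) = 0"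
  shows "Re (deriv f s0 / f s0) \<ge> 1 / d - 8 * M / R"
proof -
  define a where "a = s0 - of_real d"
  have a: "a \<in> cball s0 (R / 2)" "a \<noteq> s0" "f a = 0" using d by (auto simp: a_def dist_norm)
  have s0: "s0 \<in> ball s0 R'" using R by simp
  have sub: "cball s0 (R / 2) \<subseteq> ball s0 R'" using R by auto
  obtain n g where g: "n > 0" "g holomorphic_on ball s0 R'" "g a \<noteq> 0"
      "\<And>z. z \<in> ball s0 R' \<Longrightarrow> f z = (z - a) ^ n * g z"
    using holomorphic_divide_out_zero[OF holf open_ball connected_ball subsetD[OF sub a(1)] a(3) s0 f0]
    by metis
  note step = Re_log_deriv_ge_of_divided_zero[OF R g(2,4) a(1,2) f0 bound]
  have "- (8 * M / R) \<le> Re (deriv g s0 / g s0)"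
    using g(2,4) step(1,2) zeros sub by (intro Re_log_deriv_ge[OF R M]) auto
  moreover have "of_nat n / (s0 - a) = of_real (real n / d)" by (simp add: a_def)
  hence "Re (of_nat n / (s0 - a)) = real n / d" by (metis Re_complex_of_real)
  moreover have "real n / d \<ge> 1 / d" using g(1) d by (intro divide_right_mono) auto
  ultimately show ?thesis using step(3) by simp
qed

section \<open>Continuation of the Dirichlet series to the half plane Re s > 1/2\<close>

text \<open>The continuous factor B is bounded on closed discs, so the Weierstrass test applies
  locally even where, as for a power of |s|, it is unbounded on S.\<close>

lemma holomorphic_on_suminf:
  fixes f :: "nat \<Rightarrow> complex \<Rightarrow> complex"
  assumes S: "open S" and hol: "\<And>n. f n holomorphic_on S"
    and B: "continuous_on S B" and M: "summable M" "\<And>n. M n \<ge> 0"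
    and bound: "\<And>n s. s \<in> S \<Longrightarrow> norm (f n s) \<le> B s * M n"
  shows "(\<lambda>s. \<Sum>n. f n s) holomorphic_on S"
proof (rule holomorphic_uniform_sequence[OF S])
  show "(\<lambda>s. \<Sum>n<N. f n s) holomorphic_on S" for N by (intro holomorphic_intros hol)
next
  fix x assume "x \<in> S"
  then obtain d where d: "d > 0" "cball x d \<subseteq> S" using S open_contains_cball by blast
  have "compact (B ` cball x d)"
    by (intro compact_continuous_image continuous_on_subset[OF B d(2)] compact_cball)
  hence "bdd_above (B ` cball x d)" by (intro bounded_imp_bdd_above compact_imp_bounded)
  then obtain C where C: "\<And>s. s \<in> cball x d \<Longrightarrow> B s \<le> C"
    unfolding bdd_above_def by blast
  have "uniform_limit (cball x d) (\<lambda>N s. \<Sum>n<N. f n s) (\<lambda>s. \<Sum>n. f n s) sequentially"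
  proof (rule Weierstrass_m_test)
    fix n s assume s: "s \<in> cball x d"
    have "norm (f n s) \<le> B s * M n" using s d bound by blast
    also have "\<dots> \<le> C * M n" using C[OF s] M by (intro mult_right_mono) auto
    finally show "norm (f n s) \<le> C * M n" .
  qed (use M in \<open>auto intro: summable_mult\<close>)
  thus "\<exists>d>0. cball x d \<subseteq> S \<and> uniform_limit (cball x d) (\<lambda>N s. \<Sum>n<N. f n s) (\<lambda>s. \<Sum>n. f n s) sequentially"
    using d by blast
qed

text \<open>Brackets of fixed length may be removed when the terms tend to 0: a partial sum differs
  from a complete-bracket sum by fewer than m small terms. The defining series of \<open>eta\<close>
  and \<open>L_chi4\<close> converge only conditionally for Re s \<le> 1, whereas their grouped
  forms converge absolutely for Re s > 1/2.\<close>

lemma sums_of_grouped: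
  fixes a :: "nat \<Rightarrow> 'a :: real_normed_vector"
  assumes m: "m > 0" and a0: "a \<longlonglongrightarrow> 0" and s: "(\<lambda>k. \<Sum>i<m. a (k * m + i)) sums l"
  shows "a sums l"
proof -
  define S where "S = (\<lambda>N. \<Sum>n<N. a n)"
  have S_add: "S (k + j) = S k + (\<Sum>i<j. a (k + i))" for k j
    unfolding S_def by (induction j) (auto simp: add.assoc)
  have "S (k * m) = (\<Sum>j<k. \<Sum>i<m. a (j * m + i))" for k
  proof (induction k)
    case (Suc k)
    have "S (Suc k * m) = S (k * m + m)" by (simp add: add.commute)
    also have "\<dots> = S (k * m) + (\<Sum>i<m. a (k * m + i))"
      by (rule S_add)
    finally show ?case using Suc by simp
  qed (simp add: S_def)
  hence Sm: "(\<lambda>k. S (k * m)) \<longlonglongrightarrow> l" using s by (simp add: sums_def)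
  have div: "filterlim (\<lambda>N. N div m) at_top sequentially"
    unfolding filterlim_at_top
  proof
    fix Z
    show "\<forall>\<^sub>F N in sequentially. Z \<le> N div m"
      using eventually_ge_at_top[of "Z * m"] by eventually_elim (use m in \<open>simp add: less_eq_div_iff_mult_less_eq\<close>)
  qed
  have "(\<lambda>k. \<Sum>i<m. norm (a (k * m + i))) \<longlonglongrightarrow> (\<Sum>i<m. norm (0::'a))"
  proof (intro tendsto_sum tendsto_norm)
    fix i
    have "filterlim (\<lambda>k. k * m + i) at_top sequentially"
      by (rule filterlim_at_top_mono[OF filterlim_ident]) (use m in \<open>auto intro!: always_eventually trans_le_add1\<close>)
    thus "(\<lambda>k. a (k * m + i)) \<longlonglongrightarrow> 0" by (rule filterlim_compose[OF a0])
  qed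
  hence e: "(\<lambda>k. \<Sum>i<m. norm (a (k * m + i))) \<longlonglongrightarrow> 0" by simp
  have split: "S N - S (N div m * m) = (\<Sum>i<N mod m. a (N div m * m + i))" for N
    using S_add[of "N div m * m" "N mod m"] by simp
  have "(\<lambda>N. S N - S (N div m * m)) \<longlonglongrightarrow> 0"
  proof (rule Lim_null_comparison[OF always_eventually filterlim_compose[OF e div]], rule allI)
    fix N
    have "norm (S N - S (N div m * m)) \<le> (\<Sum>i<N mod m. norm (a (N div m * m + i)))"
      unfolding split by (rule norm_sum)
    also have "\<dots> \<le> (\<Sum>i<m. norm (a (N div m * m + i)))"
      using m by (intro sum_mono2) (auto intro: less_trans[OF _ mod_less_divisor])
    finally show "norm (S N - S (N div m * m)) \<le> (\<Sum>i<m. norm (a (N div m * m + i)))" .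
  qed
  hence "(\<lambda>N. (S N - S (N div m * m)) + S (N div m * m)) \<longlonglongrightarrow> 0 + l"
    by (intro tendsto_add filterlim_compose[OF Sm div])
  thus ?thesis by (simp add: sums_def S_def)
qed

section \<open>Bounds for differences of Dirichlet terms\<close>

lemma norm_powr_diff_le:
  fixes w :: complex
  assumes ab: "0 < a" "a \<le> b" and B: "\<And>u. a \<le> u \<Longrightarrow> u \<le> b \<Longrightarrow> u powr (Re w - 1) \<le> B"
  shows "norm (of_real b powr w - of_real a powr w) \<le> norm w * B * (b - a)"
proof -
  let ?S = "closed_segment (complex_of_real a) (of_real b)"
  have "norm (complex_of_real b powr w - of_real a powr w) \<le> norm w * B * norm (complex_of_real b - of_real a)"
  proof (rule field_differentiable_bound[of ?S])
    fix z assume "z \<in> ?S"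
    then obtain u where u: "z = of_real u" "a \<le> u" "u \<le> b"
      using ab by (auto simp: closed_segment_of_real closed_segment_eq_real_ivl)
    have "z \<notin> \<real>\<^sub>\<le>\<^sub>0" using u ab by (auto simp: complex_nonpos_Reals_iff)
    thus "((\<lambda>z. z powr w) has_field_derivative w * z powr (w - 1)) (at z within ?S)"
      by (rule has_field_derivative_powr[THEN has_field_derivative_at_within])
    show "norm (w * z powr (w - 1)) \<le> norm w * B"
      using u ab B[of u] by (auto simp: norm_mult norm_powr_real_powr intro!: mult_left_mono)
  qed auto
  also have "norm (complex_of_real b - of_real a) = b - a"
    using ab by (metis norm_of_real of_real_diff abs_of_nonneg diff_ge_0_iff_ge)
  finally show ?thesis .
qed

lemma norm_powr_minus_diff_le:
  assumes ab: "0 < a" "a \<le> b" and s: "Re s \<ge> 0"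
  shows "norm (of_real b powr (-s) - of_real a powr (-s)) \<le> norm s * a powr (- Re s - 1) * (b - a)"
proof -
  have "norm (of_real b powr (-s) - of_real a powr (-s)) \<le> norm (-s) * a powr (- Re s - 1) * (b - a)"
    using ab s by (intro norm_powr_diff_le) (auto intro!: powr_mono2')
  thus ?thesis by simp
qed

text \<open>The minimum of 2A and q A is at most 2 A q^\<theta> for every \<theta> in [0, 1]; here
  \<theta> = 3/4.\<close>

lemma le_interpolate:
  fixes X A q :: real
  assumes "X \<le> 2 * A" "X \<le> q * A" "A \<ge> 0" "q \<ge> 0"
  shows "X \<le> 2 * A * q powr (3/4)"
proof (cases "q \<le> 1")
  case True
  hence "q \<le> q powr (3/4)" using assms powr_mono'[of "3/4" 1 q] by simp
  hence "q * A \<le> q powr (3/4) * A" using assms by (intro mult_right_mono)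
  also have "\<dots> \<le> 2 * (q powr (3/4) * A)" using assms by simp
  finally show ?thesis using assms by (simp add: mult_ac)
next
  case False
  hence "1 \<le> q powr (3/4)" by (simp add: ge_one_powr_ge_zero)
  hence "2 * A * 1 \<le> 2 * A * q powr (3/4)" using assms by (intro mult_left_mono) auto
  thus ?thesis using assms by simp
qed

lemma summable_five_quarters: "summable (\<lambda>n. real (Suc n) powr (-5/4))"
  using summable_Suc_iff[of "\<lambda>n. real n powr (-5/4)"] by (simp add: summable_real_powr_iff)

text \<open>Interpolates between the trivial bound a^(-Re s) and the mean value bound |s| a^(-Re s -
  1). On Re s \<ge> 1/2 the weight 3/4 leaves n^(-1/2 - 3/4) = n^(-5/4). A weight above 1/2 makes
  this summable; a weight below 1 keeps the growth in |s| small enough for the later contour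
  integral with its kernel of order |t|^(-2).\<close>

lemma powr_interpolate_le:
  assumes "Re s \<ge> 1/2" "a \<ge> real (Suc n)" "X \<le> 2 * a powr (- Re s)" "X \<le> c * norm s / a * a powr (- Re s)" "c \<ge> 0"
  shows "X \<le> 2 * c powr (3/4) * norm s powr (3/4) * real (Suc n) powr (-5/4)"
proof -
  have a: "a \<ge> 1" using assms(2) by simp
  have "X \<le> 2 * a powr (- Re s) * (c * norm s / a) powr (3/4)"
    using assms a by (intro le_interpolate) auto
  also have "\<dots> = 2 * c powr (3/4) * norm s powr (3/4) * a powr (- Re s - 3/4)"
    using a assms by (simp add: powr_divide powr_mult powr_diff)
  also have "\<dots> \<le> 2 * c powr (3/4) * norm s powr (3/4) * a powr (-5/4)"
    using a assms(1) by (intro mult_left_mono powr_mono) auto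
  also have "\<dots> \<le> 2 * c powr (3/4) * norm s powr (3/4) * real (Suc n) powr (-5/4)"
    using assms(2) by (intro mult_left_mono powr_mono2') auto
  finally show ?thesis .
qed

text \<open>The admissible gap 2 covers the pairs 4n+1, 4n+3 of \<open>L_chi4\<close> as well as the
  pairs 2n+1, 2n+2 of \<open>eta\<close>.\<close>

lemma norm_dirichlet_diff_le:
  assumes s: "Re s \<ge> 1/2" and a: "a \<ge> real (Suc n)" "a \<le> b" "b \<le> a + 2"
  shows "norm (of_real a powr (-s) - of_real b powr (-s)) \<le> 4 * norm s powr (3/4) * real (Suc n) powr (-5/4)"
proof -
  have a0: "a > 0" using a by simp
  have "norm (of_real a powr (-s) - of_real b powr (-s)) \<le> 2 * 2 powr (3/4) * norm s powr (3/4) * real (Suc n) powr (-5/4)"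
  proof (rule powr_interpolate_le[OF s a(1)])
    have "norm (of_real a powr (-s) - of_real b powr (-s)) \<le> a powr (- Re s) + b powr (- Re s)"
      using a0 a by (intro order_trans[OF norm_triangle_ineq4]) (auto simp: norm_powr_real_powr)
    also have "b powr (- Re s) \<le> a powr (- Re s)" using a0 a s by (intro powr_mono2') auto
    finally show "norm (of_real a powr (-s) - of_real b powr (-s)) \<le> 2 * a powr (- Re s)" by simp
    have "norm (of_real a powr (-s) - of_real b powr (-s)) \<le> norm s * a powr (- Re s - 1) * (b - a)"
      using norm_powr_minus_diff_le[of a b s] a0 a s by (simp add: norm_minus_commute)
    also have "\<dots> \<le> norm s * a powr (- Re s - 1) * 2"
      using a by (intro mult_left_mono) auto
    also have "\<dots> = 2 * norm s / a * a powr (- Re s)" using a0 by (simp add: powr_diff)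
    finally show "norm (of_real a powr (-s) - of_real b powr (-s)) \<le> 2 * norm s / a * a powr (- Re s)" .
  qed simp
  also have "\<dots> \<le> 2 * 2 * norm s powr (3/4) * real (Suc n) powr (-5/4)"
    using powr_mono[of "3/4" 1 "2::real"] by (intro mult_right_mono) auto
  finally show ?thesis by simp
qed

lemma dirichlet_diff_series:
  fixes a b :: "nat \<Rightarrow> real"
  assumes ab: "\<And>n. a n \<ge> real (Suc n)" "\<And>n. a n \<le> b n" "\<And>n. b n \<le> a n + 2"
  defines "D \<equiv> \<lambda>s. \<Sum>n. of_real (a n) powr (-s) - complex_of_real (b n) powr (-s)"
  shows "D holomorphic_on {s. Re s > 1/2}"
    and "Re s \<ge> 1/2 \<Longrightarrow> summable (\<lambda>n. of_real (a n) powr (-s) - complex_of_real (b n) powr (-s))"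
    and "Re s \<ge> 1/2 \<Longrightarrow> norm (D s) \<le> 4 * (\<Sum>n. real (Suc n) powr (-5/4)) * norm s powr (3/4)"
proof -
  let ?f = "\<lambda>n s. of_real (a n) powr (-s) - complex_of_real (b n) powr (-s)"
  have bound: "norm (?f n s) \<le> 4 * norm s powr (3/4) * real (Suc n) powr (-5/4)" if "Re s \<ge> 1/2" for n s
    using norm_dirichlet_diff_le[OF that ab] .
  have pos: "a n > 0" "b n > 0" for n using ab(1,2)[of n] by auto
  show "D holomorphic_on {s. Re s > 1/2}" unfolding D_def
  proof (rule holomorphic_on_suminf[where B = "\<lambda>s. 4 * norm s powr (3/4)" and M = "\<lambda>n. real (Suc n) powr (-5/4)"])
    show "(\<lambda>s. ?f n s) holomorphic_on {s. 1/2 < Re s}" for n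
      using pos[of n] by (auto intro!: holomorphic_intros)
    show "continuous_on {s. 1/2 < Re s} (\<lambda>s. 4 * norm s powr (3/4))"
      by (intro continuous_intros) auto
    fix n s assume "s \<in> {s. 1/2 < Re s}"
    thus "norm (?f n s) \<le> 4 * norm s powr (3/4) * real (Suc n) powr (-5/4)" using bound by simp
  qed (rule open_halfspace_Re_gt summable_five_quarters powr_ge_zero)+
  assume s: "Re s \<ge> 1/2"
  have sn: "summable (\<lambda>n. norm (?f n s))"
    by (rule summable_comparison_test'[OF summable_mult[OF summable_five_quarters, of "4 * norm s powr (3/4)"], of 0])
       (use bound[OF s] in auto)
  show "summable (\<lambda>n. ?f n s)" using sn by (rule summable_norm_cancel)
  have "norm (D s) \<le> (\<Sum>n. norm (?f n s))" unfolding D_def by (rule summable_norm[OF sn])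
  also have "\<dots> \<le> (\<Sum>n. 4 * norm s powr (3/4) * real (Suc n) powr (-5/4))"
    by (intro suminf_le bound[OF s] sn summable_mult summable_five_quarters)
  also have "\<dots> = 4 * norm s powr (3/4) * (\<Sum>n. real (Suc n) powr (-5/4))"
    by (rule suminf_mult[OF summable_five_quarters])
  finally show "norm (D s) \<le> 4 * (\<Sum>n. real (Suc n) powr (-5/4)) * norm s powr (3/4)" by (simp add: mult_ac)
qed

lemma tendsto_nat_powr_minus:
  assumes "Re s > 0" shows "(\<lambda>n. of_nat (Suc n) powr (-s)) \<longlonglongrightarrow> (0::complex)"
proof (rule tendsto_norm_zero_cancel)
  have "(\<lambda>n. real (Suc n) powr (- Re s)) \<longlonglongrightarrow> 0"
    using assms by (intro tendsto_neg_powr filterlim_compose[OF filterlim_real_sequentially filterlim_Suc]) auto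
  thus "(\<lambda>n. norm (of_nat (Suc n) powr (-s) :: complex)) \<longlonglongrightarrow> 0"
    by (simp add: norm_powr_real_powr)
qed

lemma L_chi4_eq_diff_series:
  assumes "Re s > 1/2"
  shows "L_chi4 s = (\<Sum>n. of_real (real (4*n+1)) powr (-s) - of_real (real (4*n+3)) powr (-s))"
proof -
  let ?f = "\<lambda>n. complex_of_real (real (4*n+1)) powr (-s) - of_real (real (4*n+3)) powr (-s)"
  let ?a = "\<lambda>n. of_int (chi4 (Suc n)) * (of_nat (Suc n)) powr (- s) :: complex"
  have "?a sums suminf ?f"
  proof (rule sums_of_grouped[of 4])
    show "?a \<longlonglongrightarrow> 0"
    proof (rule Lim_null_comparison)
      show "\<forall>\<^sub>F n in sequentially. norm (?a n) \<le> norm (of_nat (Suc n) powr (-s) :: complex)"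
        by (intro always_eventually allI) (simp add: chi4_def norm_mult)
      show "(\<lambda>n. norm (of_nat (Suc n) powr (-s) :: complex)) \<longlonglongrightarrow> 0"
        using tendsto_nat_powr_minus[of s] assms by (intro tendsto_norm_zero) auto
    qed
    have "summable ?f" using assms by (intro dirichlet_diff_series(2)) auto
    moreover have "(\<Sum>i<4. ?a (k * 4 + i)) = ?f k" for k
    proof -
      have "chi4 (Suc (k*4)) = 1" "chi4 (Suc (k*4+1)) = 0" "chi4 (Suc (k*4+2)) = -1" "chi4 (Suc (k*4+3)) = 0"
        unfolding chi4_def by presburger+
      thus ?thesis by (simp add: eval_nat_numeral algebra_simps)
    qed
    ultimately show "(\<lambda>k. \<Sum>i<4. ?a (k * 4 + i)) sums suminf ?f" using summable_sums by simp
  qed simp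
  thus ?thesis unfolding L_chi4_def by (simp add: sums_iff)
qed

lemma eta_eq_diff_series:
  assumes "Re s > 1/2"
  shows "eta s = (\<Sum>n. of_real (real (2*n+1)) powr (-s) - of_real (real (2*n+2)) powr (-s))"
proof -
  let ?f = "\<lambda>n. complex_of_real (real (2*n+1)) powr (-s) - of_real (real (2*n+2)) powr (-s)"
  let ?a = "\<lambda>n. (-1) ^ n * (of_nat (Suc n)) powr (- s) :: complex"
  have "?a sums suminf ?f"
  proof (rule sums_of_grouped[of 2])
    show "?a \<longlonglongrightarrow> 0"
    proof (rule Lim_null_comparison)
      show "\<forall>\<^sub>F n in sequentially. norm (?a n) \<le> norm (of_nat (Suc n) powr (-s) :: complex)"
        by (intro always_eventually allI) (simp add: norm_mult norm_power)
      show "(\<lambda>n. norm (of_nat (Suc n) powr (-s) :: complex)) \<longlonglongrightarrow> 0"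
        using tendsto_nat_powr_minus[of s] assms by (intro tendsto_norm_zero) auto
    qed
    have "summable ?f" using assms by (intro dirichlet_diff_series(2)) auto
    moreover have "(\<Sum>i<2. ?a (k * 2 + i)) = ?f k" for k
    proof -
      have "(\<Sum>i<2. ?a (k * 2 + i)) = ?a (k * 2) + ?a (k * 2 + 1)" by (simp add: numeral_2_eq_2)
      also have "?a (k * 2) = of_real (real (2*k+1)) powr (-s)" by (simp add: mult.commute add.commute)
      also have "?a (k * 2 + 1) = - (of_real (real (2*k+2)) powr (-s))" by (simp add: mult.commute add.commute)
      finally show ?thesis by simp
    qed
    ultimately show "(\<lambda>k. \<Sum>i<2. ?a (k * 2 + i)) sums suminf ?f" using summable_sums by simp
  qed simp
  thus ?thesis unfolding eta_def by (simp add: sums_iff)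
qed

lemma holomorphic_L_chi4: "L_chi4 holomorphic_on {s. Re s > 1/2}"
proof -
  have "(\<lambda>s. \<Sum>n. of_real (real (4*n+1)) powr (-s) - of_real (real (4*n+3)) powr (-s)) holomorphic_on {s. Re s > 1/2}"
    by (intro dirichlet_diff_series(1)) auto
  thus ?thesis by (rule holomorphic_transform) (simp add: L_chi4_eq_diff_series)
qed

lemma holomorphic_eta: "eta holomorphic_on {s. Re s > 1/2}"
proof -
  have "(\<lambda>s. \<Sum>n. of_real (real (2*n+1)) powr (-s) - of_real (real (2*n+2)) powr (-s)) holomorphic_on {s. Re s > 1/2}"
    by (intro dirichlet_diff_series(1)) auto
  thus ?thesis by (rule holomorphic_transform) (simp add: eta_eq_diff_series)
qed

lemma L_chi4_bound: "\<exists>C>0. \<forall>s. Re s > 1/2 \<longrightarrow> norm (L_chi4 s) \<le> C * norm s powr (3/4)"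
proof -
  let ?C = "4 * (\<Sum>n. real (Suc n) powr (-5/4))"
  have le: "norm (L_chi4 s) \<le> ?C * norm s powr (3/4)" if "Re s > 1/2" for s
    unfolding L_chi4_eq_diff_series[OF that] using that by (intro dirichlet_diff_series(3)) auto
  have "?C * norm s powr (3/4) \<le> max 1 ?C * norm s powr (3/4)" for s :: complex
    by (intro mult_right_mono max.cobounded2 powr_ge_zero)
  note order_trans[OF le this]
  thus ?thesis by (intro exI[of _ "max 1 ?C"] conjI allI impI) (rule less_le_trans[OF zero_less_one max.cobounded1])
qed

text \<open>The paired terms 1/(4n+1) - 1/(4n+3) are all positive. This is the non-vanishing that
  makes \<open>Zreg\<close> nonzero at 1.\<close>

lemma L_chi4_one_pos: "Re (L_chi4 1) > 0"
proof -
  let ?f = "\<lambda>n. complex_of_real (real (4*n+1)) powr (-1) - of_real (real (4*n+3)) powr (-1)"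
  have eq: "?f n = of_real (1 / real (4*n+1) - 1 / real (4*n+3))" for n
    by (simp add: powr_minus divide_inverse)
  have "summable ?f" by (intro dirichlet_diff_series(2)) auto
  hence "summable (\<lambda>n. 1 / real (4*n+1) - 1 / real (4*n+3))" by (simp only: eq summable_of_real_iff)
  hence "(\<Sum>n. 1 / real (4*n+1) - 1 / real (4*n+3)) > 0"
    by (intro suminf_pos) (auto intro!: divide_strict_left_mono)
  moreover have "L_chi4 1 = of_real (\<Sum>n. 1 / real (4*n+1) - 1 / real (4*n+3))"
    using L_chi4_eq_diff_series[of 1] \<open>summable (\<lambda>n. 1 / real (4*n+1) - 1 / real (4*n+3))\<close>
    by (simp only: eq suminf_of_real) simp
  ultimately show ?thesis by simp
qed

text \<open>The continuation of \<open>(s - 1) \<zeta>(s)\<close>: the summands are \<open>(s - 1) (n\<^sup>-\<^sup>s - \<integral> u\<^sup>-\<^sup>s du)\<close>, the integral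
  being over \<open>[n, n + 1]\<close>.\<close>

definition zeta_reg :: "complex \<Rightarrow> complex" where
  "zeta_reg s = 1 + (\<Sum>n. (s - 1) * of_nat (Suc n) powr (- s)
      + (of_nat (Suc (Suc n)) powr (1 - s) - of_nat (Suc n) powr (1 - s)))"

text \<open>The summand is the increment over [m, m + 1] of u^(1-s) + (s - 1) m^(-s) u, whose
  derivative is -(s - 1) (u^(-s) - m^(-s)). The mean value inequality thus replaces the integral,
  and the difference of powers is interpolated as before.\<close>

lemma norm_zeta_reg_term_le:
  assumes s: "Re s \<ge> 1/2"
  shows "norm ((s - 1) * of_nat (Suc n) powr (- s)
      + (of_nat (Suc (Suc n)) powr (1 - s) - of_nat (Suc n) powr (1 - s)))
    \<le> 2 * norm (s - 1) * norm s powr (3/4) * real (Suc n) powr (-5/4)"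
proof -
  define m where "m = real (Suc n)"
  have m: "m > 0" by (simp add: m_def)
  let ?S = "closed_segment (complex_of_real m) (of_real (m + 1))"
  define \<phi> where "\<phi> = (\<lambda>u. u powr (1 - s) + (s - 1) * of_real m powr (-s) * u)"
  have "norm (\<phi> (of_real (m + 1)) - \<phi> (of_real m))
      \<le> norm (s - 1) * (2 * 1 powr (3/4) * norm s powr (3/4) * real (Suc n) powr (-5/4)) * norm (complex_of_real (m + 1) - of_real m)"
  proof (rule field_differentiable_bound[of ?S])
    fix z assume "z \<in> ?S"
    then obtain u where u: "z = of_real u" "m \<le> u" "u \<le> m + 1"
      unfolding closed_segment_of_real closed_segment_eq_real_ivl by auto
    have z: "z \<notin> \<real>\<^sub>\<le>\<^sub>0" using u m by (auto simp: complex_nonpos_Reals_iff)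
    show "(\<phi> has_field_derivative (1 - s) * z powr (1 - s - 1) + (s - 1) * of_real m powr (-s)) (at z within ?S)"
      unfolding \<phi>_def using z by (auto intro!: derivative_eq_intros)
    have "norm (z powr (-s) - of_real m powr (-s)) \<le> 2 * 1 powr (3/4) * norm s powr (3/4) * real (Suc n) powr (-5/4)"
    proof (rule powr_interpolate_le[OF s])
      have "norm (z powr (-s) - of_real m powr (-s)) \<le> u powr (- Re s) + m powr (- Re s)"
        using u m by (intro order_trans[OF norm_triangle_ineq4]) (auto simp: norm_powr_real_powr)
      also have "u powr (- Re s) \<le> m powr (- Re s)" using u m s by (intro powr_mono2') auto
      finally show "norm (z powr (-s) - of_real m powr (-s)) \<le> 2 * m powr (- Re s)" by simp
      have "norm (z powr (-s) - of_real m powr (-s)) \<le> norm s * m powr (- Re s - 1) * (u - m)"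
        using norm_powr_minus_diff_le[of m u s] u m s by simp
      also have "\<dots> \<le> norm s * m powr (- Re s - 1) * 1"
        using u by (intro mult_left_mono) auto
      also have "\<dots> = 1 * norm s / m * m powr (- Re s)" using m by (simp add: powr_diff)
      finally show "norm (z powr (-s) - of_real m powr (-s)) \<le> 1 * norm s / m * m powr (- Re s)" .
    qed (auto simp: m_def)
    moreover have "(1 - s) * z powr (1 - s - 1) + (s - 1) * of_real m powr (-s) = - ((s - 1) * (z powr (-s) - of_real m powr (-s)))"
      by (simp add: algebra_simps)
    ultimately show "norm ((1 - s) * z powr (1 - s - 1) + (s - 1) * of_real m powr (-s)) \<le>
        norm (s - 1) * (2 * 1 powr (3/4) * norm s powr (3/4) * real (Suc n) powr (-5/4))"
      by (simp only: norm_minus_cancel norm_mult mult_left_mono norm_ge_zero)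
  qed auto
  moreover have "\<phi> (of_real (m + 1)) - \<phi> (of_real m) = (s - 1) * of_nat (Suc n) powr (- s)
      + (of_nat (Suc (Suc n)) powr (1 - s) - of_nat (Suc n) powr (1 - s))"
    by (simp add: \<phi>_def m_def algebra_simps)
  ultimately show ?thesis by (simp add: mult_ac)
qed

lemma holomorphic_zeta_reg: "zeta_reg holomorphic_on {s. Re s > 1/2}"
proof -
  have "(\<lambda>s. \<Sum>n. (s - 1) * of_nat (Suc n) powr (- s)
      + (of_nat (Suc (Suc n)) powr (1 - s) - of_nat (Suc n) powr (1 - s))) holomorphic_on {s. Re s > 1/2}"
    (is "(\<lambda>s. \<Sum>n. ?f n s) holomorphic_on _")
  proof (rule holomorphic_on_suminf[where B = "\<lambda>s. 2 * norm (s - 1) * norm s powr (3/4)" and M = "\<lambda>n. real (Suc n) powr (-5/4)"])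
    show "?f n holomorphic_on {s. 1/2 < Re s}" for n
      by (intro holomorphic_intros) (auto simp del: of_nat_Suc)
    show "continuous_on {s. 1/2 < Re s} (\<lambda>s. 2 * norm (s - 1) * norm s powr (3/4))"
      by (intro continuous_intros) auto
    fix n s assume "s \<in> {s. 1/2 < Re s}"
    thus "norm (?f n s) \<le> 2 * norm (s - 1) * norm s powr (3/4) * real (Suc n) powr (-5/4)"
      by (intro norm_zeta_reg_term_le) simp
  qed (rule open_halfspace_Re_gt summable_five_quarters powr_ge_zero)+
  thus ?thesis unfolding zeta_reg_def[abs_def] by (intro holomorphic_intros)
qed

lemma summable_zeta_reg_terms:
  assumes s: "Re s \<ge> 1/2"
  shows "summable (\<lambda>n. norm ((s - 1) * of_nat (Suc n) powr (- s)
      + (of_nat (Suc (Suc n)) powr (1 - s) - of_nat (Suc n) powr (1 - s))))"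
  by (rule summable_comparison_test'[OF summable_mult[OF summable_five_quarters, of "2 * norm (s - 1) * norm s powr (3/4)"], of 0])
     (use norm_zeta_reg_term_le[OF s] in auto)

lemma zeta_reg_bound:
  "\<exists>C>0. \<forall>s. Re s \<ge> 1/2 \<longrightarrow> norm (zeta_reg s) \<le> 1 + C * norm (s - 1) * norm s powr (3/4)"
proof -
  let ?c = "\<Sum>n. real (Suc n) powr (-5/4)"
  have c: "?c > 0" by (intro suminf_pos summable_five_quarters) auto
  have "norm (zeta_reg s) \<le> 1 + (2 * ?c) * norm (s - 1) * norm s powr (3/4)" if s: "Re s \<ge> 1/2" for s
  proof -
    note sn = summable_zeta_reg_terms[OF s]
    have "norm (zeta_reg s) \<le> 1 + norm (\<Sum>n. (s - 1) * of_nat (Suc n) powr (- s)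
      + (of_nat (Suc (Suc n)) powr (1 - s) - of_nat (Suc n) powr (1 - s)))"
      unfolding zeta_reg_def by (rule order_trans[OF norm_triangle_ineq]) simp
    also have "\<dots> \<le> 1 + (\<Sum>n. norm ((s - 1) * of_nat (Suc n) powr (- s)
      + (of_nat (Suc (Suc n)) powr (1 - s) - of_nat (Suc n) powr (1 - s))))"
      using summable_norm[OF sn] by (rule add_left_mono)
    also have "\<dots> \<le> 1 + (\<Sum>n. 2 * norm (s - 1) * norm s powr (3/4) * real (Suc n) powr (-5/4))"
      by (intro add_left_mono suminf_le norm_zeta_reg_term_le[OF s] sn summable_mult summable_five_quarters)
    also have "(\<Sum>n. 2 * norm (s - 1) * norm s powr (3/4) * real (Suc n) powr (-5/4))
        = 2 * norm (s - 1) * norm s powr (3/4) * ?c"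
      by (rule suminf_mult[OF summable_five_quarters])
    finally show ?thesis by (simp add: mult_ac)
  qed
  thus ?thesis using c by (intro exI[of _ "2 * ?c"]) auto
qed

lemma zeta_reg_1: "zeta_reg 1 = 1"
  by (simp add: zeta_reg_def del: of_nat_Suc)

text \<open>The series starts at index 0 so that it fits the Euler product theorem; the extra term
  vanishes because \<open>0 powr z = 0\<close>. It represents zeta only for Re s > 1.\<close>

definition zeta_sum :: "complex \<Rightarrow> complex" where
  "zeta_sum s = (\<Sum>n. of_nat n powr (-s))"

lemma summable_norm_nat_powr:
  assumes "Re s > 1"
  shows "summable (\<lambda>n. norm (of_nat n powr (-s) :: complex))"
proof -
  have "summable (\<lambda>n. real n powr (- Re s))" using assms by (simp add: summable_real_powr_iff)
  thus ?thesis by (rule summable_comparison_test'[of _ 0]) (simp add: norm_powr_real_powr)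
qed

lemma zeta_sum_Suc_sums:
  assumes "Re s > 1"
  shows "(\<lambda>n. of_nat (Suc n) powr (-s)) sums zeta_sum s"
proof -
  have "(\<lambda>n. of_nat n powr (-s)) sums zeta_sum s"
    unfolding zeta_sum_def by (rule summable_sums[OF summable_norm_cancel[OF summable_norm_nat_powr[OF assms]]])
  thus ?thesis by (subst sums_Suc_iff) simp
qed

lemma zeta_reg_eq_zeta_sum:
  assumes s: "Re s > 1"
  shows "zeta_reg s = (s - 1) * zeta_sum s"
proof -
  have "(\<lambda>n. of_nat (Suc n) powr (- (s - 1))) \<longlonglongrightarrow> (0::complex)"
    using s by (intro tendsto_nat_powr_minus) simp
  hence "(\<lambda>n. of_nat (Suc n) powr (1 - s)) \<longlonglongrightarrow> (0::complex)" by simp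
  from telescope_sums[OF this]
  have "(\<lambda>n. of_nat (Suc (Suc n)) powr (1 - s) - of_nat (Suc n) powr (1 - s)) sums (- 1 :: complex)" by simp
  from sums_add[OF sums_mult[OF zeta_sum_Suc_sums[OF s], of "s - 1"] this]
  show ?thesis unfolding zeta_reg_def by (simp add: sums_iff)
qed

lemma of_nat_powr_mult: "of_nat (m * n) powr s = of_nat m powr s * (of_nat n powr s :: complex)"
  using powr_times_real[of "of_nat m" "of_nat n" s] by simp

lemma of_nat_powr_power: "n > 0 \<Longrightarrow> of_nat (n ^ k) powr s = (of_nat n powr s :: complex) ^ k"
proof (induction k)
  case (Suc k)
  have "of_nat (n ^ Suc k) powr s = of_nat (n * n ^ k) powr s" by simp
  also have "\<dots> = of_nat n powr s * of_nat (n ^ k) powr s" by (rule of_nat_powr_mult)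
  finally show ?case using Suc by simp
qed auto

text \<open>The alternating series is the full one minus twice its even part, and the even part is
  2^(-s) times the full series.\<close>

lemma eta_eq_zeta_sum:
  assumes s: "Re s > 1"
  shows "eta s = (1 - 2 powr (1 - s)) * zeta_sum s"
proof -
  let ?o = "\<lambda>k. complex_of_real (real (2*k+1)) powr (-s)" and ?e = "\<lambda>k. complex_of_real (real (2*k+2)) powr (-s)"
  have e: "?e sums (2 powr (-s) * zeta_sum s)"
  proof -
    have "?e k = 2 powr (-s) * of_nat (Suc k) powr (-s)" for k
      using of_nat_powr_mult[of 2 "Suc k" "-s"] by simp
    thus ?thesis using sums_mult[OF zeta_sum_Suc_sums[OF s], of "2 powr (-s)"] by simp
  qed
  have "(\<lambda>k. sum (\<lambda>n. of_nat (Suc n) powr (-s)) {k * 2..<k * 2 + 2}) sums zeta_sum s"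
    by (rule sums_group[OF zeta_sum_Suc_sums[OF s]]) simp
  moreover have "sum (\<lambda>n. of_nat (Suc n) powr (-s)) {k * 2..<k * 2 + 2} = ?o k + ?e k" for k
  proof -
    have "{k * 2..<k * 2 + 2} = {k * 2, k * 2 + 1}" by auto
    thus ?thesis by (simp add: algebra_simps)
  qed
  ultimately have oe: "(\<lambda>k. ?o k + ?e k) sums zeta_sum s" by simp
  have "(\<lambda>k. ?o k + ?e k - 2 * ?e k) sums (zeta_sum s - 2 * (2 powr (-s) * zeta_sum s))"
    by (intro sums_diff oe sums_mult e)
  moreover have "?o k + ?e k - 2 * ?e k = ?o k - ?e k" for k by simp
  ultimately have "(\<lambda>k. ?o k - ?e k) sums (zeta_sum s - 2 * (2 powr (-s) * zeta_sum s))" by (simp only:)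
  moreover have "2 * 2 powr (-s) = 2 powr (1 - s)" by (simp add: powr_diff powr_minus divide_inverse)
  hence "zeta_sum s - 2 * (2 powr (-s) * zeta_sum s) = (1 - 2 powr (1 - s)) * zeta_sum s"
    by (simp add: algebra_simps)
  ultimately show ?thesis using s by (subst eta_eq_diff_series) (simp_all add: sums_iff)
qed

text \<open>Identity theorem from Re s > 1. The relation is kept free of denominators so that it
  also holds at the zeros of 1 - 2^(1-s), which lie on Re s = 1.\<close>

lemma zeta_reg_eta:
  assumes "Re s > 1/2"
  shows "zeta_reg s * (1 - 2 powr (1 - s)) = (s - 1) * eta s"
proof (rule analytic_continuation_open[of "{s. Re s > 1}" "{s. Re s > 1/2}"
    "\<lambda>s. zeta_reg s * (1 - 2 powr (1 - s))" "\<lambda>s. (s - 1) * eta s"])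
  show "{s. Re s > 1} \<noteq> {}" by (auto intro!: exI[of _ 2])
  show "(\<lambda>s. zeta_reg s * (1 - 2 powr (1 - s))) holomorphic_on {s. Re s > 1/2}"
    by (intro holomorphic_intros holomorphic_zeta_reg) auto
  show "(\<lambda>s. (s - 1) * eta s) holomorphic_on {s. Re s > 1/2}"
    by (intro holomorphic_intros holomorphic_eta)
  show "open {s. Re s > 1/2}" by (rule open_halfspace_Re_gt)
  show "connected {s. Re s > 1/2}" by (rule convex_connected[OF convex_halfspace_Re_gt])
qed (use assms in \<open>auto simp: open_halfspace_Re_gt zeta_reg_eq_zeta_sum eta_eq_zeta_sum\<close>)

text \<open>To the left of the line Re s = 1 one has |2^(1-s)| > 1, so the denominator in
  \<open>zeta\<close> does not vanish; this is the range where the Riemann hypothesis is applied to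
  \<open>zeta\<close>.\<close>

lemma zeta_reg_eq_zeta:
  assumes "1/2 < Re s" "Re s < 1"
  shows "zeta_reg s = (s - 1) * zeta s"
proof -
  have "norm (2 powr (1 - s) :: complex) = 2 powr (1 - Re s)"
    using norm_powr_real_powr[of 2 "1 - s"] by simp
  also have "\<dots> > 1" using assms by simp
  finally have "1 - 2 powr (1 - s) \<noteq> 0" by auto
  thus ?thesis using zeta_reg_eta[OF assms(1)] unfolding zeta_def by (simp add: field_simps)
qed

section \<open>Real values on the real axis\<close>

lemma zeta_reg_of_real:
  assumes "1/2 < \<sigma>"
  shows "zeta_reg (of_real \<sigma>) \<in> \<real>"
proof -
  let ?g = "\<lambda>n. (\<sigma> - 1) * real (Suc n) powr (- \<sigma>) + (real (Suc (Suc n)) powr (1 - \<sigma>) - real (Suc n) powr (1 - \<sigma>))"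
  let ?f = "\<lambda>n. (complex_of_real \<sigma> - 1) * of_nat (Suc n) powr (- of_real \<sigma>)
      + (of_nat (Suc (Suc n)) powr (1 - of_real \<sigma>) - of_nat (Suc n) powr (1 - of_real \<sigma>))"
  have pw: "of_nat (Suc n) powr (complex_of_real x) = of_real (real (Suc n) powr x)" for n x
    using powr_of_real[of "real (Suc n)" x] by simp
  have eq: "?f n = of_real (?g n)" for n
    using pw[of n "- \<sigma>"] pw[of n "1 - \<sigma>"] pw[of "Suc n" "1 - \<sigma>"] by simp
  have "1/2 \<le> Re (of_real \<sigma>)" using assms by simp
  from summable_norm_cancel[OF summable_zeta_reg_terms[OF this]]
  have "summable ?g" unfolding eq summable_of_real_iff .
  hence "suminf ?f = of_real (suminf ?g)" unfolding eq by (rule suminf_of_real[symmetric])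
  hence "zeta_reg (of_real \<sigma>) = of_real (1 + suminf ?g)" unfolding zeta_reg_def by (simp only: of_real_add of_real_1)
  thus ?thesis by (simp only: Reals_of_real)
qed

lemma L_chi4_of_real:
  assumes "1/2 < \<sigma>"
  shows "L_chi4 (of_real \<sigma>) \<in> \<real>"
proof -
  let ?f = "\<lambda>n. complex_of_real (real (4*n+1)) powr (- of_real \<sigma>) - of_real (real (4*n+3)) powr (- of_real \<sigma>)"
  let ?g = "\<lambda>n. real (4*n+1) powr (-\<sigma>) - real (4*n+3) powr (- \<sigma>)"
  have pw: "of_real x powr (- complex_of_real \<sigma>) = of_real (x powr (- \<sigma>))" if "x \<ge> 0" for x
    using powr_of_real[of x "-\<sigma>"] that by simp
  have eq: "?f n = of_real (?g n)" for n by (simp only: pw of_nat_0_le_iff of_real_diff)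
  have "summable ?f" using assms by (intro dirichlet_diff_series(2)) auto
  hence "summable ?g" by (simp only: eq summable_of_real_iff)
  hence "suminf ?f = of_real (suminf ?g)" unfolding eq by (rule suminf_of_real[symmetric])
  moreover have "1/2 < Re (of_real \<sigma>)" using assms by simp
  ultimately show ?thesis by (simp only: L_chi4_eq_diff_series Reals_of_real)
qed

lemma zeta_sm1_eq:
  assumes "1/2 < \<sigma>" "\<sigma> \<le> 1"
  shows "zeta_sm1 \<sigma> = Re (zeta_reg (of_real \<sigma>))"
proof (cases "\<sigma> = 1")
  case False
  thus ?thesis using zeta_reg_eq_zeta[of "of_real \<sigma>"] assms by (simp add: zeta_sm1_def)
qed (simp add: zeta_sm1_def zeta_reg_1)

section \<open>Euler products of the three Dirichlet series\<close>

lemma chi4_mult: "chi4 (m * n) = chi4 m * chi4 n"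
proof -
  have "m mod 4 = 0 \<or> m mod 4 = 1 \<or> m mod 4 = 2 \<or> m mod 4 = 3"
       "n mod 4 = 0 \<or> n mod 4 = 1 \<or> n mod 4 = 2 \<or> n mod 4 = 3" by presburger+
  moreover have "(m * n) mod 4 = (m mod 4 * (n mod 4)) mod 4" by (simp add: mod_mult_eq)
  ultimately show ?thesis unfolding chi4_def by (elim disjE) simp_all
qed

lemma tendsto_prod_primes_cong:
  assumes "(\<lambda>N. \<Prod>p | prime p \<and> p \<le> N. f p) \<longlonglongrightarrow> l" "\<And>p::nat. prime p \<Longrightarrow> f p = g p"
  shows "(\<lambda>N. \<Prod>p | prime p \<and> p \<le> N. g p) \<longlonglongrightarrow> l"
proof -
  have "(\<Prod>p | prime p \<and> p \<le> N. f p) = (\<Prod>p | prime p \<and> p \<le> N. g p)" for N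
    using assms(2) by (intro prod.cong) auto
  thus ?thesis using assms(1) by simp
qed

lemma norm_nat_powr_less_1:
  assumes "n \<ge> 2" "Re s > 0"
  shows "norm (of_nat n powr (-s) :: complex) < 1"
proof -
  have "norm (of_nat n powr (-s) :: complex) = real n powr (- Re s)"
    by (simp add: norm_powr_real_powr)
  also have "\<dots> < 1" using assms by (simp add: powr_less_one)
  finally show ?thesis .
qed

lemma euler_product_dirichlet:
  fixes a :: "nat \<Rightarrow> complex"
  assumes s: "Re s > 1" and a1: "a 1 = 1"
    and mult: "\<And>m n. coprime m n \<Longrightarrow> m > 0 \<Longrightarrow> n > 0 \<Longrightarrow> a (m * n) = a m * a n"
    and bound: "\<And>n. norm (a n) \<le> 1"
  shows "(\<lambda>N. \<Prod>p | prime p \<and> p \<le> N. \<Sum>k. a (p ^ k) * (of_nat p powr (-s)) ^ k) \<longlonglongrightarrow> (\<Sum>n. a n * of_nat n powr (-s))"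
proof -
  let ?f = "\<lambda>n. a n * of_nat n powr (-s)"
  have "(\<lambda>N. \<Prod>p | prime p \<and> p \<le> N. \<Sum>k. ?f (p ^ k)) \<longlonglongrightarrow> (\<Sum>n. ?f n)"
  proof (rule euler_product_tendsto)
    show "?f (m * n) = ?f m * ?f n" if "coprime m n" "m > 0" "n > 0" for m n
      using mult[OF that] of_nat_powr_mult[of m n "-s"] by simp
    show "summable (\<lambda>n. norm (?f n))"
    proof (rule summable_comparison_test'[OF summable_norm_nat_powr[OF s], of 0])
      fix n show "norm (norm (?f n)) \<le> norm (of_nat n powr (-s) :: complex)"
        using mult_right_mono[OF bound, of "norm (of_nat n powr (-s) :: complex)" n] by (simp add: norm_mult)
    qed
  qed (use a1 in auto)
  moreover have "(\<Sum>k. ?f (p ^ k)) = (\<Sum>k. a (p ^ k) * (of_nat p powr (-s)) ^ k)" if "prime p" for p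
    using prime_gt_0_nat[OF that] by (simp only: of_nat_powr_power)
  ultimately show ?thesis by (rule tendsto_prod_primes_cong)
qed

lemma euler_product_zeta_sum:
  assumes s: "Re s > 1"
  shows "(\<lambda>N. \<Prod>p | prime p \<and> p \<le> N. 1 / (1 - of_nat p powr (-s))) \<longlonglongrightarrow> zeta_sum s"
proof -
  have loc: "(\<Sum>k. 1 * (of_nat p powr (-s)) ^ k) = 1 / (1 - of_nat p powr (-s))" if "prime p" for p
    using norm_nat_powr_less_1[of p s] prime_ge_2_nat[OF that] s by (simp add: suminf_geometric)
  have "(\<lambda>N. \<Prod>p | prime p \<and> p \<le> N. \<Sum>k. 1 * (of_nat p powr (-s)) ^ k) \<longlonglongrightarrow> zeta_sum s"
    using euler_product_dirichlet[OF s, of "\<lambda>_. 1"] by (simp add: zeta_sum_def)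
  thus ?thesis using loc by (rule tendsto_prod_primes_cong)
qed

lemma euler_product_L_chi4:
  assumes s: "Re s > 1"
  shows "(\<lambda>N. \<Prod>p | prime p \<and> p \<le> N. 1 / (1 - of_int (chi4 p) * of_nat p powr (-s))) \<longlonglongrightarrow> L_chi4 s"
proof -
  have pw: "chi4 (p ^ k) = chi4 p ^ k" for p k
    by (induction k) (auto simp: chi4_mult, simp add: chi4_def)
  have loc: "(\<Sum>k. of_int (chi4 (p ^ k)) * (of_nat p powr (-s)) ^ k) = 1 / (1 - of_int (chi4 p) * of_nat p powr (-s))"
    if "prime p" for p
  proof -
    have "norm (of_int (chi4 p) * of_nat p powr (-s) :: complex) \<le> norm (of_nat p powr (-s) :: complex)"
      by (simp add: chi4_def norm_mult)
    also have "\<dots> < 1" using norm_nat_powr_less_1[of p s] prime_ge_2_nat[OF that] s by simp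
    finally show ?thesis using suminf_geometric[of "of_int (chi4 p) * of_nat p powr (-s)"]
      by (simp add: pw power_mult_distrib)
  qed
  have "(\<lambda>n. of_int (chi4 n) * of_nat n powr (-s)) sums (\<Sum>n. of_int (chi4 n) * of_nat n powr (-s) :: complex)"
  proof (rule summable_sums, rule summable_comparison_test'[OF summable_norm_nat_powr[OF s], of 0])
    fix n show "norm (of_int (chi4 n) * of_nat n powr (-s) :: complex) \<le> norm (of_nat n powr (-s) :: complex)"
      by (simp add: chi4_def norm_mult)
  qed
  hence "(\<lambda>n. of_int (chi4 (Suc n)) * of_nat (Suc n) powr (-s)) sums (\<Sum>n. of_int (chi4 n) * of_nat n powr (-s) :: complex)"
    by (subst sums_Suc_iff) (simp add: chi4_def)
  hence "L_chi4 s = (\<Sum>n. of_int (chi4 n) * of_nat n powr (-s))"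
    unfolding L_chi4_def by (simp add: sums_iff)
  moreover have "(\<lambda>N. \<Prod>p | prime p \<and> p \<le> N. \<Sum>k. of_int (chi4 (p ^ k)) * (of_nat p powr (-s)) ^ k)
     \<longlonglongrightarrow> (\<Sum>n. of_int (chi4 n) * of_nat n powr (-s))"
    by (rule euler_product_dirichlet[OF s]) (auto simp: chi4_mult, auto simp: chi4_def)
  ultimately have "(\<lambda>N. \<Prod>p | prime p \<and> p \<le> N. \<Sum>k. of_int (chi4 (p ^ k)) * (of_nat p powr (-s)) ^ k)
     \<longlonglongrightarrow> L_chi4 s" by simp
  thus ?thesis using loc by (rule tendsto_prod_primes_cong)
qed

definition E_sum :: "complex \<Rightarrow> complex" where
  "E_sum s = (\<Sum>n. of_bool (n \<in> sum2sq) * of_nat n powr (-s))"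

text \<open>The local factor at p sums x^k over the exponents k with p^k a sum of two squares: all
  k, or only the even ones when p = 3 mod 4.\<close>

lemma euler_product_E_sum:
  assumes s: "Re s > 1"
  shows "(\<lambda>N. \<Prod>p | prime p \<and> p \<le> N. if p mod 4 = 3 then 1 / (1 - (of_nat p powr (-s))^2)
            else 1 / (1 - of_nat p powr (-s))) \<longlonglongrightarrow> E_sum s"
proof -
  have loc: "(\<Sum>k. of_bool (p ^ k \<in> sum2sq) * (of_nat p powr (-s)) ^ k) =
      (if p mod 4 = 3 then 1 / (1 - (of_nat p powr (-s))^2) else 1 / (1 - of_nat p powr (-s)))"
    if p: "prime p" for p
  proof -
    have x: "norm (of_nat p powr (-s) :: complex) < 1"
      using norm_nat_powr_less_1[of p s] prime_ge_2_nat[OF p] s by simp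
    show ?thesis
    proof (cases "p mod 4 = 3")
      case False
      thus ?thesis using suminf_geometric[OF x] p by (simp add: prime_power_mem_sum2sq_iff)
    next
      case True
      define x where "x = (of_nat p powr (-s) :: complex)"
      have "norm (x^2) < 1" using x by (simp add: x_def norm_power power_less_one_iff)
      hence "(\<lambda>k. (x^2) ^ k) sums (1 / (1 - x^2))" by (rule geometric_sums)
      hence "(\<lambda>k. (if even (2*k) then x ^ (2*k) else 0)) sums (1 / (1 - x^2))" by (simp add: power_mult)
      moreover have "strict_mono (\<lambda>k::nat. 2 * k)" by (simp add: strict_mono_def)
      ultimately have "(\<lambda>k. if even k then x ^ k else 0) sums (1 / (1 - x^2))"
        by (subst (asm) sums_mono_reindex) (auto elim!: evenE)
      moreover have "of_bool (p ^ k \<in> sum2sq) * x ^ k = (if even k then x ^ k else 0)" for k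
        using True p by (simp add: prime_power_mem_sum2sq_iff)
      ultimately show ?thesis using True by (simp add: sums_iff flip: x_def)
    qed
  qed
  have "1 \<in> sum2sq" using square_mem_sum2sq[of 1] by simp
  hence "(\<lambda>N. \<Prod>p | prime p \<and> p \<le> N. \<Sum>k. of_bool (p ^ k \<in> sum2sq) * (of_nat p powr (-s)) ^ k) \<longlonglongrightarrow> E_sum s"
    unfolding E_sum_def
    by (intro euler_product_dirichlet[OF s]) (auto simp: sum2sq_mult_coprime_iff)
  thus ?thesis using loc by (rule tendsto_prod_primes_cong)
qed

definition Zfun :: "complex \<Rightarrow> complex" where
  "Zfun s = zeta_sum s * L_chi4 s"

text \<open>Every local factor of \<open>\<zeta>(s) L(s, \<chi>\<^sub>4)\<close> is a power of some \<open>1 / (1 - q\<^sup>-\<^sup>s)\<close> with \<open>q\<close> a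
  prime or the square of a prime, which makes all coefficients of its logarithm nonnegative.\<close>

definition Z_base :: "nat \<Rightarrow> nat" where
  "Z_base p = (if p mod 4 = 3 then p^2 else p)"

definition Z_exponent :: "nat \<Rightarrow> nat" where
  "Z_exponent p = (if p mod 4 = 1 then 2 else 1)"

definition Z_factor :: "nat \<Rightarrow> complex \<Rightarrow> complex" where
  "Z_factor p s = (1 / (1 - of_nat (Z_base p) powr (-s))) ^ Z_exponent p"

lemma Z_base_ge_2: "prime p \<Longrightarrow> Z_base p \<ge> 2"
  using prime_ge_2_nat[of p] self_le_power[of p 2] by (auto simp: Z_base_def)

lemma prime_mod_4_cases:
  assumes "prime (p::nat)" obtains "p = 2" | "p mod 4 = 1" | "p mod 4 = 3"
proof (cases "p = 2")
  case False
  hence "odd p" using prime_odd_nat[of p] assms prime_ge_2_nat[of p] by simp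
  hence "p mod 4 = 1 \<or> p mod 4 = 3" by presburger
  thus ?thesis using that by blast
qed (use that in blast)

text \<open>At 2 the character vanishes and only the zeta factor remains; at p = 1 mod 4 the two
  factors coincide, hence exponent 2; at p = 3 mod 4 they combine as (1 - x)(1 + x) = 1 - x^2, hence
  base p^2.\<close>

lemma Z_factor_eq:
  assumes "prime p"
  shows "1 / (1 - of_nat p powr (-s)) * (1 / (1 - of_int (chi4 p) * of_nat p powr (-s))) = Z_factor p s"
  using assms
proof (cases rule: prime_mod_4_cases)
  case 1 thus ?thesis by (simp add: chi4_def Z_factor_def Z_base_def Z_exponent_def)
next
  case 2 thus ?thesis by (simp add: chi4_def Z_factor_def Z_base_def Z_exponent_def power2_eq_square)
next
  case 3
  have "of_nat (p^2) powr (-s) = (of_nat p powr (-s) :: complex)^2"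
    using of_nat_powr_power prime_gt_0_nat[OF assms] by blast
  moreover have "(1 - x) * (1 + x) = 1 - x^2" for x :: complex by (simp add: power2_eq_square algebra_simps)
  ultimately show ?thesis using 3 by (simp add: chi4_def Z_factor_def Z_base_def Z_exponent_def)
qed

lemma euler_product_Zfun:
  assumes s: "Re s > 1"
  shows "(\<lambda>N. \<Prod>p | prime p \<and> p \<le> N. Z_factor p s) \<longlonglongrightarrow> Zfun s"
proof -
  have "(\<lambda>N. (\<Prod>p | prime p \<and> p \<le> N. 1 / (1 - of_nat p powr (-s))) *
      (\<Prod>p | prime p \<and> p \<le> N. 1 / (1 - of_int (chi4 p) * of_nat p powr (-s)))) \<longlonglongrightarrow> Zfun s"
    unfolding Zfun_def by (intro tendsto_mult euler_product_zeta_sum euler_product_L_chi4 s)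
  thus ?thesis unfolding prod.distrib[symmetric] using Z_factor_eq by (rule tendsto_prod_primes_cong)
qed

text \<open>Factor by factor, |1 - x| (1 - |x|) \<le> (1 + |x|)(1 - |x|) \<le> 1. Besides
  non-vanishing this gives a quantitative lower bound for |Z| to the right of 1, which Landau's
  lemma needs at the centre of its disc.\<close>

lemma norm_Zfun_mult_ge_1:
  assumes s: "Re s > 1"
  shows "norm (Zfun s) * norm (Zfun (of_real (Re s))) \<ge> 1"
proof -
  have "(\<lambda>N. norm (\<Prod>p | prime p \<and> p \<le> N. Z_factor p s) * norm (\<Prod>p | prime p \<and> p \<le> N. Z_factor p (of_real (Re s))))
     \<longlonglongrightarrow> norm (Zfun s) * norm (Zfun (of_real (Re s)))"
    using s by (intro tendsto_intros euler_product_Zfun) auto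
  moreover have "norm (\<Prod>p | prime p \<and> p \<le> N. Z_factor p s) * norm (\<Prod>p | prime p \<and> p \<le> N. Z_factor p (of_real (Re s))) \<ge> 1" for N
  proof -
    have "1 \<le> (\<Prod>p | prime p \<and> p \<le> N. norm (Z_factor p s) * norm (Z_factor p (of_real (Re s))))"
    proof (rule prod_ge_1, clarsimp)
      fix p :: nat assume p: "prime p"
      define x y where "x = (of_nat (Z_base p) powr (-s) :: complex)" and "y = real (Z_base p) powr (- Re s)"
      have xy: "norm x = y" unfolding x_def y_def by (simp add: norm_powr_real_powr)
      have y: "0 \<le> y" "y < 1" using norm_nat_powr_less_1[OF Z_base_ge_2[OF p], of s] s xy unfolding x_def by (auto simp: y_def)
      from y(1) have "of_nat (Z_base p) powr (- complex_of_real (Re s)) = complex_of_real y"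
        using powr_of_real[of "real (Z_base p)" "- Re s"] by (simp add: y_def)
      have fac: "norm (Z_factor p (of_real (Re s))) = (1 / (1 - y)) ^ Z_exponent p"
      proof -
        have "1 - complex_of_real y = of_real (1 - y)" by simp
        hence "norm (1 - complex_of_real y) = 1 - y" using y by (simp only: norm_of_real)
        with \<open>of_nat (Z_base p) powr (- complex_of_real (Re s)) = complex_of_real y\<close> show ?thesis
          unfolding Z_factor_def by (simp add: norm_divide norm_power)
      qed
      have "norm (1 - x) * (1 - y) \<le> (1 + y) * (1 - y)"
        using y norm_triangle_ineq4[of 1 x] xy by (intro mult_right_mono) auto
      also have "\<dots> \<le> 1" by (simp add: algebra_simps)
      finally have le: "norm (1 - x) * (1 - y) \<le> 1" .
      have "1 - x \<noteq> 0" using xy y by auto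
      hence "1 \<le> 1 / norm (1 - x) * (1 / (1 - y))" using le y by (simp add: field_simps)
      hence "1 \<le> (1 / norm (1 - x) * (1 / (1 - y))) ^ Z_exponent p" by (rule one_le_power)
      thus "1 \<le> norm (Z_factor p s) * norm (Z_factor p (of_real (Re s)))"
        unfolding fac unfolding Z_factor_def x_def[symmetric]
        by (simp only: norm_divide norm_power norm_one power_mult_distrib)
    qed
    thus ?thesis by (simp add: prod.distrib prod_norm)
  qed
  ultimately show ?thesis by (intro LIMSEQ_le_const) auto
qed

lemma Zfun_nonzero: "Re s > 1 \<Longrightarrow> Zfun s \<noteq> 0"
  using norm_Zfun_mult_ge_1[of s] by auto

section \<open>The 3-4-1 inequality\<close>

lemma three_four_one_nonneg:
  assumes "norm (u::complex) = 1"
  shows "3 + 4 * Re u + Re (u^2) \<ge> 0"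
proof -
  have "(Re u)^2 + (Im u)^2 = 1" using assms cmod_power2[of u] by simp
  hence "3 + 4 * Re u + Re (u^2) = 2 * (1 + Re u)^2"
    by (simp add: power2_eq_square algebra_simps)
  thus ?thesis by simp
qed

lemma ln_norm_one_minus_sums:
  assumes "norm (z::complex) < 1"
  shows "(\<lambda>n. - (Re (z ^ n) / real n)) sums ln (norm (1 - z))"
proof -
  have "1 - z \<noteq> 0" using assms by auto
  moreover have "(\<lambda>n. - (z ^ n) / of_nat n) sums Ln (1 - z)"
    using Ln_series'[of "-z"] assms by simp
  hence "(\<lambda>n. Re (- (z ^ n) / of_nat n)) sums Re (Ln (1 - z))" by (rule sums_Re)
  ultimately show ?thesis by simp
qed

text \<open>The logarithm of the left-hand side is minus the sum over n of r^n / n times 3 + 4 Re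
  w^n + Re w^(2n), hence decreasing in r. Stating positivity as monotonicity lets it pass through
  the infinite product, so that logarithmic derivatives can be taken afterwards without a Dirichlet
  series for them.\<close>

lemma three_four_one_mono:
  assumes w: "norm (w::complex) = 1" and r: "0 \<le> r'" "r' \<le> r" "r < 1"
  shows "norm (1 - complex_of_real r) ^ 3 * norm (1 - of_real r * w) ^ 4 * norm (1 - of_real r * w^2)
    \<le> norm (1 - complex_of_real r') ^ 3 * norm (1 - of_real r' * w) ^ 4 * norm (1 - of_real r' * w^2)"
proof -
  define g where "g = (\<lambda>r. 3 * ln (norm (1 - complex_of_real r)) + 4 * ln (norm (1 - of_real r * w)) + ln (norm (1 - of_real r * w^2)))"
  have sums: "(\<lambda>n. - (r ^ n / real n * (3 + 4 * Re (w ^ n) + Re ((w ^ n)^2)))) sums g r" if "0 \<le> r" "r < 1" for r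
  proof -
    have "(\<lambda>n. 3 * (- (Re (of_real r ^ n) / real n)) + 4 * (- (Re ((of_real r * w) ^ n) / real n))
        + (- (Re ((of_real r * w^2) ^ n) / real n))) sums g r"
      unfolding g_def using that w
      by (intro sums_add sums_mult ln_norm_one_minus_sums) (auto simp: norm_mult norm_power)
    moreover have "3 * (- (Re (of_real r ^ n) / real n)) + 4 * (- (Re ((of_real r * w) ^ n) / real n))
        + (- (Re ((of_real r * w^2) ^ n) / real n)) = - (r ^ n / real n * (3 + 4 * Re (w ^ n) + Re ((w ^ n)^2)))" for n
    proof -
      have "Re ((of_real r * v) ^ n) = r ^ n * Re (v ^ n)" for v
        by (simp add: power_mult_distrib flip: of_real_power)
      moreover have "Re (of_real r ^ n) = r ^ n" by (simp flip: of_real_power)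
      moreover have "(w^2)^n = (w^n)^2" by (simp flip: power_mult add: mult.commute)
      ultimately show ?thesis by (simp add: algebra_simps add_divide_distrib)
    qed
    ultimately show ?thesis by simp
  qed
  have gle: "g r \<le> g r'"
  proof (rule sums_le[OF _ sums sums])
    fix n
    have "3 + 4 * Re (w ^ n) + Re ((w ^ n)^2) \<ge> 0"
      using w by (intro three_four_one_nonneg) (simp add: norm_power)
    moreover have "r' ^ n / real n \<le> r ^ n / real n" using r by (intro divide_right_mono power_mono) auto
    ultimately show "- (r ^ n / real n * (3 + 4 * Re (w ^ n) + Re ((w ^ n)^2))) \<le>
        - (r' ^ n / real n * (3 + 4 * Re (w ^ n) + Re ((w ^ n)^2)))"
      by (intro le_imp_neg_le mult_right_mono)
  qed (use r in auto)
  have "exp (g r) = norm (1 - complex_of_real r) ^ 3 * norm (1 - of_real r * w) ^ 4 * norm (1 - of_real r * w^2)"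
    if "0 \<le> r" "r < 1" for r
  proof -
    have "1 - of_real r * v \<noteq> 0" if "norm v = 1" for v :: complex
    proof
      assume "1 - of_real r * v = 0"
      hence "norm (of_real r * v) = 1" by simp
      thus False using that \<open>0 \<le> r\<close> \<open>r < 1\<close> by (simp add: norm_mult)
    qed
    from this[of 1] this[of w] this[of "w^2"] w
    have "1 - complex_of_real r \<noteq> 0" "1 - of_real r * w \<noteq> 0" "1 - of_real r * w^2 \<noteq> 0"
      by (auto simp: norm_power)
    hence pos: "norm (1 - complex_of_real r) > 0" "norm (1 - of_real r * w) > 0" "norm (1 - of_real r * w^2) > 0" by auto
    have "exp (real k * ln x) = x ^ k" if "x > 0" for x :: real and k
      using that by (simp add: exp_of_nat_mult)
    from this[of _ 3] this[of _ 4] pos show ?thesis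
      unfolding g_def by (simp add: exp_add)
  qed
  from this[of r] this[of r'] gle show ?thesis
    using r exp_le_cancel_iff[of "g r" "g r'"] by auto
qed

text \<open>For each base q, the choice r = q^(-\<sigma>) and w = q^(-it) turns the local factors
  into those of \<open>three_four_one_mono\<close>; r decreases as \<sigma> grows. The finite
  products then pass to the limit.\<close>

lemma Zfun_three_four_one_mono:
  assumes \<sigma>: "1 < \<sigma>1" "\<sigma>1 \<le> \<sigma>2"
  shows "norm (Zfun (of_real \<sigma>2)) ^ 3 * norm (Zfun (Complex \<sigma>2 t)) ^ 4 * norm (Zfun (Complex \<sigma>2 (2*t)))
    \<le> norm (Zfun (of_real \<sigma>1)) ^ 3 * norm (Zfun (Complex \<sigma>1 t)) ^ 4 * norm (Zfun (Complex \<sigma>1 (2*t)))"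
proof -
  define P where "P = (\<lambda>N s. \<Prod>p | prime p \<and> p \<le> N. Z_factor p s)"
  define h where "h = (\<lambda>p \<sigma>. norm (Z_factor p (of_real \<sigma>)) ^ 3 * norm (Z_factor p (Complex \<sigma> t)) ^ 4 * norm (Z_factor p (Complex \<sigma> (2*t))))"
  have P: "norm (P N (of_real \<sigma>)) ^ 3 * norm (P N (Complex \<sigma> t)) ^ 4 * norm (P N (Complex \<sigma> (2*t)))
      = (\<Prod>p | prime p \<and> p \<le> N. h p \<sigma>)" for N \<sigma>
    unfolding P_def h_def by (simp only: prod.distrib prod_power_distrib[symmetric] prod_norm)
  have lim: "(\<lambda>N. norm (P N (of_real \<sigma>)) ^ 3 * norm (P N (Complex \<sigma> t)) ^ 4 * norm (P N (Complex \<sigma> (2*t))))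
     \<longlonglongrightarrow> norm (Zfun (of_real \<sigma>)) ^ 3 * norm (Zfun (Complex \<sigma> t)) ^ 4 * norm (Zfun (Complex \<sigma> (2*t)))"
    if "\<sigma> > 1" for \<sigma>
    unfolding P_def using that by (intro tendsto_intros euler_product_Zfun) auto
  have "h p \<sigma>2 \<le> h p \<sigma>1" if p: "prime p" for p
  proof -
    define q where "q = real (Z_base p)"
    define w where "w = complex_of_real q powr (- (\<i> * of_real t))"
    have q: "q \<ge> 2" using Z_base_ge_2[OF p] by (simp add: q_def)
    have w1: "norm w = 1" using q by (simp add: w_def norm_powr_real_powr)
    define k where "k = (\<lambda>r. norm (1 - complex_of_real r) ^ 3 * norm (1 - of_real r * w) ^ 4 * norm (1 - of_real r * w^2))"
    have pw: "complex_of_real q powr (- of_real \<sigma>) = of_real (q powr (-\<sigma>))" for \<sigma>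
      using powr_of_real[of q "-\<sigma>"] q by simp
    have pw1: "complex_of_real q powr (- Complex \<sigma> t) = of_real (q powr (-\<sigma>)) * w" for \<sigma>
    proof -
      have "- Complex \<sigma> t = - of_real \<sigma> + - (\<i> * of_real t)" by (simp add: complex_eq_iff)
      thus ?thesis unfolding w_def pw[symmetric] by (simp only: powr_add)
    qed
    have pw2: "complex_of_real q powr (- Complex \<sigma> (2*t)) = of_real (q powr (-\<sigma>)) * w^2" for \<sigma>
    proof -
      have "- Complex \<sigma> (2*t) = - of_real \<sigma> + (- (\<i> * of_real t) + - (\<i> * of_real t))" by (simp add: complex_eq_iff)
      thus ?thesis unfolding w_def pw[symmetric] power2_eq_square by (simp only: powr_add)
    qed
    have h: "h p \<sigma> = (1 / k (q powr (-\<sigma>))) ^ Z_exponent p" for \<sigma>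
    proof -
      have "norm (Z_factor p s) = (1 / norm (1 - complex_of_real q powr (-s))) ^ Z_exponent p" for s
        unfolding Z_factor_def q_def by (simp add: norm_power norm_divide)
      hence "h p \<sigma> = ((1 / norm (1 - complex_of_real (q powr (-\<sigma>)))) ^ Z_exponent p) ^ 3 *
          ((1 / norm (1 - of_real (q powr (-\<sigma>)) * w)) ^ Z_exponent p) ^ 4 *
          (1 / norm (1 - of_real (q powr (-\<sigma>)) * w^2)) ^ Z_exponent p"
        unfolding h_def by (simp only: pw pw1 pw2)
      thus ?thesis unfolding k_def
        by (simp add: power_mult_distrib power_divide flip: power_mult) (simp add: mult.commute)
    qed
    have r: "0 \<le> q powr (-\<sigma>2)" "q powr (-\<sigma>2) \<le> q powr (-\<sigma>1)" "q powr (-\<sigma>1) < 1"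
      using q \<sigma> by (auto intro!: powr_mono powr_less_one)
    have "k (q powr (-\<sigma>1)) \<le> k (q powr (-\<sigma>2))" unfolding k_def by (rule three_four_one_mono[OF w1 r])
    moreover have "k (q powr (-\<sigma>1)) > 0"
    proof -
      have "1 - of_real (q powr (-\<sigma>1)) * v \<noteq> 0" if "norm v = 1" for v :: complex
      proof
        assume "1 - of_real (q powr (-\<sigma>1)) * v = 0"
        hence "norm (of_real (q powr (-\<sigma>1)) * v) = 1" by simp
        thus False using that r by (simp add: norm_mult)
      qed
      from this[of 1] this[of w] this[of "w^2"] show ?thesis using w1 by (simp add: k_def norm_power)
    qed
    ultimately show ?thesis unfolding h by (intro power_mono divide_left_mono mult_pos_pos) auto
  qed
  moreover have "h p \<sigma>2 \<ge> 0" for p by (simp add: h_def)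
  ultimately have "(\<Prod>p | prime p \<and> p \<le> N. h p \<sigma>2) \<le> (\<Prod>p | prime p \<and> p \<le> N. h p \<sigma>1)" for N
    by (intro prod_mono) auto
  thus ?thesis using \<sigma> by (intro LIMSEQ_le[OF lim lim]) (auto simp: P)
qed

section \<open>The zero-free region\<close>

definition Zreg :: "complex \<Rightarrow> complex" where
  "Zreg s = zeta_reg s * L_chi4 s"

lemma holomorphic_Zreg: "Zreg holomorphic_on {s. Re s > 1/2}"
  unfolding Zreg_def[abs_def] by (intro holomorphic_intros holomorphic_zeta_reg holomorphic_L_chi4)

lemma Zreg_eq_Zfun: "Re s > 1 \<Longrightarrow> Zreg s = (s - 1) * Zfun s"
  by (simp add: Zreg_def Zfun_def zeta_reg_eq_zeta_sum)

lemma Zreg_nonzero_of_Re_gt_1: "Re s > 1 \<Longrightarrow> Zreg s \<noteq> 0"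
  using Zfun_nonzero[of s] by (auto simp: Zreg_eq_Zfun)

lemma Zreg_1_nonzero: "Zreg 1 \<noteq> 0"
  using L_chi4_one_pos by (auto simp: Zreg_def zeta_reg_1)

text \<open>A crude power is enough here, since in the zero-free region argument only the logarithm
  of this bound enters.\<close>

lemma Zreg_bound: "\<exists>A\<ge>1. \<forall>s. Re s > 1/2 \<longrightarrow> norm (Zreg s) \<le> A * (1 + norm s) ^ 3"
proof -
  obtain C where C: "C > 0" "\<And>s. Re s \<ge> 1/2 \<Longrightarrow> norm (zeta_reg s) \<le> 1 + C * norm (s - 1) * norm s powr (3/4)"
    using zeta_reg_bound by blast
  obtain D where D: "D > 0" "\<And>s. Re s > 1/2 \<Longrightarrow> norm (L_chi4 s) \<le> D * norm s powr (3/4)"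
    using L_chi4_bound by blast
  have "norm (Zreg s) \<le> ((1 + C) * (D + 1)) * (1 + norm s) ^ 3" if s: "Re s > 1/2" for s
  proof -
    have p: "norm s powr (3/4) \<le> 1 + norm s"
    proof -
      have "norm s powr (3/4) \<le> (1 + norm s) powr (3/4)" by (intro powr_mono2) auto
      also have "\<dots> \<le> (1 + norm s) powr 1" by (intro powr_mono) auto
      finally show ?thesis by simp
    qed
    have "norm (s - 1) \<le> 1 + norm s" using norm_triangle_ineq4[of s 1] by simp
    hence "norm (s - 1) * norm s powr (3/4) \<le> (1 + norm s) * (1 + norm s)" using p by (intro mult_mono) auto
    hence "C * (norm (s - 1) * norm s powr (3/4)) \<le> C * (1 + norm s) ^ 2"
      using C by (intro mult_left_mono) (auto simp: power2_eq_square)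
    moreover have "1 \<le> (1 + norm s) ^ 2" by (simp add: one_le_power)
    moreover have "norm (zeta_reg s) \<le> 1 + C * (norm (s - 1) * norm s powr (3/4))"
      using C(2)[of s] s by (simp add: mult.assoc)
    ultimately have 1: "norm (zeta_reg s) \<le> (1 + C) * (1 + norm s) ^ 2"
      unfolding distrib_right by linarith
    have "norm (L_chi4 s) \<le> D * (1 + norm s)" using D(2)[OF s] p D(1) by (meson mult_left_mono order_trans less_imp_le)
    also have "\<dots> \<le> (D + 1) * (1 + norm s)" by (intro mult_right_mono) auto
    finally have "norm (zeta_reg s) * norm (L_chi4 s) \<le> ((1 + C) * (1 + norm s) ^ 2) * ((D + 1) * (1 + norm s))"
      using 1 C(1) by (intro mult_mono) auto
    thus ?thesis by (simp add: Zreg_def norm_mult eval_nat_numeral mult_ac)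
  qed
  moreover have "(1 + C) * (D + 1) \<ge> 1 * 1" using C(1) D(1) by (intro mult_mono) auto
  ultimately show ?thesis by (intro exI[of _ "(1 + C) * (D + 1)"]) auto
qed

text \<open>Near s0 the quotient f / f s0 is close to 1, so the principal logarithm is holomorphic
  on it; its real part differs from log |f| by a constant.\<close>

lemma has_real_derivative_ln_norm:
  assumes holf: "f holomorphic_on S" and S: "open S" and s: "Complex \<sigma> a \<in> S" "f (Complex \<sigma> a) \<noteq> 0"
  shows "((\<lambda>x. ln (norm (f (Complex x a)))) has_real_derivative
           Re (deriv f (Complex \<sigma> a) / f (Complex \<sigma> a))) (at \<sigma>)"
proof -
  define s0 where "s0 = Complex \<sigma> a"
  define g where "g = (\<lambda>s. Ln (f s / f s0))"
  have f': "(f has_field_derivative deriv f s0) (at s0)"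
    using holf S s by (simp add: holomorphic_derivI s0_def)
  have "(g has_field_derivative deriv f s0 / f s0) (at s0)"
    unfolding g_def using s f'
    by (auto intro!: derivative_eq_intros simp: complex_nonpos_Reals_iff s0_def)
  moreover have "((\<lambda>x. Complex x a) has_vector_derivative 1) (at \<sigma>)"
  proof -
    have "((\<lambda>x. of_real x + \<i> * of_real a) has_vector_derivative 1) (at \<sigma>)"
      by (auto intro!: derivative_eq_intros)
    thus ?thesis by (simp add: complex_eq_iff Complex_eq)
  qed
  ultimately have "((g \<circ> (\<lambda>x. Complex x a)) has_vector_derivative 1 * (deriv f s0 / f s0)) (at \<sigma>)"
    unfolding s0_def by (intro field_vector_diff_chain_at)
  from bounded_linear.has_vector_derivative[OF bounded_linear_Re this]
  have "((\<lambda>x. Re (g (Complex x a))) has_real_derivative Re (deriv f s0 / f s0)) (at \<sigma>)"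
    by (simp only: has_real_derivative_iff_has_vector_derivative o_def mult_1)
  hence d: "((\<lambda>x. ln (norm (f s0)) + Re (g (Complex x a))) has_real_derivative Re (deriv f s0 / f s0)) (at \<sigma>)"
    using DERIV_add[OF DERIV_const, of _ "Re (deriv f s0 / f s0)" \<sigma> UNIV "ln (norm (f s0))"] by (simp only: add_0)
  have "isCont f s0" using f' DERIV_isCont by blast
  moreover have "isCont (\<lambda>x. Complex x a) \<sigma>"
    by (auto simp: Complex_eq intro!: continuous_intros)
  ultimately have "isCont (\<lambda>x. f (Complex x a)) \<sigma>" unfolding s0_def by (rule isCont_o2[rotated])
  hence "\<forall>\<^sub>F x in nhds \<sigma>. f (Complex x a) \<noteq> 0"
    using s(2) topological_tendstoD[of "\<lambda>x. f (Complex x a)" "f (Complex \<sigma> a)" "at \<sigma>" "-{0}"]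
      open_Compl[OF closed_singleton[of "0::complex"]]
    by (simp add: eventually_nhds_conv_at isCont_def)
  hence "\<forall>\<^sub>F x in nhds \<sigma>. ln (norm (f s0)) + Re (g (Complex x a)) = ln (norm (f (Complex x a)))"
    by eventually_elim (use s(2) in \<open>simp add: g_def norm_divide ln_div s0_def\<close>)
  from DERIV_cong_ev[OF refl this refl] d show ?thesis by (simp add: s0_def)
qed

text \<open>The left-hand side is the derivative in \<sigma> of a function that is non-increasing by
  \<open>Zfun_three_four_one_mono\<close>; a positive derivative would contradict this just to the
  right of \<sigma>.\<close>

lemma Zfun_log_deriv_three_four_one:
  assumes \<sigma>: "\<sigma> > 1"
  shows "3 * Re (deriv Zfun (of_real \<sigma>) / Zfun (of_real \<sigma>)) + 4 * Re (deriv Zfun (Complex \<sigma> t) / Zfun (Complex \<sigma> t))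
     + Re (deriv Zfun (Complex \<sigma> (2*t)) / Zfun (Complex \<sigma> (2*t))) \<le> 0" (is "?D \<le> 0")
proof (rule ccontr)
  assume "\<not> ?D \<le> 0"
  hence D: "?D > 0" by simp
  have "(\<lambda>s. Zreg s / (s - 1)) holomorphic_on {s. Re s > 1}"
    by (intro holomorphic_intros holomorphic_on_subset[OF holomorphic_Zreg]) auto
  hence hol: "Zfun holomorphic_on {s. Re s > 1}"
    by (rule holomorphic_transform) (auto simp: Zreg_eq_Zfun)
  note der = has_real_derivative_ln_norm[OF hol open_halfspace_Re_gt]
  define \<Phi> where "\<Phi> = (\<lambda>x. 3 * ln (norm (Zfun (Complex x 0))) + 4 * ln (norm (Zfun (Complex x t))) + ln (norm (Zfun (Complex x (2*t)))))"
  have "(\<Phi> has_real_derivative ?D) (at \<sigma>)" unfolding \<Phi>_def complex_of_real_def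
    using \<sigma> by (intro DERIV_add DERIV_cmult der Zfun_nonzero) auto
  from DERIV_pos_inc_right[OF this D] obtain d where d: "d > 0" "\<And>h. 0 < h \<Longrightarrow> h < d \<Longrightarrow> \<Phi> \<sigma> < \<Phi> (\<sigma> + h)" by blast
  define h where "h = d / 2"
  have h: "0 < h" "h < d" using d by (auto simp: h_def)
  have pos: "norm (Zfun (Complex x y)) > 0" if "x > 1" for x y using Zfun_nonzero[of "Complex x y"] that by simp
  have exp: "exp (\<Phi> x) = norm (Zfun (of_real x)) ^ 3 * norm (Zfun (Complex x t)) ^ 4 * norm (Zfun (Complex x (2*t)))"
    if "x > 1" for x
  proof -
    have "exp (real k * ln y) = y ^ k" if "y > 0" for y :: real and k
      using that by (simp add: exp_of_nat_mult)
    from this[OF pos[OF that], of 3] this[OF pos[OF that], of 4] pos[OF that] show ?thesis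
      unfolding \<Phi>_def by (simp add: exp_add complex_of_real_def)
  qed
  have "exp (\<Phi> (\<sigma> + h)) \<le> exp (\<Phi> \<sigma>)"
    using Zfun_three_four_one_mono[of \<sigma> "\<sigma> + h" t] \<sigma> h by (simp add: exp)
  thus False using d(2)[OF h] by simp
qed

lemma deriv_Zfun_div:
  assumes "Re s > 1"
  shows "deriv Zfun s / Zfun s = deriv Zreg s / Zreg s - 1 / (s - 1)"
proof -
  have s1: "s \<noteq> 1" using assms by auto
  have Z': "(Zreg has_field_derivative deriv Zreg s) (at s)"
    using assms by (intro holomorphic_derivI[OF holomorphic_Zreg open_halfspace_Re_gt]) auto
  have "((\<lambda>s. Zreg s / (s - 1)) has_field_derivative (deriv Zreg s * (s - 1) - Zreg s) / (s - 1)^2) (at s)"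
    using s1 by (auto intro!: derivative_eq_intros Z' simp: power2_eq_square)
  hence "(Zfun has_field_derivative (deriv Zreg s * (s - 1) - Zreg s) / (s - 1)^2) (at s)"
  proof (rule has_field_derivative_transform_within_open[OF _ open_halfspace_Re_gt])
    show "Zreg z / (z - 1) = Zfun z" if "z \<in> {s. 1 < Re s}" for z
      using that Zreg_eq_Zfun[of z] by auto
  qed (use assms in auto)
  hence "deriv Zfun s = (deriv Zreg s * (s - 1) - Zreg s) / (s - 1)^2" by (rule DERIV_imp_deriv)
  moreover have "Zfun s = Zreg s / (s - 1)" using Zreg_eq_Zfun[OF assms] s1 by simp
  moreover have "(d * u - z) / u^2 / (z / u) = d / z - 1 / u" if "u \<noteq> 0" "z \<noteq> 0" for d u z :: complex
    using that by (simp add: field_simps power2_eq_square)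
  ultimately show ?thesis using s1 Zreg_nonzero_of_Re_gt_1[OF assms] by simp
qed

lemma Re_inverse_le:
  assumes "t \<noteq> 0" "a > 0" shows "Re (1 / Complex a t) \<le> 1 / \<bar>t\<bar>"
proof -
  have "Re (1 / Complex a t) \<le> norm (1 / Complex a t)" by (rule complex_Re_le_cmod)
  also have "\<dots> \<le> 1 / \<bar>t\<bar>" unfolding norm_divide
    using assms abs_Im_le_cmod[of "Complex a t"] by (simp add: frac_le)
  finally show ?thesis .
qed

lemma Zreg_log_deriv_real_bound: "\<exists>C\<ge>0. \<forall>\<sigma>\<in>{1..2}. \<bar>Re (deriv Zreg (of_real \<sigma>) / Zreg (of_real \<sigma>))\<bar> \<le> C"
proof -
  have nz: "Zreg (of_real \<sigma>) \<noteq> 0" if "\<sigma> \<in> {1..2}" for \<sigma>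
    using that Zreg_1_nonzero Zreg_nonzero_of_Re_gt_1[of "of_real \<sigma>"] by (cases "\<sigma> = 1") auto
  have hol: "deriv Zreg holomorphic_on {s. Re s > 1/2}"
    by (rule holomorphic_deriv[OF holomorphic_Zreg open_halfspace_Re_gt])
  have c: "continuous_on {1..2} (\<lambda>\<sigma>. h (complex_of_real \<sigma>))" if "h holomorphic_on {s. Re s > 1/2}" for h
    by (rule continuous_on_compose2[OF holomorphic_on_imp_continuous_on[OF that]]) (auto intro!: continuous_intros)
  have "continuous_on {1..2} (\<lambda>\<sigma>. Re (deriv Zreg (of_real \<sigma>) / Zreg (of_real \<sigma>)))"
    by (intro continuous_intros c[OF hol] c[OF holomorphic_Zreg] continuous_on_Re) (use nz in auto)
  hence "compact ((\<lambda>\<sigma>. Re (deriv Zreg (of_real \<sigma>) / Zreg (of_real \<sigma>))) ` {1..2})"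
    by (intro compact_continuous_image) auto
  from compact_imp_bounded[OF this] show ?thesis unfolding bounded_iff
    by (metis (no_types, lifting) imageI real_norm_def abs_ge_zero order_trans atLeastAtMost_iff order_refl one_le_numeral)
qed

text \<open>Passing from Z to \<open>Zreg\<close> adds the pole terms 1/(s - 1): the real point
  gives 3/(\<sigma> - 1), and the points at heights t and 2t give at most 4/|t| + 1/|t|.\<close>

lemma Zreg_log_deriv_three_four_one:
  assumes \<sigma>: "\<sigma> > 1" and t: "t \<noteq> 0"
  shows "3 * Re (deriv Zreg (of_real \<sigma>) / Zreg (of_real \<sigma>)) + 4 * Re (deriv Zreg (Complex \<sigma> t) / Zreg (Complex \<sigma> t))
     + Re (deriv Zreg (Complex \<sigma> (2*t)) / Zreg (Complex \<sigma> (2*t))) \<le> 3 / (\<sigma> - 1) + 5 / \<bar>t\<bar>"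
proof -
  have 1: "Complex \<sigma> y - 1 = Complex (\<sigma> - 1) y" for y by (simp add: complex_eq_iff)
  have 2: "Re (1 / (complex_of_real \<sigma> - 1)) = 1 / (\<sigma> - 1)"
    by (metis Re_complex_of_real of_real_1 of_real_diff of_real_divide)
  have "Re (1 / Complex (\<sigma> - 1) (2*t)) \<le> 1 / \<bar>2*t\<bar>" using \<sigma> t by (intro Re_inverse_le) auto
  also have "\<dots> \<le> 1 / \<bar>t\<bar>" using t by (intro divide_left_mono) auto
  finally have 3: "Re (1 / Complex (\<sigma> - 1) (2*t)) \<le> 1 / \<bar>t\<bar>" .
  have 4: "Re (1 / Complex (\<sigma> - 1) t) \<le> 1 / \<bar>t\<bar>" using \<sigma> t by (intro Re_inverse_le) auto
  have "3 * (Re (deriv Zreg (of_real \<sigma>) / Zreg (of_real \<sigma>)) - 1 / (\<sigma> - 1))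
     + 4 * (Re (deriv Zreg (Complex \<sigma> t) / Zreg (Complex \<sigma> t)) - Re (1 / Complex (\<sigma> - 1) t))
     + (Re (deriv Zreg (Complex \<sigma> (2*t)) / Zreg (Complex \<sigma> (2*t))) - Re (1 / Complex (\<sigma> - 1) (2*t))) \<le> 0"
    using Zfun_log_deriv_three_four_one[OF \<sigma>, of t] \<sigma> by (simp add: deriv_Zfun_div 1 2 del: Re_divide)
  thus ?thesis using 3 4 by (simp add: algebra_simps)
qed

text \<open>Landau's lemma on discs of radius 1/4 turns the 3-4-1 inequality into a repulsion
  between a zero \<beta> + it and the point \<sigma> + it. The term ln (1 / (\<sigma> - 1)) appears
  because the lower bound for |Zreg| at the centre degenerates as \<sigma> tends to 1; it is
  harmless beside 1/(\<sigma> - 1).\<close>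

lemma Zreg_zero_inequality:
  "\<exists>C\<ge>1. \<forall>t \<sigma> \<beta>. t \<noteq> 0 \<longrightarrow> 1 < \<sigma> \<longrightarrow> \<sigma> \<le> 2 \<longrightarrow> \<beta> \<le> 1 \<longrightarrow> \<sigma> - \<beta> \<le> 1/8 \<longrightarrow> Zreg (Complex \<beta> t) = 0 \<longrightarrow>
     4 / (\<sigma> - \<beta>) \<le> 3 / (\<sigma> - 1) + C * (1 + 1 / \<bar>t\<bar> + ln (4 + 2 * \<bar>t\<bar>) + ln (1 / (\<sigma> - 1)))"
proof -
  obtain A where A: "A \<ge> 1" "\<And>s. Re s > 1/2 \<Longrightarrow> norm (Zreg s) \<le> A * (1 + norm s) ^ 3"
    using Zreg_bound by blast
  obtain C where C: "C \<ge> 0" "\<And>\<sigma>. \<sigma> \<in> {1..2} \<Longrightarrow> \<bar>Re (deriv Zreg (of_real \<sigma>) / Zreg (of_real \<sigma>))\<bar> \<le> C"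
    using Zreg_log_deriv_real_bound by blast
  \<comment> \<open>The exponential of M is the upper bound A (4 + |t|)^3 on the circle divided by
    the lower bound (\<sigma> - 1)^2 / (64 A) at the centre. The latter comes from
    \<open>norm_Zfun_mult_ge_1\<close> together with \<open>Zreg_bound\<close> at the real point
    \<sigma>.\<close>
  define M where "M = (\<lambda>t \<sigma>. ln (64 * A^2) + 3 * ln (4 + \<bar>t\<bar>) + 2 * ln (1 / (\<sigma> - 1)))"
  have A2: "64 * A^2 \<ge> 64" using A by simp
  have M_pos: "M t \<sigma> > 0" if "1 < \<sigma>" "\<sigma> \<le> 2" for t \<sigma>
  proof -
    have "ln (64 * A^2) > 0" using A2 by (intro ln_gt_zero) linarith
    thus ?thesis using that unfolding M_def by (intro add_pos_nonneg) auto
  qed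
  have M_mono: "M t \<sigma> \<le> M (2 * t) \<sigma>" for t \<sigma> unfolding M_def by simp
  have bound: "norm (Zreg z) \<le> exp (M t \<sigma>) * norm (Zreg (Complex \<sigma> t))"
    if \<sigma>: "1 < \<sigma>" "\<sigma> \<le> 2" and z: "dist (Complex \<sigma> t) z = 1/4" for t \<sigma> z
  proof -
    define s0 where "s0 = Complex \<sigma> t"
    have s0: "Re s0 = \<sigma>" "norm s0 \<le> 2 + \<bar>t\<bar>" using \<sigma> cmod_le[of s0] by (auto simp: s0_def)
    have "Re (s0 - z) \<le> 1/4" using complex_Re_le_cmod[of "s0 - z"] z by (simp add: dist_norm s0_def)
    hence "Re z > 1/2" using s0 \<sigma> by simp
    hence "norm (Zreg z) \<le> A * (1 + norm z) ^ 3" by (rule A)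
    also have "norm z \<le> norm s0 + 1/4" using z norm_triangle_ineq2[of z s0] by (simp add: dist_norm s0_def norm_minus_commute)
    hence "A * (1 + norm z) ^ 3 \<le> A * (4 + \<bar>t\<bar>) ^ 3" using A s0 by (intro mult_left_mono power_mono) auto
    finally have 1: "norm (Zreg z) \<le> A * (4 + \<bar>t\<bar>) ^ 3" .
    have "norm (Zfun (of_real \<sigma>)) * (\<sigma> - 1) = norm (Zreg (of_real \<sigma>))"
    proof -
      have "norm (complex_of_real \<sigma> - 1) = \<sigma> - 1"
        using \<sigma> by (metis norm_of_real of_real_1 of_real_diff abs_of_pos diff_gt_0_iff_gt)
      thus ?thesis using \<sigma> by (simp add: Zreg_eq_Zfun norm_mult)
    qed
    also have "\<dots> \<le> A * (1 + norm (complex_of_real \<sigma>)) ^ 3" using \<sigma> by (intro A) auto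
    also have "\<dots> \<le> A * 4 ^ 3" using A \<sigma> by (intro mult_left_mono power_mono) auto
    finally have 2: "norm (Zfun (of_real \<sigma>)) * (\<sigma> - 1) \<le> 64 * A" by simp
    have "(\<sigma> - 1)^2 \<le> (\<sigma> - 1)^2 * (norm (Zfun s0) * norm (Zfun (of_real \<sigma>)))"
      using norm_Zfun_mult_ge_1[of s0] s0 \<sigma> mult_left_mono[of 1 _ "(\<sigma> - 1)^2"] by simp
    also have "\<dots> = ((\<sigma> - 1) * norm (Zfun s0)) * (norm (Zfun (of_real \<sigma>)) * (\<sigma> - 1))"
      by (simp add: power2_eq_square mult_ac)
    also have "\<dots> \<le> norm (Zreg s0) * (64 * A)"
    proof (rule mult_mono[OF _ 2])
      have "\<sigma> - 1 \<le> norm (s0 - 1)" using abs_Re_le_cmod[of "s0 - 1"] s0 by simp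
      thus "(\<sigma> - 1) * norm (Zfun s0) \<le> norm (Zreg s0)" using s0 \<sigma> 
        by (simp add: Zreg_eq_Zfun norm_mult mult_right_mono)
    qed (use \<sigma> in auto)
    finally have 3: "(\<sigma> - 1)^2 \<le> norm (Zreg s0) * (64 * A)" .
    have "exp (M t \<sigma>) = 64 * A^2 * (4 + \<bar>t\<bar>) ^ 3 / (\<sigma> - 1)^2"
    proof -
      have "3 * ln (4 + \<bar>t\<bar>) = ln ((4 + \<bar>t\<bar>) ^ 3)" by (simp add: ln_realpow)
      moreover have "2 * ln (1 / (\<sigma> - 1)) = ln ((1 / (\<sigma> - 1))^2)" using \<sigma> by (simp add: ln_realpow)
      ultimately have "M t \<sigma> = ln (64 * A^2) + ln ((4 + \<bar>t\<bar>) ^ 3) + ln ((1 / (\<sigma> - 1))^2)" unfolding M_def by simp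
      hence "exp (M t \<sigma>) = (64 * A^2) * (4 + \<bar>t\<bar>) ^ 3 * (1 / (\<sigma> - 1))^2"
        using A2 \<sigma> by (simp only: exp_add) (subst exp_ln; auto)+
      thus ?thesis by (simp add: power_divide)
    qed
    hence "exp (M t \<sigma>) * norm (Zreg s0) = A * (4 + \<bar>t\<bar>) ^ 3 * (norm (Zreg s0) * (64 * A) / (\<sigma> - 1)^2)"
      by (simp add: power2_eq_square)
    also have "\<dots> \<ge> A * (4 + \<bar>t\<bar>) ^ 3 * 1"
      using 3 \<sigma> A by (intro mult_left_mono) (auto simp: le_divide_eq)
    finally show ?thesis using 1 by (simp add: s0_def)
  qed
  have holZ: "Zreg holomorphic_on ball (Complex \<sigma> t) (1/3)" if "1 < \<sigma>" for \<sigma> t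
  proof (rule holomorphic_on_subset[OF holomorphic_Zreg], rule subsetI)
    fix z assume "z \<in> ball (Complex \<sigma> t) (1/3)"
    hence "Re (Complex \<sigma> t - z) < 1/3" using complex_Re_le_cmod[of "Complex \<sigma> t - z"] by (simp add: dist_norm)
    thus "z \<in> {s. 1/2 < Re s}" using that by simp
  qed
  have zeros: "Re z < Re (Complex \<sigma> t)" if "Zreg z = 0" "1 < \<sigma>" for z \<sigma> t
    using that Zreg_nonzero_of_Re_gt_1[of z] by force
  \<comment> \<open>With R = 1/4 Landau's error is 8M/R = 32M; the weights 4 at height t and 1 at
    height 2t add up to 160 M, both heights being bounded by the value at 2t. The condition \<sigma>
    - \<beta> \<le> 1/8 = R/2 places the zero in the inner disc.\<close>
  have main: "4 / (\<sigma> - \<beta>) \<le> 3 / (\<sigma> - 1) + 5 / \<bar>t\<bar> + 3 * C + 160 * M (2 * t) \<sigma>"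
    if t: "t \<noteq> 0" and \<sigma>: "1 < \<sigma>" "\<sigma> \<le> 2" and \<beta>: "\<beta> \<le> 1" "\<sigma> - \<beta> \<le> 1/8" and zero: "Zreg (Complex \<beta> t) = 0" for t \<sigma> \<beta>
  proof -
    have nz: "Zreg (Complex \<sigma> y) \<noteq> 0" for y using \<sigma> Zreg_nonzero_of_Re_gt_1[of "Complex \<sigma> y"] by simp
    have "Complex \<sigma> t - of_real (\<sigma> - \<beta>) = Complex \<beta> t" by (simp add: complex_eq_iff)
    hence 1: "Re (deriv Zreg (Complex \<sigma> t) / Zreg (Complex \<sigma> t)) \<ge> 1 / (\<sigma> - \<beta>) - 8 * M t \<sigma> / (1/4)"
      using \<sigma> \<beta> zero by (intro Re_log_deriv_ge_zero[where R' = "1/3"] M_pos holZ nz bound zeros) auto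
    have 2: "Re (deriv Zreg (Complex \<sigma> (2*t)) / Zreg (Complex \<sigma> (2*t))) \<ge> - (8 * M (2*t) \<sigma> / (1/4))"
      using \<sigma> by (intro Re_log_deriv_ge[where R' = "1/3"] M_pos holZ nz bound zeros) auto
    have 3: "Re (deriv Zreg (of_real \<sigma>) / Zreg (of_real \<sigma>)) \<ge> - C" using C(2)[of \<sigma>] \<sigma> by (simp add: abs_le_iff)
    show ?thesis using Zreg_log_deriv_three_four_one[OF \<sigma>(1) t] 1 2 3 M_mono[of t \<sigma>] by (simp add: algebra_simps)
  qed
  define K where "K = 5 + 3 * C + 160 * (ln (64 * A^2) + 3)"
  have lnA: "ln (64 * A^2) \<ge> 0" using A2 by (intro ln_ge_zero) linarith
  have "4 / (\<sigma> - \<beta>) \<le> 3 / (\<sigma> - 1) + K * (1 + 1 / \<bar>t\<bar> + ln (4 + 2 * \<bar>t\<bar>) + ln (1 / (\<sigma> - 1)))"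
    if h: "t \<noteq> 0" "1 < \<sigma>" "\<sigma> \<le> 2" "\<beta> \<le> 1" "\<sigma> - \<beta> \<le> 1/8" "Zreg (Complex \<beta> t) = 0" for t \<sigma> \<beta>
  proof -
    have l: "ln (1 / (\<sigma> - 1)) \<ge> 0" "ln (4 + 2 * \<bar>t\<bar>) \<ge> 0" "1 / \<bar>t\<bar> \<ge> 0" using h by auto
    have k: "K \<ge> 5" "K \<ge> 320" "K \<ge> 480" "K \<ge> 3 * C + 160 * ln (64 * A^2)" unfolding K_def using C lnA by auto
    have "5 * (1 / \<bar>t\<bar>) \<le> K * (1 / \<bar>t\<bar>)" "480 * ln (4 + 2 * \<bar>t\<bar>) \<le> K * ln (4 + 2 * \<bar>t\<bar>)"
      "320 * ln (1 / (\<sigma> - 1)) \<le> K * ln (1 / (\<sigma> - 1))" using k l by (intro mult_right_mono; simp)+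
    moreover have "160 * M (2 * t) \<sigma> = 160 * ln (64 * A^2) + 480 * ln (4 + 2 * \<bar>t\<bar>) + 320 * ln (1 / (\<sigma> - 1))"
      by (simp add: M_def abs_mult algebra_simps)
    ultimately have "5 / \<bar>t\<bar> + 3 * C + 160 * M (2 * t) \<sigma> \<le> K * 1 + K * (1 / \<bar>t\<bar>) + K * ln (4 + 2 * \<bar>t\<bar>) + K * ln (1 / (\<sigma> - 1))"
      using k by simp
    also have "\<dots> = K * (1 + 1 / \<bar>t\<bar> + ln (4 + 2 * \<bar>t\<bar>) + ln (1 / (\<sigma> - 1)))" by (simp only: distrib_left)
    finally show ?thesis using main[OF h] by simp
  qed
  moreover have "K \<ge> 1" unfolding K_def using C lnA by auto
  ultimately show ?thesis by (intro exI[of _ K]) blast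
qed

text \<open>For a zero on the line and \<sigma> = 1 + d the repulsion inequality becomes 4/d \<le>
  3/d + O(1 + ln (1/d)), which fails for small d.\<close>

lemma Zreg_nonzero_line: "Zreg (Complex 1 t) \<noteq> 0"
proof (cases "t = 0")
  case True
  thus ?thesis using Zreg_1_nonzero by (simp add: complex_of_real_def[symmetric])
next
  case False
  obtain C where C: "C \<ge> 1" "\<And>t \<sigma> \<beta>. t \<noteq> 0 \<Longrightarrow> 1 < \<sigma> \<Longrightarrow> \<sigma> \<le> 2 \<Longrightarrow> \<beta> \<le> 1 \<Longrightarrow> \<sigma> - \<beta> \<le> 1/8 \<Longrightarrow> Zreg (Complex \<beta> t) = 0 \<Longrightarrow>
     4 / (\<sigma> - \<beta>) \<le> 3 / (\<sigma> - 1) + C * (1 + 1 / \<bar>t\<bar> + ln (4 + 2 * \<bar>t\<bar>) + ln (1 / (\<sigma> - 1)))"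
    using Zreg_zero_inequality by blast
  show ?thesis
  proof
    assume zero: "Zreg (Complex 1 t) = 0"
    define K where "K = 1 + 1 / \<bar>t\<bar> + ln (4 + 2 * \<bar>t\<bar>)"
    have K: "K \<ge> 1" unfolding K_def by auto
    \<comment> \<open>With d = 1/n^2 the inequality reads n^2 \<le> C K + 2 C ln n, and its
      right-hand side is at most (C K + 2 C) n < n^2 for this n.\<close>
    define n where "n = C * K + 2 * C + 3"
    have "C * K \<ge> 0" using C K by simp
    note CK = this
    hence n: "n \<ge> 3" unfolding n_def using C by simp
    have n2: "n\<^sup>2 \<ge> 9" using power_mono[of 3 n 2] n by simp
    define d where "d = 1 / n^2"
    have d: "0 < d" "d \<le> 1/8" using n n2 frac_le[of 1 1 8 "n^2"] by (auto simp: d_def)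
    have "4 / d \<le> 3 / d + C * (K + ln (1 / d))"
      using C(2)[OF False, of "1 + d" 1] d zero unfolding K_def by simp
    hence "1 / d \<le> C * (K + ln (1 / d))" by (simp add: divide_simps split: if_splits)
    moreover have "ln (1 / d) = 2 * ln n" using n by (simp add: d_def ln_realpow)
    ultimately have "n^2 \<le> C * K + 2 * C * ln n" by (simp add: d_def algebra_simps)
    also have "\<dots> \<le> C * K * n + 2 * C * n"
    proof (rule add_mono)
      show "C * K \<le> C * K * n" using n CK mult_left_mono[of 1 n "C * K"] by simp
      show "2 * C * ln n \<le> 2 * C * n" using n C(1) ln_bound[of n] by (intro mult_left_mono) auto
    qed
    also have "\<dots> < n * n" using n unfolding n_def by (simp add: algebra_simps)
    finally show False by (simp add: power2_eq_square)
  qed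
qed

text \<open>Take \<sigma> = 1 + d with d = \<kappa>/l, where l = ln (4 + 2|t|). If 1 - \<beta> < d/7
  then \<sigma> - \<beta> < 8d/7, so the left-hand side of the repulsion inequality exceeds 7/(2d),
  while its right-hand side is at most 3/d + 1/(2d).\<close>

lemma Zreg_zero_free_large:
  "\<exists>\<kappa>>0. \<forall>s. \<bar>Im s\<bar> \<ge> 1 \<longrightarrow> Re s > 1 - \<kappa> / ln (4 + 2 * \<bar>Im s\<bar>) \<longrightarrow> Zreg s \<noteq> 0"
proof -
  obtain C where C: "C \<ge> 1" "\<And>t \<sigma> \<beta>. t \<noteq> 0 \<Longrightarrow> 1 < \<sigma> \<Longrightarrow> \<sigma> \<le> 2 \<Longrightarrow> \<beta> \<le> 1 \<Longrightarrow> \<sigma> - \<beta> \<le> 1/8 \<Longrightarrow> Zreg (Complex \<beta> t) = 0 \<Longrightarrow>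
     4 / (\<sigma> - \<beta>) \<le> 3 / (\<sigma> - 1) + C * (1 + 1 / \<bar>t\<bar> + ln (4 + 2 * \<bar>t\<bar>) + ln (1 / (\<sigma> - 1)))"
    using Zreg_zero_inequality by blast
  \<comment> \<open>\<kappa> is the square of 1/k because ln (1/d) itself contributes a multiple of
    k: the remainder is at most 6 C k l, which equals k^2 l / 2 = 1/(2d) for k = 12 C.\<close>
  define k where "k = 12 * C"
  define \<kappa> where "\<kappa> = 1 / k^2"
  have k: "k \<ge> 12" using C by (simp add: k_def)
  have k2: "k^2 \<ge> 144" using power_mono[of 12 k 2] k by simp
  have \<kappa>: "0 < \<kappa>" "\<kappa> \<le> 1/144" using k k2 frac_le[of 1 1 144 "k^2"] by (auto simp: \<kappa>_def)
  have "Zreg s \<noteq> 0" if t: "\<bar>Im s\<bar> \<ge> 1" and Re: "Re s > 1 - \<kappa> / 7 / ln (4 + 2 * \<bar>Im s\<bar>)" for s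
  proof
    assume zero: "Zreg s = 0"
    define t where "t = Im s"
    define \<beta> where "\<beta> = Re s"
    define l where "l = ln (4 + 2 * \<bar>t\<bar>)"
    have \<beta>: "\<beta> \<le> 1" using zero Zreg_nonzero_of_Re_gt_1[of s] by (force simp: \<beta>_def)
    have l: "l \<ge> 1"
    proof -
      have "exp 1 \<le> 4 + 2 * \<bar>t\<bar>" using exp_le by simp
      thus ?thesis unfolding l_def by (subst ln_ge_iff) auto
    qed
    define d where "d = \<kappa> / l"
    have d: "0 < d" "d \<le> \<kappa>" using \<kappa> l by (auto simp: d_def divide_le_eq mult_le_cancel_left1)
    have b: "1 - \<beta> < d / 7" using Re by (simp add: \<beta>_def d_def l_def t_def)
    have "4 / (1 + d - \<beta>) \<le> 3 / d + C * (1 + 1 / \<bar>t\<bar> + l + ln (1 / d))"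
      using C(2)[of t "1 + d" \<beta>] zero t \<beta> b d \<kappa> by (simp add: t_def \<beta>_def l_def)
    moreover have "1 / \<bar>t\<bar> \<le> 1" using t by (simp add: t_def)
    moreover have "ln (1 / d) \<le> l + k * 2"
    proof -
      have "ln (1 / d) = ln (l * k^2)" by (simp add: d_def \<kappa>_def mult.commute)
      also have "\<dots> = ln l + 2 * ln k" using l k by (simp add: ln_mult ln_realpow)
      also have "\<dots> \<le> l + 2 * k" using ln_bound[of l] ln_bound[of k] l k by (intro add_mono mult_left_mono) auto
      finally show ?thesis by (simp add: mult.commute)
    qed
    ultimately have "4 / (1 + d - \<beta>) \<le> 3 / d + C * (1 + 1 + l + (l + k * 2))"
      using C(1) by (elim order_trans) (intro add_left_mono mult_left_mono add_mono, auto)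
    also have "C * (1 + 1 + l + (l + k * 2)) \<le> C * (6 * (k * l))"
    proof (intro mult_left_mono)
      have "1 * 1 \<le> k * l" "1 * l \<le> k * l" "k * 1 \<le> k * l" using k l by (intro mult_mono; simp)+
      thus "1 + 1 + l + (l + k * 2) \<le> 6 * (k * l)" by simp
    qed (use C in auto)
    also have "C * (6 * (k * l)) = (1 / 2) / d"
      using l k by (simp add: d_def \<kappa>_def k_def power2_eq_square)
    finally have "4 / (1 + d - \<beta>) \<le> (7 / 2) / d" by (simp add: add_divide_distrib[symmetric])
    moreover have "4 / (1 + d - \<beta>) > 4 / (8 / 7 * d)" using b d \<beta> by (intro divide_strict_left_mono mult_pos_pos) auto
    ultimately show False using d by simp
  qed
  thus ?thesis using \<kappa> by (intro exI[of _ "\<kappa> / 7"]) auto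
qed

text \<open>At heights below 1 compactness replaces the inequality: the zeros in a closed box
  reaching up to Re s = 1 form a compact set that misses this line, hence keep a distance \<delta>
  from it. The 4 inside the logarithm makes it at least 1, so that c / ln (4 + 2|t|) \<le> c \<le>
  1/8 stays within the box.\<close>

theorem Zreg_zero_free_region:
  "\<exists>c>0. c \<le> 1/8 \<and> (\<forall>s. Re s > 1 - c / ln (4 + 2 * \<bar>Im s\<bar>) \<longrightarrow> Zreg s \<noteq> 0)"
proof -
  obtain \<kappa> where \<kappa>: "\<kappa> > 0" "\<And>s. \<bar>Im s\<bar> \<ge> 1 \<Longrightarrow> Re s > 1 - \<kappa> / ln (4 + 2 * \<bar>Im s\<bar>) \<Longrightarrow> Zreg s \<noteq> 0"
    using Zreg_zero_free_large by blast
  define F where "F = {z \<in> cbox (Complex (3/4) (-1)) (Complex 1 1). Zreg z = 0}"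
  have sub: "cbox (Complex (3/4) (-1)) (Complex 1 1) \<subseteq> {s. Re s > 1/2}" by (auto simp: in_cbox_complex_iff)
  have "closed F" unfolding F_def
    by (intro continuous_closed_preimage_constant holomorphic_on_imp_continuous_on
        holomorphic_on_subset[OF holomorphic_Zreg sub] closed_cbox)
  moreover have "bounded F" unfolding F_def by (rule bounded_subset[OF bounded_cbox]) auto
  ultimately have cF: "compact F" by (simp add: compact_eq_bounded_closed)
  have "\<exists>\<delta>>0. \<forall>z\<in>F. Re z < 1 - \<delta>"
  proof (cases "F = {}")
    case False
    have "continuous_on F Re" by (intro continuous_intros)
    from continuous_attains_sup[OF cF False this] obtain a where a: "a \<in> F" "\<And>z. z \<in> F \<Longrightarrow> Re z \<le> Re a" by blast
    hence "Re a \<le> 1" "Zreg a = 0" by (auto simp: F_def in_cbox_complex_iff)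
    moreover have "Re a \<noteq> 1" using Zreg_nonzero_line[of "Im a"] \<open>Zreg a = 0\<close> by (metis complex.collapse)
    ultimately have a1: "Re a < 1" by simp
    show ?thesis
    proof (intro exI[of _ "(1 - Re a) / 2"] conjI ballI)
      fix z assume "z \<in> F"
      hence "Re z \<le> Re a" by (rule a(2))
      thus "Re z < 1 - (1 - Re a) / 2" using a1 by (simp add: field_simps)
    qed (use a1 in auto)
  qed (auto intro: exI[of _ 1])
  then obtain \<delta> where \<delta>: "\<delta> > 0" "\<And>z. z \<in> F \<Longrightarrow> Re z < 1 - \<delta>" by blast
  define c where "c = min (min \<kappa> \<delta>) (1/8)"
  have c: "c > 0" "c \<le> 1/8" "c \<le> \<kappa>" "c \<le> \<delta>" using \<kappa> \<delta> by (auto simp: c_def)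
  have "Zreg s \<noteq> 0" if s: "Re s > 1 - c / ln (4 + 2 * \<bar>Im s\<bar>)" for s
  proof (cases "\<bar>Im s\<bar> \<ge> 1")
    case True
    have "ln (4 + 2 * \<bar>Im s\<bar>) > 0" by (intro ln_gt_zero) auto
    hence "c / ln (4 + 2 * \<bar>Im s\<bar>) \<le> \<kappa> / ln (4 + 2 * \<bar>Im s\<bar>)" using c by (intro divide_right_mono) auto
    thus ?thesis using \<kappa>(2)[OF True] s by simp
  next
    case False
    have "exp 1 \<le> 4 + 2 * \<bar>Im s\<bar>" using exp_le by simp
    hence "ln (4 + 2 * \<bar>Im s\<bar>) \<ge> 1" by (subst ln_ge_iff) auto
    hence "c / ln (4 + 2 * \<bar>Im s\<bar>) \<le> c" using c by (simp add: divide_le_eq mult_le_cancel_left1)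
    hence Re: "Re s > 1 - c" using s by simp
    show ?thesis
    proof
      assume z: "Zreg s = 0"
      hence "Re s \<le> 1" using Zreg_nonzero_of_Re_gt_1[of s] by force
      hence "s \<in> F" using z Re False c by (auto simp: F_def in_cbox_complex_iff)
      from \<delta>(2)[OF this] Re c show False by simp
    qed
  qed
  thus ?thesis using c by blast
qed

section \<open>Growth under the Riemann hypothesis\<close>

text \<open>Three sources: the Euler product for Re s > 1, \<open>Zreg_nonzero_line\<close> on the
  line Re s = 1, and the hypothesis inside the strip.\<close>

lemma RH_Zreg_nonzero:
  assumes RH: "RH_zeta_L4" and s: "Re s > 1/2"
  shows "Zreg s \<noteq> 0"
proof -
  consider "Re s > 1" | "Re s = 1" | "Re s < 1" by linarith
  thus ?thesis
  proof cases
    case 1 thus ?thesis by (rule Zreg_nonzero_of_Re_gt_1)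
  next
    case 2 thus ?thesis using Zreg_nonzero_line[of "Im s"] by (metis complex.collapse)
  next
    case 3
    have "zeta s \<noteq> 0" "L_chi4 s \<noteq> 0" using RH s 3 unfolding RH_zeta_L4_def by force+
    moreover have "s \<noteq> 1" using 3 by auto
    ultimately show ?thesis using zeta_reg_eq_zeta[OF s 3] by (simp add: Zreg_def)
  qed
qed

text \<open>Cauchy's inequality on the small circle controls the first K Taylor coefficients and on
  the large circle the geometric tail. The factor of B3 can be made as small as desired by enlarging
  K, which serves the purpose of the three circles theorem when B3 is only logarithmically
  large.\<close>

lemma norm_le_of_two_discs:
  assumes holg: "g holomorphic_on ball z0 R" and r: "0 < \<rho>1" "\<rho>1 < R" "0 < r2" "r2 < \<rho>3" "\<rho>3 < R"
    and b1: "\<And>z. dist z0 z = \<rho>1 \<Longrightarrow> norm (g z) \<le> B1" and b3: "\<And>z. dist z0 z = \<rho>3 \<Longrightarrow> norm (g z) \<le> B3"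
    and B: "B1 \<ge> 0" "B3 \<ge> 0" and z: "dist z0 z \<le> r2"
  shows "norm (g z) \<le> (\<Sum>k<K. B1 * (r2 / \<rho>1) ^ k) + B3 * ((r2 / \<rho>3) ^ K / (1 - r2 / \<rho>3))"
proof -
  define a where "a = (\<lambda>n. (deriv ^^ n) g z0 / fact n * (z - z0) ^ n)"
  define \<theta> where "\<theta> = r2 / \<rho>3"
  have \<theta>: "0 < \<theta>" "\<theta> < 1" using r by (auto simp: \<theta>_def)
  have sums: "a sums g z" unfolding a_def
    using holg z r by (intro holomorphic_power_series) auto
  have co: "norm ((deriv ^^ n) g z0 / fact n) \<le> B / \<rho> ^ n" if "0 < \<rho>" "\<rho> < R" "\<And>z. dist z0 z = \<rho> \<Longrightarrow> norm (g z) \<le> B" for \<rho> B n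
  proof -
    have "norm ((deriv ^^ n) g z0) \<le> fact n * B / \<rho> ^ n"
    proof (rule Cauchy_inequality)
      show "g holomorphic_on ball z0 \<rho>" using that by (intro holomorphic_on_subset[OF holg]) auto
      show "continuous_on (cball z0 \<rho>) g"
        using that by (intro holomorphic_on_imp_continuous_on holomorphic_on_subset[OF holg]) auto
    qed (use that in \<open>auto simp: dist_norm\<close>)
    hence "norm ((deriv ^^ n) g z0) / fact n \<le> fact n * B / \<rho> ^ n / fact n" by (rule divide_right_mono) simp
    thus ?thesis by (simp add: norm_divide)
  qed
  have zz: "norm (z - z0) ^ n \<le> r2 ^ n" for n using z by (intro power_mono) (auto simp: dist_norm norm_minus_commute)
  have an: "norm (a n) \<le> B * (r2 / \<rho>) ^ n" if "0 < \<rho>" "\<rho> < R" "\<And>z. dist z0 z = \<rho> \<Longrightarrow> norm (g z) \<le> B" "B \<ge> 0" for \<rho> B n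
  proof -
    have "norm (a n) = norm ((deriv ^^ n) g z0 / fact n) * norm (z - z0) ^ n" unfolding a_def norm_mult norm_power ..
    also have "\<dots> \<le> B / \<rho> ^ n * r2 ^ n" using that by (intro mult_mono co zz) auto
    finally show ?thesis by (simp add: power_divide)
  qed
  have a1: "norm (a n) \<le> B1 * (r2 / \<rho>1) ^ n" for n using an[of \<rho>1 B1 n] r b1 B by simp
  have a3: "norm (a n) \<le> B3 * \<theta> ^ n" for n using an[of \<rho>3 B3 n] r b3 B by (simp add: \<theta>_def)
  have g: "summable (\<lambda>n. B3 * \<theta> ^ n)" using \<theta> by (intro summable_mult summable_geometric) auto
  have s: "summable (\<lambda>n. norm (a n))" by (rule summable_comparison_test'[OF g, of 0]) (use a3 in auto)
  have "norm (g z) \<le> (\<Sum>n. norm (a n))" using sums summable_norm[OF s] by (simp add: sums_iff)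
  also have "\<dots> = (\<Sum>n. norm (a (n + K))) + (\<Sum>n<K. norm (a n))" by (rule suminf_split_initial_segment[OF s])
  also have "(\<Sum>n. norm (a (n + K))) \<le> (\<Sum>n. B3 * \<theta> ^ K * \<theta> ^ n)"
  proof (intro suminf_le)
    show "norm (a (n + K)) \<le> B3 * \<theta> ^ K * \<theta> ^ n" for n using a3[of "n + K"] by (simp add: power_add mult_ac)
    show "summable (\<lambda>n. norm (a (n + K)))" using s by (simp add: summable_iff_shift[of "\<lambda>n. norm (a n)"])
    show "summable (\<lambda>n. B3 * \<theta> ^ K * \<theta> ^ n)" using \<theta> by (intro summable_mult summable_geometric) auto
  qed
  also have "(\<Sum>n. B3 * \<theta> ^ K * \<theta> ^ n) = B3 * \<theta> ^ K * (1 / (1 - \<theta>))"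
    using \<theta> by (subst suminf_mult) (auto simp: suminf_geometric summable_geometric)
  also have "(\<Sum>n<K. norm (a n)) \<le> (\<Sum>k<K. B1 * (r2 / \<rho>1) ^ k)" by (intro sum_mono a1)
  finally show ?thesis by (simp add: \<theta>_def)
qed

lemma norm_Zfun_le_of_Re_ge:
  "\<exists>C>0. \<forall>s. Re s \<ge> 3/2 \<longrightarrow> norm (Zfun s) \<le> C"
proof -
  let ?z = "\<Sum>n. real (Suc n) powr (-3/2)"
  have sz: "summable (\<lambda>n. real (Suc n) powr (-3/2))"
    using summable_Suc_iff[of "\<lambda>n. real n powr (-3/2)"] by (simp add: summable_real_powr_iff)
  have z0: "?z > 0" by (intro suminf_pos sz) auto
  have bnd: "norm (suminf f) \<le> ?z" if "\<And>n. norm (f n) \<le> real (Suc n) powr (-3/2)" for f :: "nat \<Rightarrow> complex"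
  proof -
    have sn: "summable (\<lambda>n. norm (f n))" by (rule summable_comparison_test'[OF sz, of 0]) (use that in auto)
    have "norm (suminf f) \<le> (\<Sum>n. norm (f n))" by (rule summable_norm[OF sn])
    also have "\<dots> \<le> ?z" by (intro suminf_le that sn sz)
    finally show ?thesis .
  qed
  have pw: "norm (of_nat (Suc n) powr (-s) :: complex) \<le> real (Suc n) powr (-3/2)" if "Re s \<ge> 3/2" for n s
  proof -
    have "norm (of_nat (Suc n) powr (-s) :: complex) = real (Suc n) powr (- Re s)" by (simp add: norm_powr_real_powr)
    also have "\<dots> \<le> real (Suc n) powr (-3/2)" using that by (intro powr_mono) auto
    finally show ?thesis .
  qed
  have "norm (Zfun s) \<le> ?z * ?z" if s: "Re s \<ge> 3/2" for s
  proof -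
    have "Re s > 1" using s by simp
    hence "zeta_sum s = (\<Sum>n. of_nat (Suc n) powr (-s))" using zeta_sum_Suc_sums by (simp add: sums_iff)
    hence 1: "norm (zeta_sum s) \<le> ?z" using bnd[of "\<lambda>n. of_nat (Suc n) powr (-s)"] pw[OF s] by simp
    have "norm (of_int (chi4 (Suc n)) * of_nat (Suc n) powr (-s) :: complex) \<le> real (Suc n) powr (-3/2)" for n
    proof -
      have "norm (of_int (chi4 (Suc n)) * of_nat (Suc n) powr (-s) :: complex) \<le> norm (of_nat (Suc n) powr (-s) :: complex)"
        unfolding norm_mult by (rule mult_left_le_one_le) (auto simp: chi4_def)
      thus ?thesis using pw[OF s, of n] by (rule order_trans)
    qed
    hence 2: "norm (L_chi4 s) \<le> ?z" unfolding L_chi4_def by (rule bnd)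
    show ?thesis unfolding Zfun_def norm_mult using 1 2 z0 by (intro mult_mono) auto
  qed
  thus ?thesis using z0 by (intro exI[of _ "?z * ?z"]) auto
qed

text \<open>On discs about \<open>3 + it\<close>, the Taylor coefficients of \<open>log Z\<close> are bounded on a small disc by a
  constant and on a large one by \<open>log |t|\<close>; cutting the Taylor series at a fixed large order gives
  \<open>log |Z(s)| \<le> \<eta> log |t| + O(1)\<close>.\<close>

lemma RH_Zreg_bound:
  assumes RH: "RH_zeta_L4" and a: "1/2 < a" "a \<le> 1" and \<eta>: "\<eta> > 0"
  shows "\<exists>C>0. \<forall>s. a \<le> Re s \<longrightarrow> Re s \<le> 2 \<longrightarrow> \<bar>Im s\<bar> \<ge> 3 \<longrightarrow> norm (Zreg s / (s - 1)) \<le> C * \<bar>Im s\<bar> powr \<eta>"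
proof -
  obtain A where A: "A \<ge> 1" "\<And>s. Re s > 1/2 \<Longrightarrow> norm (Zreg s) \<le> A * (1 + norm s) ^ 3"
    using Zreg_bound by blast
  obtain B where B: "B > 0" "\<And>s. Re s \<ge> 3/2 \<Longrightarrow> norm (Zfun s) \<le> B"
    using norm_Zfun_le_of_Re_ge by blast
  define f where "f = (\<lambda>s. Zreg s / (s - 1))"
  have fZ: "f s = Zfun s" if "Re s > 1" for s using that Zreg_eq_Zfun[of s] by (auto simp: f_def)
  \<comment> \<open>The discs are centred at 3 + it: the target s lies within 3 - a < 5/2, radius
    5/2 just reaches the line Re s = 1/2, and \<rho>3 is halfway between the two.\<close>
  define r2 where "r2 = 3 - a"
  define \<rho>3 where "\<rho>3 = (r2 + 5/2) / 2"
  define \<theta> where "\<theta> = r2 / \<rho>3"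
  have r: "0 < r2" "r2 < \<rho>3" "\<rho>3 < 5/2" using a by (auto simp: r2_def \<rho>3_def)
  have \<theta>: "0 < \<theta>" "\<theta> < 1" using r by (auto simp: \<theta>_def)
  define c where "c = 2 * \<rho>3 / (5/2 - \<rho>3) / (1 - \<theta>)"
  have c: "c > 0" using r \<theta> by (simp add: c_def)
  have "(\<lambda>K. \<theta> ^ K) \<longlonglongrightarrow> 0" using \<theta> by (intro LIMSEQ_realpow_zero) auto
  hence "\<forall>\<^sub>F K in sequentially. \<theta> ^ K < \<eta> / (9 * c)" using \<eta> c by (intro order_tendstoD) auto
  \<comment> \<open>On the large circle log f is bounded by a multiple of M1, at most D + 9 ln |t|.
    Making c \<theta>^K smaller than \<eta>/9 turns this into \<eta> ln |t| plus a constant; K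
    depends on a and \<eta> but not on t.\<close>
  then obtain K where K: "\<theta> ^ K < \<eta> / (9 * c)" using eventually_happens trivial_limit_sequentially by blast
  define D where "D = \<bar>ln (2 * A * B)\<bar> + 1"
  have D: "D > 0" by (simp add: D_def)
  define M0 where "M0 = \<bar>ln (B * B)\<bar> + 1"
  have M0: "M0 > 0" by (simp add: M0_def)
  define S where "S = (\<Sum>k<K. 4 * M0 * (r2 / 1) ^ k)"
  define C where "C = B * exp (S + D * \<eta> / 9)"
  have "norm (f s) \<le> C * \<bar>Im s\<bar> powr \<eta>" if s: "a \<le> Re s" "Re s \<le> 2" "\<bar>Im s\<bar> \<ge> 3" for s
  proof -
    define t where "t = Im s"
    define s0 where "s0 = Complex 3 t"
    have t: "\<bar>t\<bar> \<ge> 3" using s by (simp add: t_def)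
    have inb: "Re z > 1/2" "\<bar>Im z\<bar> > 1/2" "norm z \<le> 6 + \<bar>t\<bar>" if "z \<in> ball s0 (5/2)" for z
    proof -
      have d: "norm (s0 - z) < 5/2" using that by (simp add: dist_norm)
      show "Re z > 1/2" using complex_Re_le_cmod[of "s0 - z"] d by (simp add: s0_def)
      show "\<bar>Im z\<bar> > 1/2" using abs_Im_le_cmod[of "s0 - z"] d t by (simp add: s0_def abs_if split: if_splits)
      have "norm s0 \<le> 3 + \<bar>t\<bar>" using cmod_le[of s0] by (simp add: s0_def)
      thus "norm z \<le> 6 + \<bar>t\<bar>" using norm_triangle_ineq2[of z s0] d by (simp add: norm_minus_commute)
    qed
    have nz: "f z \<noteq> 0" if "z \<in> ball s0 (5/2)" for z
    proof -
      have "z \<noteq> 1" using inb(2)[OF that] by auto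
      thus ?thesis using RH_Zreg_nonzero[OF RH inb(1)[OF that]] by (simp add: f_def)
    qed
    have holf: "f holomorphic_on ball s0 (5/2)" unfolding f_def
      using inb by (intro holomorphic_intros holomorphic_on_subset[OF holomorphic_Zreg]) force+
    obtain g0 where g0: "g0 holomorphic_on ball s0 (5/2)" "\<And>z. z \<in> ball s0 (5/2) \<Longrightarrow> f z = exp (g0 z)"
      using nz by (rule_tac starlike_holomorphic_log[OF _ open_ball holf]) (auto intro!: convex_imp_starlike)
    define g where "g = (\<lambda>z. g0 z - g0 s0)"
    have holg: "g holomorphic_on ball s0 (5/2)" unfolding g_def by (intro holomorphic_intros g0)
    have s0b: "s0 \<in> ball s0 (5/2)" by simp
    have fs0: "norm (f s0) \<ge> 1 / B" "norm (f s0) \<le> B"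
    proof -
      have "1 \<le> norm (Zfun s0) * norm (Zfun (of_real (Re s0)))" by (rule norm_Zfun_mult_ge_1) (simp add: s0_def)
      also have "\<dots> \<le> norm (Zfun s0) * B" by (intro mult_left_mono B) (auto simp: s0_def)
      finally show "norm (f s0) \<ge> 1 / B" using B fZ[of s0] by (simp add: s0_def field_simps)
      show "norm (f s0) \<le> B" using B(2)[of s0] fZ[of s0] by (simp add: s0_def)
    qed
    have expg: "norm (f z) = norm (f s0) * exp (Re (g z))" if "z \<in> ball s0 (5/2)" for z
      using g0(2)[OF that] g0(2)[OF s0b] by (simp add: g_def exp_diff)
    have Re_g: "Re (g z) \<le> ln (X * B)" if "z \<in> ball s0 (5/2)" "norm (f z) \<le> X" "X > 0" for z X
    proof -
      have "1 / B * exp (Re (g z)) \<le> norm (f s0) * exp (Re (g z))" using fs0 by (intro mult_right_mono) auto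
      also have "\<dots> \<le> X" using expg[OF that(1)] that by simp
      finally have "exp (Re (g z)) \<le> X * B" using B by (simp add: field_simps)
      thus ?thesis using that B by (simp add: ln_ge_iff)
    qed
    have b1: "norm (g z) \<le> 4 * M0" if "dist s0 z = 1" for z
    proof -
      have "norm (g z) \<le> 2 * M0 * dist s0 z / (3/2 - dist s0 z)"
      proof (rule Borel_Caratheodory(1))
        show "g holomorphic_on ball s0 (3/2)" by (rule holomorphic_on_subset[OF holg]) auto
        fix w assume w: "w \<in> ball s0 (3/2)"
        have "Re w > 3/2" using complex_Re_le_cmod[of "s0 - w"] w by (simp add: s0_def dist_norm)
        hence "norm (f w) \<le> B" using B(2)[of w] fZ[of w] by simp
        hence "Re (g w) \<le> ln (B * B)" using B w by (intro Re_g) auto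
        thus "Re (g w) < M0" by (simp add: M0_def)
      qed (use that M0 in \<open>auto simp: g_def\<close>)
      thus ?thesis using that by simp
    qed
    define M1 where "M1 = D + 3 * ln (7 + \<bar>t\<bar>)"
    have M1: "M1 > 0" unfolding M1_def using D by (intro add_pos_nonneg) auto
    have b3: "norm (g z) \<le> 2 * M1 * \<rho>3 / (5/2 - \<rho>3)" if "dist s0 z = \<rho>3" for z
    proof -
      have "norm (g z) \<le> 2 * M1 * dist s0 z / (5/2 - dist s0 z)"
      proof (rule Borel_Caratheodory(1)[OF holg])
        fix w assume w: "w \<in> ball s0 (5/2)"
        have "norm (w - 1) \<ge> 1/2" using inb(2)[OF w] abs_Im_le_cmod[of "w - 1"] by simp
        hence "norm (f w) \<le> norm (Zreg w) / (1/2)" unfolding f_def norm_divide by (intro divide_left_mono) auto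
        also have "\<dots> = 2 * norm (Zreg w)" by simp
        also have "\<dots> \<le> 2 * (A * (1 + norm w) ^ 3)" using A(2)[OF inb(1)[OF w]] by simp
        also have "\<dots> \<le> 2 * (A * (7 + \<bar>t\<bar>) ^ 3)" using A inb(3)[OF w] by (intro mult_left_mono power_mono) auto
        finally have "Re (g w) \<le> ln (2 * (A * (7 + \<bar>t\<bar>) ^ 3) * B)" using w A by (intro Re_g) auto
        also have "\<dots> = ln ((2 * A * B) * (7 + \<bar>t\<bar>) ^ 3)" by (simp add: mult_ac)
        also have "\<dots> = ln (2 * A * B) + 3 * ln (7 + \<bar>t\<bar>)" using A B
          by (subst ln_mult_pos) (auto simp: ln_realpow)
        also have "\<dots> < M1" by (simp add: M1_def D_def)
        finally show "Re (g w) < M1" .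
      qed (use that r M1 in \<open>auto simp: g_def\<close>)
      thus ?thesis using that by simp
    qed
    have ss: "dist s0 s \<le> r2"
    proof -
      have "s0 - s = of_real (3 - Re s)" by (simp add: s0_def t_def complex_eq_iff)
      hence "dist s0 s = \<bar>3 - Re s\<bar>" by (simp only: dist_norm norm_of_real)
      thus ?thesis using s by (simp add: r2_def)
    qed
    have sb: "s \<in> ball s0 (5/2)" using ss r by simp
    have "norm (g s) \<le> (\<Sum>k<K. 4 * M0 * (r2 / 1) ^ k) + 2 * M1 * \<rho>3 / (5/2 - \<rho>3) * ((r2 / \<rho>3) ^ K / (1 - r2 / \<rho>3))"
      using r M0 M1 by (intro norm_le_of_two_discs[OF holg _ _ _ _ _ b1 b3 _ _ ss]) auto
    also have "\<dots> = S + M1 * (c * \<theta> ^ K)" by (simp add: S_def c_def \<theta>_def)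
    also have "\<dots> \<le> S + M1 * (\<eta> / 9)" using K c M1 by (intro add_left_mono mult_left_mono) (auto simp: field_simps)
    also have "M1 * (\<eta> / 9) \<le> (D + 9 * ln \<bar>t\<bar>) * (\<eta> / 9)"
    proof (intro mult_right_mono)
      have "3 ^ 2 \<le> \<bar>t\<bar> ^ 2" using t by (intro power_mono) auto
      hence "9 * \<bar>t\<bar> \<le> \<bar>t\<bar> ^ 2 * \<bar>t\<bar>" by (intro mult_right_mono) auto
      hence "7 + \<bar>t\<bar> \<le> \<bar>t\<bar> ^ 3" using t by (simp add: eval_nat_numeral)
      hence "ln (7 + \<bar>t\<bar>) \<le> ln (\<bar>t\<bar> ^ 3)" using t by (intro ln_mono) auto
      also have "\<dots> = 3 * ln \<bar>t\<bar>" using t by (simp add: ln_realpow)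
      finally show "M1 \<le> D + 9 * ln \<bar>t\<bar>" by (simp add: M1_def)
    qed (use \<eta> in auto)
    also have "S + (D + 9 * ln \<bar>t\<bar>) * (\<eta> / 9) = S + D * \<eta> / 9 + \<eta> * ln \<bar>t\<bar>" by (simp add: algebra_simps)
    finally have "Re (g s) \<le> S + D * \<eta> / 9 + \<eta> * ln \<bar>t\<bar>" using complex_Re_le_cmod[of "g s"] by linarith
    hence "exp (Re (g s)) \<le> exp (S + D * \<eta> / 9) * \<bar>t\<bar> powr \<eta>" using t
      by (simp add: powr_def flip: exp_add)
    hence "norm (f s0) * exp (Re (g s)) \<le> B * (exp (S + D * \<eta> / 9) * \<bar>t\<bar> powr \<eta>)" using fs0 B(1) by (intro mult_mono) auto
    thus ?thesis using expg[OF sb] by (simp add: C_def t_def mult_ac)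
  qed
  moreover have "C > 0" using B by (simp add: C_def)
  ultimately show ?thesis unfolding f_def by blast
qed

section \<open>The holomorphic square root\<close>

text \<open>The majorant may depend on the closed half plane Re s \<ge> a and may blow up as a tends
  to a0, as happens for \<open>log_prod3\<close> at 1/2 and for \<open>E_sum\<close> at 1.\<close>

lemma holomorphic_on_suminf_halfplane:
  fixes f :: "nat \<Rightarrow> complex \<Rightarrow> complex"
  assumes hol: "\<And>n. f n holomorphic_on {s. Re s > a0}"
    and bound: "\<And>a. a > a0 \<Longrightarrow> \<exists>M. summable M \<and> (\<forall>n s. Re s \<ge> a \<longrightarrow> norm (f n s) \<le> M n)"
  shows "(\<lambda>s. \<Sum>n. f n s) holomorphic_on {s. Re s > a0}"
  unfolding holomorphic_on_open[OF open_halfspace_Re_gt]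
proof
  fix s assume s: "s \<in> {s. Re s > a0}"
  define a where "a = (a0 + Re s) / 2"
  have a: "a0 < a" "a < Re s" using s by (auto simp: a_def)
  obtain M where M: "summable M" "\<And>n s. Re s \<ge> a \<Longrightarrow> norm (f n s) \<le> M n" using bound[OF a(1)] by blast
  have "(\<lambda>s. \<Sum>n. f n s) holomorphic_on {s. Re s > a}"
  proof (rule holomorphic_on_suminf[where B = "\<lambda>_. 1", OF open_halfspace_Re_gt _ _ M(1)])
    show "f n holomorphic_on {s. Re s > a}" for n using a by (intro holomorphic_on_subset[OF hol]) auto
    show "M n \<ge> 0" for n using M(2)[of "of_real a" n] by (metis Re_complex_of_real norm_ge_zero order_refl order_trans)
  qed (use M in auto)
  thus "\<exists>f'. ((\<lambda>s. \<Sum>n. f n s) has_field_derivative f') (at s)"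
    unfolding holomorphic_on_open[OF open_halfspace_Re_gt] using a by blast
qed

text \<open>The logarithm of the product of (1 - p^(-2s))^(-1), without the square root; the
  exponent 1/2 of G comes from halving later. Since |p^(-2s)| < 1/2, the principal logarithm of each
  factor is holomorphic.\<close>

definition log_prod3 :: "complex \<Rightarrow> complex" where
  "log_prod3 s = (\<Sum>p. if prime p \<and> p mod 4 = 3 then - Ln (1 - of_nat p powr (-2 * s)) else 0)"

lemma norm_powr_prime3_less:
  assumes p: "p mod 4 = (3::nat)" and s: "Re s > 1/2"
  shows "norm (of_nat p powr (-2 * s) :: complex) < 1/2"
proof -
  have p3: "p \<ge> 3" using p by presburger
  have "norm (of_nat p powr (-2 * s) :: complex) = real p powr (-2 * Re s)" by (simp add: norm_powr_real_powr)
  also have "\<dots> \<le> real p powr (-1)" using p3 s by (intro powr_mono) auto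
  also have "\<dots> = 1 / real p" using p3 by (simp add: powr_minus_divide)
  also have "\<dots> < 1/2" using p3 by (simp add: field_simps)
  finally show ?thesis .
qed

lemma log_prod3_term_bound:
  assumes "a > 1/2" "Re s \<ge> a"
  shows "norm (if prime p \<and> p mod 4 = 3 then - Ln (1 - of_nat p powr (-2 * s)) else 0 :: complex) \<le> 2 * real p powr (-2 * a)"
proof (cases "prime p \<and> p mod 4 = 3")
  case True
  hence p3: "p \<ge> 1" using prime_ge_1_nat by blast
  have "norm (Ln (1 + - (of_nat p powr (-2 * s)))) \<le> 2 * norm (- (of_nat p powr (-2 * s)) :: complex)"
    using norm_powr_prime3_less[of p s] True assms by (intro norm_Ln_le) auto
  also have "\<dots> = 2 * real p powr (-2 * Re s)" by (simp add: norm_powr_real_powr)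
  also have "real p powr (-2 * Re s) \<le> real p powr (-2 * a)" using p3 assms by (intro powr_mono) auto
  finally show ?thesis using True by simp
qed auto

lemma summable_log_prod3_bound: "a > 1/2 \<Longrightarrow> summable (\<lambda>p. 2 * real p powr (-2 * a))"
  by (intro summable_mult) (simp add: summable_real_powr_iff)

lemma summable_log_prod3:
  assumes "Re s > 1/2"
  shows "summable (\<lambda>p. if prime p \<and> p mod 4 = 3 then - Ln (1 - of_nat p powr (-2 * s)) else 0)"
  by (rule summable_comparison_test'[OF summable_log_prod3_bound[OF assms], of 0])
     (use log_prod3_term_bound[OF assms order_refl] in auto)

lemma holomorphic_log_prod3: "log_prod3 holomorphic_on {s. Re s > 1/2}"
  unfolding log_prod3_def[abs_def]
proof (rule holomorphic_on_suminf_halfplane)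
  fix p :: nat
  show "(\<lambda>s. if prime p \<and> p mod 4 = 3 then - Ln (1 - of_nat p powr (-2 * s)) else 0) holomorphic_on {s. Re s > 1/2}"
  proof (cases "prime p \<and> p mod 4 = 3")
    case True
    have "1 - of_nat p powr (-2 * s) \<notin> \<real>\<^sub>\<le>\<^sub>0" if "Re s > 1/2" for s :: complex
      using norm_powr_prime3_less[of p s] that True complex_Re_le_cmod[of "of_nat p powr (-2 * s)"]
      by (auto simp: complex_nonpos_Reals_iff)
    moreover have "p \<noteq> 0" using True by auto
    ultimately show ?thesis using True by (auto intro!: holomorphic_intros)
  qed auto
next
  fix a :: real assume "a > 1/2"
  thus "\<exists>M. summable M \<and> (\<forall>n s. Re s \<ge> a \<longrightarrow> norm (if prime n \<and> n mod 4 = 3 then - Ln (1 - of_nat n powr (-2 * s)) else 0) \<le> M n)"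
    using summable_log_prod3_bound log_prod3_term_bound by (intro exI[of _ "\<lambda>p. 2 * real p powr (-2 * a)"]) auto
qed

lemma log_prod3_bound:
  assumes "a > 1/2"
  shows "\<exists>C. \<forall>s. Re s \<ge> a \<longrightarrow> norm (log_prod3 s) \<le> C"
proof (intro exI allI impI)
  fix s :: complex assume s: "Re s \<ge> a"
  note b = log_prod3_term_bound[OF assms s]
  have sn: "summable (\<lambda>p. norm (if prime p \<and> p mod 4 = 3 then - Ln (1 - of_nat p powr (-2 * s)) else 0))"
    by (rule summable_comparison_test'[OF summable_log_prod3_bound[OF assms], of 0]) (use b in auto)
  have "norm (log_prod3 s) \<le> (\<Sum>p. norm (if prime p \<and> p mod 4 = 3 then - Ln (1 - of_nat p powr (-2 * s)) else 0))"
    unfolding log_prod3_def by (rule summable_norm[OF sn])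
  also have "\<dots> \<le> (\<Sum>p. 2 * real p powr (-2 * a))"
    by (intro suminf_le b sn summable_log_prod3_bound assms)
  finally show "norm (log_prod3 s) \<le> (\<Sum>p. 2 * real p powr (-2 * a))" .
qed

lemma log_prod3_of_real:
  assumes \<sigma>: "\<sigma> > 1/2"
  defines "g \<equiv> \<lambda>p. if prime p \<and> p mod 4 = 3 then - ln (1 - real p powr (-2 * \<sigma>)) else 0"
  shows "log_prod3 (of_real \<sigma>) = of_real (suminf g)" "summable g"
    and "prodinf (\<lambda>p. if prime p \<and> p mod 4 = 3 then (1 - real p powr (-2 * \<sigma>)) powr (-1/2) else 1) = exp (suminf g / 2)"
proof -
  have less: "real p powr (-2 * \<sigma>) < 1/2" if "p mod 4 = 3" for p
    using norm_powr_prime3_less[of p "of_real \<sigma>"] that \<sigma> by (simp add: norm_powr_real_powr)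
  have eq: "(if prime p \<and> p mod 4 = 3 then - Ln (1 - of_nat p powr (-2 * of_real \<sigma>)) else 0) = complex_of_real (g p)" for p
  proof (cases "prime p \<and> p mod 4 = 3")
    case True
    have "of_nat p powr (-2 * complex_of_real \<sigma>) = of_real (real p powr (-2 * \<sigma>))"
      using powr_of_real[of "real p" "-2 * \<sigma>"] by simp
    hence "1 - of_nat p powr (-2 * complex_of_real \<sigma>) = of_real (1 - real p powr (-2 * \<sigma>))" by simp
    moreover have "1 - real p powr (-2 * \<sigma>) > 0" using less[of p] True by simp
    ultimately have "Ln (1 - of_nat p powr (-2 * complex_of_real \<sigma>)) = of_real (ln (1 - real p powr (-2 * \<sigma>)))"
      by (simp only: Ln_of_real)
    thus ?thesis using True by (simp add: g_def)
  qed (auto simp: g_def)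
  have "1/2 < Re (of_real \<sigma>)" using \<sigma> by simp
  from summable_log_prod3[OF this] show sg: "summable g" unfolding eq summable_of_real_iff .
  show "log_prod3 (of_real \<sigma>) = of_real (suminf g)" unfolding log_prod3_def eq by (rule suminf_of_real[OF sg, symmetric])
  have "(if prime p \<and> p mod 4 = 3 then (1 - real p powr (-2 * \<sigma>)) powr (-1/2) else 1) = exp (g p / 2)" for p
    using less[of p] by (auto simp: g_def powr_def)
  moreover have "prodinf (\<lambda>p. exp (g p / 2)) = exp (suminf (\<lambda>p. g p / 2))"
    by (rule prodinf_exp[OF summable_divide[OF sg]])
  ultimately show "prodinf (\<lambda>p. if prime p \<and> p mod 4 = 3 then (1 - real p powr (-2 * \<sigma>)) powr (-1/2) else 1) = exp (suminf g / 2)"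
    using suminf_divide[OF sg, of 2] by simp
qed

lemma two_powr_minus_norm: "norm (2 powr (-s) :: complex) = 2 powr (- Re s)"
  using norm_powr_real_powr[of 2 "-s"] by simp

lemma Re_one_minus_two_powr_pos:
  assumes "Re s > 0" shows "Re (1 - 2 powr (-s)) > 0"
  using complex_Re_le_cmod[of "2 powr (-s)"] assms powr_less_one[of 2 "- Re s"] by (simp add: two_powr_minus_norm)

text \<open>Squaring doubles every local factor. Compared with Z, the prime 2 lacks one factor 1/(1
  - 2^(-s)), primes 1 mod 4 lack nothing, and primes 3 mod 4 lack one factor 1/(1 -
  p^(-2s)).\<close>

lemma E_sum_squared:
  assumes s: "Re s > 1"
  shows "(E_sum s)^2 = Zfun s * exp (log_prod3 s) / (1 - 2 powr (-s))"
proof -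
  define x where "x = (\<lambda>p::nat. of_nat p powr (-s) :: complex)"
  define e where "e = (\<lambda>p. if p mod 4 = 3 then 1 / (1 - (x p)^2) else 1 / (1 - x p))"
  define t where "t = (\<lambda>p. if prime p \<and> p mod 4 = 3 then - Ln (1 - of_nat p powr (-2 * s)) else 0)"
  define b where "b = (\<lambda>p::nat. if p = 2 then 1 / (1 - 2 powr (-s)) else (1::complex))"
  have xp: "norm (x p) < 1" if "prime p" for p
    unfolding x_def using that s by (intro norm_nat_powr_less_1) (auto simp: prime_ge_2_nat)
  have loc: "(e p)^2 = Z_factor p s * (b p * exp (t p))" if p: "prime p" for p
    using p
  proof (cases rule: prime_mod_4_cases)
    case 1
    thus ?thesis by (simp add: e_def b_def t_def Z_factor_def Z_base_def Z_exponent_def x_def power2_eq_square)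
  next
    case 2
    hence "p \<noteq> 2" by auto
    thus ?thesis using 2 by (simp add: e_def b_def t_def Z_factor_def Z_base_def Z_exponent_def x_def power2_eq_square)
  next
    case 3
    hence p2: "p \<noteq> 2" by auto
    have "of_nat p powr (-2 * s) = x p * x p" unfolding x_def by (simp flip: powr_add)
    moreover have "1 - x p * x p \<noteq> 0"
    proof
      assume "1 - x p * x p = 0"
      hence "norm (x p * x p) = 1" by simp
      thus False using xp[OF p] mult_strict_mono'[of "norm (x p)" 1 "norm (x p)" 1] by (simp add: norm_mult)
    qed
    moreover have "of_nat (p^2) powr (-s) = (x p)^2"
      unfolding x_def using of_nat_powr_power prime_gt_0_nat[OF p] by blast
    ultimately show ?thesis using 3 p p2
      by (simp add: e_def b_def t_def Z_factor_def Z_base_def Z_exponent_def exp_minus power2_eq_square divide_inverse)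
  qed
  have lim1: "(\<lambda>N. (\<Prod>p | prime p \<and> p \<le> N. e p)^2) \<longlonglongrightarrow> (E_sum s)^2"
    using euler_product_E_sum[OF s] unfolding e_def x_def by (intro tendsto_intros)
  have eqN: "(\<Prod>p | prime p \<and> p \<le> N. e p)^2 = (\<Prod>p | prime p \<and> p \<le> N. Z_factor p s) * (1 / (1 - 2 powr (-s)) * exp (\<Sum>p\<le>N. t p))"
    if N: "N \<ge> 2" for N
  proof -
    have "(\<Prod>p | prime p \<and> p \<le> N. e p)^2 = (\<Prod>p | prime p \<and> p \<le> N. (e p)^2)" by (simp add: prod_power_distrib)
    also have "\<dots> = (\<Prod>p | prime p \<and> p \<le> N. Z_factor p s * (b p * exp (t p)))" using loc by (intro prod.cong) auto
    also have "\<dots> = (\<Prod>p | prime p \<and> p \<le> N. Z_factor p s) * ((\<Prod>p | prime p \<and> p \<le> N. b p) * (\<Prod>p | prime p \<and> p \<le> N. exp (t p)))"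
      by (simp add: prod.distrib)
    also have "(\<Prod>p | prime p \<and> p \<le> N. b p) = 1 / (1 - 2 powr (-s))"
      unfolding b_def using N by (subst prod.delta) (auto simp: two_is_prime_nat)
    also have "(\<Prod>p | prime p \<and> p \<le> N. exp (t p)) = (\<Prod>p\<le>N. exp (t p))"
      by (rule prod.mono_neutral_left) (auto simp: t_def)
    also have "\<dots> = exp (\<Sum>p\<le>N. t p)" by (simp add: exp_sum)
    finally show ?thesis .
  qed
  have "summable t" unfolding t_def using s by (intro summable_log_prod3) auto
  hence "(\<lambda>N. \<Sum>p\<le>N. t p) \<longlonglongrightarrow> log_prod3 s"
    unfolding log_prod3_def t_def[symmetric] by (rule summable_LIMSEQ')
  hence "(\<lambda>N. (\<Prod>p | prime p \<and> p \<le> N. Z_factor p s) * (1 / (1 - 2 powr (-s)) * exp (\<Sum>p\<le>N. t p)))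
      \<longlonglongrightarrow> Zfun s * (1 / (1 - 2 powr (-s)) * exp (log_prod3 s))"
    by (intro tendsto_intros euler_product_Zfun s)
  moreover have "\<forall>\<^sub>F N in sequentially. (\<Prod>p | prime p \<and> p \<le> N. Z_factor p s) * (1 / (1 - 2 powr (-s)) * exp (\<Sum>p\<le>N. t p)) = (\<Prod>p | prime p \<and> p \<le> N. e p)^2"
    using eventually_ge_at_top[of 2] by eventually_elim (use eqN in auto)
  ultimately have "(\<lambda>N. (\<Prod>p | prime p \<and> p \<le> N. e p)^2) \<longlonglongrightarrow> Zfun s * (1 / (1 - 2 powr (-s)) * exp (log_prod3 s))"
    by (rule Lim_transform_eventually)
  from LIMSEQ_unique[OF lim1 this] show ?thesis by simp
qed

lemma summable_E_sum:
  assumes "Re s > 1" shows "summable (\<lambda>n. norm (of_bool (n \<in> sum2sq) * of_nat n powr (-s) :: complex))"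
  by (rule summable_comparison_test'[OF summable_norm_nat_powr[OF assms], of 0]) (simp add: norm_mult)

lemma holomorphic_E_sum: "E_sum holomorphic_on {s. Re s > 1}"
  unfolding E_sum_def[abs_def]
proof (rule holomorphic_on_suminf_halfplane)
  fix n :: nat
  show "(\<lambda>s. of_bool (n \<in> sum2sq) * of_nat n powr (-s)) holomorphic_on {s. Re s > 1}"
    by (cases "n = 0") (auto intro!: holomorphic_intros)
next
  fix a :: real assume a: "a > 1"
  show "\<exists>M. summable M \<and> (\<forall>n s. Re s \<ge> a \<longrightarrow> norm (of_bool (n \<in> sum2sq) * of_nat n powr (-s) :: complex) \<le> M n)"
  proof (intro exI[of _ "\<lambda>n. real n powr (-a)"] conjI allI impI)
    show "summable (\<lambda>n. real n powr (-a))" using a by (simp add: summable_real_powr_iff)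
    fix n :: nat and s :: complex assume s: "Re s \<ge> a"
    show "norm (of_bool (n \<in> sum2sq) * of_nat n powr (-s) :: complex) \<le> real n powr (-a)"
    proof (cases "n = 0")
      case False
      have "norm (of_bool (n \<in> sum2sq) * of_nat n powr (-s) :: complex) \<le> real n powr (- Re s)"
        by (simp add: norm_mult norm_powr_real_powr)
      also have "\<dots> \<le> real n powr (-a)" using s False by (intro powr_mono) auto
      finally show ?thesis .
    qed auto
  qed
qed

lemma E_sum_2: "E_sum 2 \<in> \<real>" "Re (E_sum 2) > 0"
proof -
  let ?g = "\<lambda>n. of_bool (n \<in> sum2sq) * real n powr (-2)"
  let ?f = "\<lambda>n. of_bool (n \<in> sum2sq) * of_nat n powr (-2) :: complex"
  have eq: "?f n = complex_of_real (?g n)" for n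
    using powr_of_real[of "real n" "-2"] by simp
  have "1 < Re (2::complex)" by simp
  from summable_norm_cancel[OF summable_E_sum[OF this]] have sg: "summable ?g"
    unfolding eq summable_of_real_iff .
  hence E: "E_sum 2 = of_real (suminf ?g)" unfolding E_sum_def eq by (rule suminf_of_real[symmetric])
  thus "E_sum 2 \<in> \<real>" by simp
  have "1 \<in> sum2sq" using square_mem_sum2sq[of 1] by simp
  hence "0 < ?g 1" by simp
  hence "suminf ?g > 0" by (intro suminf_pos2[OF sg, of 1]) auto
  thus "Re (E_sum 2) > 0" unfolding E by simp
qed

text \<open>A continuous function with values in the multiples of \<pi> is constant. It will be the
  argument of a real function without zeros, followed along a real segment.\<close>

lemma continuous_sin_zero_imp_zero:
  fixes \<phi> :: "real \<Rightarrow> real"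
  assumes cont: "continuous_on {0..1} \<phi>" and 0: "\<phi> 0 = 0" and sin: "\<And>u. u \<in> {0..1} \<Longrightarrow> sin (\<phi> u) = 0"
  shows "\<phi> 1 = 0"
proof (rule ccontr)
  assume "\<phi> 1 \<noteq> 0"
  define \<psi> where "\<psi> = (\<lambda>u. sgn (\<phi> 1) * \<phi> u)"
  have \<psi>: "continuous_on {0..1} \<psi>" "\<psi> 0 = 0" "\<psi> 1 > 0" using cont 0 \<open>\<phi> 1 \<noteq> 0\<close>
    unfolding \<psi>_def by (auto intro!: continuous_intros simp: sgn_if)
  have sin\<psi>: "sin (\<psi> u) = 0" if "u \<in> {0..1}" for u using sin[OF that] by (simp add: \<psi>_def sgn_if)
  \<comment> \<open>An intermediate value in (0, \<pi>), where the sine is positive.\<close>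
  define y where "y = min (\<psi> 1) (pi / 2)"
  have "\<exists>u. 0 \<le> u \<and> u \<le> 1 \<and> \<psi> u = y"
    using \<psi> by (intro IVT') (auto simp: y_def)
  then obtain u where "u \<in> {0..1}" "\<psi> u = y" by auto
  moreover have "sin y > 0" using \<psi>(3) pi_gt_zero by (intro sin_gt_zero) (auto simp: y_def min_def)
  ultimately show False using sin\<psi>[of u] by simp
qed

lemma Zreg_of_real: "\<sigma> > 1/2 \<Longrightarrow> Zreg (of_real \<sigma>) \<in> \<real>"
  unfolding Zreg_def by (intro Reals_mult zeta_reg_of_real L_chi4_of_real)

lemma Re_Zreg_of_real:
  assumes "\<sigma> > 1/2"
  shows "Re (Zreg (of_real \<sigma>)) = Re (zeta_reg (of_real \<sigma>)) * Re (L_chi4 (of_real \<sigma>))"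
  using zeta_reg_of_real[OF assms] L_chi4_of_real[OF assms] by (auto simp: Zreg_def elim!: Reals_cases)

text \<open>The square root is taken through a holomorphic logarithm of \<open>Zreg\<close>,
  normalised to be real at 1. It then stays real along the real axis, which identifies the branch
  with the positive roots in \<open>G\<close>. The quotient of \<open>E_sum\<close> by Gh / csqrt (s
  - 1) squares to 1, so it is constant on the connected half plane Re s > 1, and positivity at s = 2
  fixes its sign.\<close>

theorem exists_holomorphic_G:
  assumes star: "\<And>s. s \<in> \<Omega> \<Longrightarrow> closed_segment 1 s \<subseteq> \<Omega>" and op: "open \<Omega>"
    and half: "{s. Re s > 1} \<subseteq> \<Omega>" "\<Omega> \<subseteq> {s. Re s > 1/2}" and nz: "\<And>s. s \<in> \<Omega> \<Longrightarrow> Zreg s \<noteq> 0"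
  shows "\<exists>Gh. Gh holomorphic_on \<Omega> \<and>
    (\<forall>s\<in>\<Omega>. Gh s ^ 2 = Zreg s * exp (log_prod3 s) / (1 - 2 powr (-s))) \<and>
    (\<forall>\<sigma>. of_real \<sigma> \<in> \<Omega> \<longrightarrow> \<sigma> \<le> 1 \<longrightarrow> Gh (of_real \<sigma>) = of_real (G \<sigma>) \<and> G \<sigma> > 0) \<and>
    (\<forall>s. Re s > 1 \<longrightarrow> E_sum s = Gh s / csqrt (s - 1))"
proof -
  have "2 \<in> \<Omega>" using half(1) by auto
  hence one: "1 \<in> \<Omega>" using star[of 2] ends_in_segment(1) by blast
  have "starlike \<Omega>" unfolding starlike_def using one star by blast
  then obtain l0 where l0: "l0 holomorphic_on \<Omega>" "\<And>s. s \<in> \<Omega> \<Longrightarrow> Zreg s = exp (l0 s)"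
    using starlike_holomorphic_log[OF _ op holomorphic_on_subset[OF holomorphic_Zreg half(2)] nz] by metis
  define l where "l = (\<lambda>s. l0 s - l0 1 + Ln (Zreg 1))"
  have holl: "l holomorphic_on \<Omega>" unfolding l_def by (intro holomorphic_intros l0)
  have lexp: "Zreg s = exp (l s)" if "s \<in> \<Omega>" for s
    using l0(2)[OF that] l0(2)[OF one] nz[OF one] by (simp add: l_def exp_add exp_diff)
  define Gh where "Gh = (\<lambda>s. exp ((l s + log_prod3 s - Ln (1 - 2 powr (-s))) / 2))"
  have pos2: "1 - 2 powr (-s) \<noteq> 0" "1 - 2 powr (-s) \<notin> \<real>\<^sub>\<le>\<^sub>0" if "s \<in> \<Omega>" for s
    using Re_one_minus_two_powr_pos[of s] that half(2) by (force simp: complex_nonpos_Reals_iff)+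
  have holG: "Gh holomorphic_on \<Omega>"
    unfolding Gh_def using pos2 half(2)
    by (intro holomorphic_intros holl holomorphic_on_subset[OF holomorphic_log_prod3]) auto
  have sq: "Gh s ^ 2 = Zreg s * exp (log_prod3 s) / (1 - 2 powr (-s))" if "s \<in> \<Omega>" for s
  proof -
    have "exp (X / 2) ^ 2 = exp X" for X :: complex by (simp flip: exp_double)
    hence "Gh s ^ 2 = exp (l s + log_prod3 s - Ln (1 - 2 powr (-s)))"
      unfolding Gh_def by blast
    also have "\<dots> = exp (l s) * exp (log_prod3 s) / (1 - 2 powr (-s))"
      using pos2[OF that] by (simp add: exp_add exp_diff)
    finally show ?thesis using lexp[OF that] by simp
  qed
  have l1: "Im (l 1) = 0"
  proof -
    have "Zreg 1 = of_real (Re (Zreg 1))" using Zreg_of_real[of 1] by (simp add: complex_is_Real_iff complex_eq_iff)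
    moreover have "Re (Zreg 1) > 0" using L_chi4_one_pos by (simp add: Zreg_def zeta_reg_1)
    ultimately have "Ln (Zreg 1) = of_real (ln (Re (Zreg 1)))" by (metis Ln_of_real)
    thus ?thesis by (simp add: l_def)
  qed
  have lreal: "Im (l (of_real \<sigma>)) = 0" if \<sigma>: "of_real \<sigma> \<in> \<Omega>" for \<sigma>
  proof -
    \<comment> \<open>The segment from 1 to \<sigma>, contained in \<Omega> by the star condition:
      along it the argument of \<open>Zreg\<close> cannot jump between multiples of \<pi>.\<close>
    define \<gamma> where "\<gamma> = (\<lambda>u. complex_of_real (1 + u * (\<sigma> - 1)))"
    have in\<Omega>: "\<gamma> u \<in> \<Omega>" if "u \<in> {0..1}" for u
    proof -
      have "\<gamma> u = (1 - u) *\<^sub>R 1 + u *\<^sub>R of_real \<sigma>" by (simp add: \<gamma>_def scaleR_conv_of_real algebra_simps)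
      hence "\<gamma> u \<in> closed_segment 1 (of_real \<sigma>)" using that by (auto simp: in_segment)
      thus ?thesis using star[OF \<sigma>] by blast
    qed
    have "Im (l (\<gamma> 1)) = 0"
    proof (rule continuous_sin_zero_imp_zero)
      show "continuous_on {0..1} (\<lambda>u. Im (l (\<gamma> u)))"
        by (intro continuous_on_Im continuous_on_compose2[OF holomorphic_on_imp_continuous_on[OF holl]])
           (use in\<Omega> in \<open>auto simp: \<gamma>_def intro!: continuous_intros\<close>)
      show "Im (l (\<gamma> 0)) = 0" using l1 by (simp add: \<gamma>_def)
      fix u :: real assume u: "u \<in> {0..1}"
      have "1 + u * (\<sigma> - 1) > 1/2" using in\<Omega>[OF u] half(2) by (auto simp: \<gamma>_def)
      from Zreg_of_real[OF this] have "Im (Zreg (\<gamma> u)) = 0" unfolding \<gamma>_def complex_is_Real_iff .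
      thus "sin (Im (l (\<gamma> u))) = 0" using lexp[OF in\<Omega>[OF u]] by (simp add: Im_exp)
    qed
    thus ?thesis by (simp add: \<gamma>_def)
  qed
  define q where "q = (\<lambda>\<sigma>. sqrt (Re (Zreg (of_real \<sigma>))) * (1 - 2 powr (-\<sigma>)) powr (-1/2) *
      prodinf (\<lambda>p. if prime p \<and> p mod 4 = 3 then (1 - real p powr (-2 * \<sigma>)) powr (-1/2) else 1))"
  have Gh_real: "Gh (of_real \<sigma>) = of_real (q \<sigma>)" and Gh_real_pos: "q \<sigma> > 0" if \<sigma>: "of_real \<sigma> \<in> \<Omega>" for \<sigma>
  proof -
    have \<sigma>2: "\<sigma> > 1/2" using \<sigma> half(2) by auto
    define a where "a = Re (l (of_real \<sigma>))"
    have la: "l (of_real \<sigma>) = of_real a" using lreal[OF \<sigma>] by (simp add: a_def complex_eq_iff)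
    have Za: "Re (Zreg (of_real \<sigma>)) = exp a" using lexp[OF \<sigma>] la by (simp add: Re_exp)
    define b where "b = suminf (\<lambda>p. if prime p \<and> p mod 4 = 3 then - ln (1 - real p powr (-2 * \<sigma>)) else 0)"
    note lb = log_prod3_of_real[OF \<sigma>2, folded b_def]
    have "2 powr (- complex_of_real \<sigma>) = of_real (2 powr (-\<sigma>))" using powr_of_real[of 2 "-\<sigma>"] by simp
    moreover have p: "1 - 2 powr (-\<sigma>) > 0" using \<sigma>2 powr_less_one[of 2 "-\<sigma>"] by simp
    ultimately have L: "Ln (1 - 2 powr (- complex_of_real \<sigma>)) = of_real (ln (1 - 2 powr (-\<sigma>)))"
      by (metis Ln_of_real of_real_1 of_real_diff)
    have "Gh (of_real \<sigma>) = exp (of_real ((a + b - ln (1 - 2 powr (-\<sigma>))) / 2))"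
      unfolding Gh_def la lb(1) L by simp
    also have "\<dots> = of_real (exp ((a + b - ln (1 - 2 powr (-\<sigma>))) / 2))" by (rule exp_of_real)
    also have "exp ((a + b - ln (1 - 2 powr (-\<sigma>))) / 2) = exp (a / 2) * exp (- ln (1 - 2 powr (-\<sigma>)) / 2) * exp (b / 2)"
      by (simp add: algebra_simps diff_divide_distrib add_divide_distrib flip: exp_add)
    also have "exp (- ln (1 - 2 powr (-\<sigma>)) / 2) = (1 - 2 powr (-\<sigma>)) powr (-1/2)"
    proof -
      have "exp (- ln x / 2) = x powr (-1/2)" if "x > 0" for x :: real using that by (simp add: powr_def)
      thus ?thesis using p by blast
    qed
    also have "exp (a / 2) = sqrt (exp a)"
      by (rule real_sqrt_unique[symmetric]) (auto simp flip: exp_double)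
    finally show "Gh (of_real \<sigma>) = of_real (q \<sigma>)" unfolding q_def lb(3) Za .
    show "q \<sigma> > 0" unfolding q_def lb(3) Za using p by (intro mult_pos_pos) auto
  qed
  have G_eq: "Gh (of_real \<sigma>) = of_real (G \<sigma>) \<and> G \<sigma> > 0" if \<sigma>: "of_real \<sigma> \<in> \<Omega>" "\<sigma> \<le> 1" for \<sigma>
  proof -
    have \<sigma>2: "\<sigma> > 1/2" using \<sigma> half(2) by auto
    have "sqrt (Re (Zreg (of_real \<sigma>))) = sqrt (zeta_sm1 \<sigma>) * sqrt (Re (L_chi4 (of_real \<sigma>)))"
      using zeta_sm1_eq[OF \<sigma>2 \<sigma>(2)] Re_Zreg_of_real[OF \<sigma>2] by (simp add: real_sqrt_mult)
    hence "G \<sigma> = q \<sigma>" unfolding G_def q_def by simp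
    thus ?thesis using Gh_real[OF \<sigma>(1)] Gh_real_pos[OF \<sigma>(1)] by simp
  qed
  have Gnz: "Gh s \<noteq> 0" for s unfolding Gh_def by simp
  define r where "r = (\<lambda>s. E_sum s * csqrt (s - 1) / Gh s)"
  have r2: "r s ^ 2 = 1" if "Re s > 1" for s
  proof -
    have s: "s \<in> \<Omega>" "s - 1 \<noteq> 0" using that half(1) by auto
    have "r s ^ 2 = (E_sum s)^2 * (s - 1) / (Gh s ^ 2)" by (simp add: r_def power_mult_distrib power_divide)
    also have "\<dots> = 1" unfolding sq[OF s(1)] E_sum_squared[OF that] Zreg_eq_Zfun[OF that]
      using s pos2[OF s(1)] Zfun_nonzero[OF that] by simp
    finally show ?thesis .
  qed
  have cs: "continuous_on {s. Re s > 1} (\<lambda>s. csqrt (s - 1))"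
    by (intro continuous_at_imp_continuous_on ballI isCont_csqrt')
       (auto intro!: continuous_intros simp: complex_nonpos_Reals_iff)
  have "continuous_on {s. Re s > 1} r" unfolding r_def
    using Gnz
    by (intro continuous_on_divide continuous_on_mult cs holomorphic_on_imp_continuous_on[OF holomorphic_E_sum]
        holomorphic_on_imp_continuous_on[OF holomorphic_on_subset[OF holG half(1)]]) auto
  moreover have "finite (r ` {s. Re s > 1})"
  proof (rule finite_subset)
    show "r ` {s. Re s > 1} \<subseteq> {1, -1}" using r2 by (auto simp: power2_eq_1_iff)
  qed simp
  ultimately have "r constant_on {s. Re s > 1}"
    by (intro continuous_finite_range_constant convex_connected convex_halfspace_Re_gt)
  then obtain y where y: "\<And>s. Re s > 1 \<Longrightarrow> r s = y" by (auto simp: constant_on_def)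
  have "y = 1"
  proof -
    have "of_real 2 \<in> \<Omega>" using half(1) by auto
    from Gh_real[OF this] Gh_real_pos[OF this] obtain g where g: "Gh 2 = of_real g" "g > 0" by auto
    obtain e where e: "E_sum 2 = of_real e" "e > 0" using E_sum_2 by (auto elim!: Reals_cases)
    have "y = of_real (e / g)" using y[of 2] by (simp add: r_def g e)
    moreover have "y ^ 2 = 1" using r2[of 2] y[of 2] by simp
    ultimately have "y = of_real (e / g)" "(e / g)^2 = 1"
      by (auto simp flip: of_real_power of_real_divide simp del: of_real_divide)
    moreover have "e / g > 0" using g e by simp
    moreover have "e / g = 1 \<or> e / g = -1" using \<open>(e / g)^2 = 1\<close> by (simp only: power2_eq_1_iff)
    ultimately have "e / g = 1" by linarith
    thus ?thesis using \<open>y = of_real (e / g)\<close> by (simp only: of_real_1)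
  qed
  have "E_sum s = Gh s / csqrt (s - 1)" if "Re s > 1" for s
  proof -
    have "csqrt (s - 1) \<noteq> 0" using that by auto
    thus ?thesis using y[OF that] \<open>y = 1\<close> Gnz[of s] by (simp add: r_def field_simps)
  qed
  thus ?thesis using holG sq G_eq by blast
qed

section \<open>Perron's formula for the smoothed counting function\<close>

lemma contour_integral_rectpath:
  assumes "continuous_on (path_image (rectpath a b)) f"
  shows "contour_integral (rectpath a b) f =
    contour_integral (linepath a (Complex (Re b) (Im a))) f
    + contour_integral (linepath (Complex (Re b) (Im a)) b) f
    + contour_integral (linepath b (Complex (Re a) (Im b))) f
    + contour_integral (linepath (Complex (Re a) (Im b)) a) f"
proof -
  let ?a2 = "Complex (Re b) (Im a)" and ?a4 = "Complex (Re a) (Im b)"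
  have img: "path_image (rectpath a b) =
      closed_segment a ?a2 \<union> closed_segment ?a2 b \<union> closed_segment b ?a4 \<union> closed_segment ?a4 a"
    by (simp add: rectpath_def Let_def path_image_join Un_assoc)
  have int: "f contour_integrable_on linepath a ?a2" "f contour_integrable_on linepath ?a2 b"
      "f contour_integrable_on linepath b ?a4" "f contour_integrable_on linepath ?a4 a"
    using assms unfolding img
    by (auto intro!: contour_integrable_continuous_linepath elim: continuous_on_subset)
  show ?thesis unfolding rectpath_def Let_def
    using int by simp
qed

lemma norm_perron_integrand_le:
  assumes "y > 0" "y powr Re s \<le> B" "norm s \<ge> T1" "norm (s + 1) \<ge> T2" "T1 > 0" "T2 > 0"
  shows "norm (of_real y powr s / (s * (s + 1))) \<le> B / (T1 * T2)"
proof -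
  have "norm (of_real y powr s / (s * (s + 1))) = y powr Re s / (norm s * norm (s + 1))"
    using assms(1) by (simp add: norm_divide norm_mult norm_powr_real_powr)
  also have "\<dots> \<le> B / (T1 * T2)" using assms
    by (intro frac_le mult_mono) (auto intro: order_trans[OF powr_ge_zero])
  finally show ?thesis .
qed

lemma perron_kernel_le_1:
  assumes y: "0 < y" "y \<le> 1" and T: "T \<ge> 2"
  shows "norm (contour_integral (linepath (Complex 2 (-T)) (Complex 2 T)) (\<lambda>s. of_real y powr s / (s * (s + 1))))
         \<le> 12 * y^2 / T"
proof -
  define f where "f = (\<lambda>s::complex. of_real y powr s / (s * (s + 1)))"
  define a b where "a = Complex 2 (-T)" and "b = Complex (2 + T) T"
  have holf: "f holomorphic_on {s. Re s > 0}"
  proof -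
    have "s * (s + 1) \<noteq> 0" if "Re s > 0" for s :: complex
    proof -
      have "s \<noteq> 0" "s + 1 \<noteq> 0" using that by (auto simp: complex_eq_iff)
      thus ?thesis by simp
    qed
    thus ?thesis unfolding f_def by (intro holomorphic_intros) (use y in auto)
  qed
  have img: "path_image (rectpath a b) \<subseteq> {s. Re s > 0}"
  proof -
    have "path_image (rectpath a b) \<subseteq> cbox a b"
      using T by (intro path_image_rectpath_subset_cbox) (auto simp: a_def b_def)
    also have "\<dots> \<subseteq> {s. Re s > 0}" by (auto simp: in_cbox_complex_iff a_def)
    finally show ?thesis .
  qed
  have int: "f contour_integrable_on linepath c d" if "Re c > 0" "Re d > 0" for c d
    using that by (intro contour_integrable_holomorphic_simple[OF holf])
      (auto simp: open_halfspace_Re_gt closed_segment_subset convex_halfspace_Re_gt)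
  have "contour_integral (rectpath a b) f = 0"
    by (intro contour_integral_unique Cauchy_theorem_convex_simple[OF holf])
      (use img in \<open>auto simp: convex_halfspace_Re_gt\<close>)
  moreover have "continuous_on (path_image (rectpath a b)) f"
    using img holf holomorphic_on_imp_continuous_on holomorphic_on_subset by blast
  ultimately have eq: "contour_integral (linepath a (Complex (2+T) (-T))) f
      + contour_integral (linepath (Complex (2+T) (-T)) b) f
      + contour_integral (linepath b (Complex 2 T)) f
      + contour_integral (linepath (Complex 2 T) a) f = 0"
    using contour_integral_rectpath[of a b f] by (simp add: a_def b_def)
  have pw: "y powr Re s \<le> y^2" if "Re s \<ge> 2" for s
    using powr_mono'[of 2 "Re s" y] that y by simp
  have bnd: "norm (f s) \<le> y^2 / (T * T)" if "Re s \<ge> 2" "\<bar>Im s\<bar> \<ge> T \<or> Re s \<ge> T" for s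
    unfolding f_def
  proof (rule norm_perron_integrand_le[OF y(1) pw[OF that(1)]])
    show "T \<le> norm s" using that abs_Im_le_cmod[of s] abs_Re_le_cmod[of s] by linarith
    show "T \<le> norm (s + 1)" using that abs_Im_le_cmod[of "s+1"] abs_Re_le_cmod[of "s+1"] by auto
  qed (use T in auto)
  have b1: "norm (contour_integral (linepath a (Complex (2+T) (-T))) f) \<le> y^2/(T*T) * norm (Complex (2+T) (-T) - a)"
    by (intro contour_integral_bound_linepath int bnd)
       (use T in \<open>auto simp: a_def closed_segment_same_Im closed_segment_eq_real_ivl\<close>)
  have b2: "norm (contour_integral (linepath (Complex (2+T) (-T)) b) f) \<le> y^2/(T*T) * norm (b - Complex (2+T) (-T))"
    by (intro contour_integral_bound_linepath int bnd)
       (use T in \<open>auto simp: b_def closed_segment_same_Re closed_segment_eq_real_ivl\<close>)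
  have b3: "norm (contour_integral (linepath b (Complex 2 T)) f) \<le> y^2/(T*T) * norm (Complex 2 T - b)"
    by (intro contour_integral_bound_linepath int bnd)
       (use T in \<open>auto simp: b_def closed_segment_same_Im closed_segment_eq_real_ivl\<close>)
  have n: "norm (Complex (2+T) (-T) - a) = T" "norm (b - Complex (2+T) (-T)) = 2*T" "norm (Complex 2 T - b) = T"
    using T by (auto simp: a_def b_def cmod_def real_sqrt_mult)
  have "contour_integral (linepath (Complex 2 T) a) f = - contour_integral (linepath a (Complex 2 T)) f"
    using contour_integral_reversepath[of "linepath a (Complex 2 T)" f] by simp
  hence "contour_integral (linepath a (Complex 2 T)) f = contour_integral (linepath a (Complex (2+T) (-T))) f
      + contour_integral (linepath (Complex (2+T) (-T)) b) f
      + contour_integral (linepath b (Complex 2 T)) f" using eq unfolding add_eq_0_iff2 by simp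
  also have "norm \<dots> \<le> y^2/(T*T) * T + y^2/(T*T) * (2*T) + y^2/(T*T) * T"
    using b1 b2 b3 unfolding n by (intro order_trans[OF norm_triangle_ineq] add_mono) auto
  also have "\<dots> = 4 * y^2 / T" using T by (simp add: field_simps)
  also have "\<dots> \<le> 12 * y^2 / T" using T by (intro divide_right_mono) auto
  finally show ?thesis by (simp add: f_def a_def)
qed

text \<open>For y \<ge> 1 the contour is pushed left to Re s = -T, enclosing 0 and -1. Splitting
  1/(s (s + 1)) into 1/s - 1/(s + 1) reduces both poles to Cauchy's integral formula, with values 1
  and 1/y. The condition T \<ge> 2 gives |s + 1| \<ge> T/2 on the left side.\<close>

lemma perron_kernel_ge_1:
  assumes y: "1 \<le> y" and T: "T \<ge> 2"
  shows "norm (contour_integral (linepath (Complex 2 (-T)) (Complex 2 T)) (\<lambda>s. of_real y powr s / (s * (s + 1)))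
           - 2 * pi * \<i> * of_real (1 - 1 / y)) \<le> 12 * y^2 / T"
proof -
  define f where "f = (\<lambda>s::complex. of_real y powr s / (s * (s + 1)))"
  define a b where "a = Complex (-T) (-T)" and "b = Complex 2 T"
  have y0: "y > 0" using y by simp
  have holp: "(\<lambda>s. of_real y powr s) holomorphic_on UNIV"
    using y by (auto intro!: holomorphic_intros)
  have img: "path_image (rectpath a b) \<subseteq> cbox a b - box a b"
    using T by (subst path_image_rectpath_cbox_minus_box) (auto simp: a_def b_def)
  have n0: "0 \<notin> path_image (rectpath a b)" "-1 \<notin> path_image (rectpath a b)"
    using img T by (auto simp: in_box_complex_iff a_def b_def)
  have contf: "continuous_on (path_image (rectpath a b)) f"
  proof -
    have "f holomorphic_on - {0, -1}" unfolding f_def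
      by (intro holomorphic_on_divide holomorphic_on_subset[OF holp] holomorphic_intros)
         (auto simp: add_eq_0_iff2)
    thus ?thesis using n0 by (auto intro: holomorphic_on_imp_continuous_on holomorphic_on_subset)
  qed
  have w: "winding_number (rectpath a b) 0 = 1" "winding_number (rectpath a b) (-1) = 1"
    by (intro winding_number_rectpath; use T in \<open>auto simp: in_box_complex_iff a_def b_def\<close>)+
  have "((\<lambda>s. of_real y powr s / (s - 0)) has_contour_integral 2*pi*\<i>* winding_number (rectpath a b) 0 * of_real y powr 0) (rectpath a b)"
    by (rule Cauchy_integral_formula_convex_simple[OF convex_UNIV holp]) (use n0 in auto)
  moreover have "((\<lambda>s. of_real y powr s / (s - (-1))) has_contour_integral 2*pi*\<i>* winding_number (rectpath a b) (-1) * of_real y powr (-1)) (rectpath a b)"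
    by (rule Cauchy_integral_formula_convex_simple[OF convex_UNIV holp]) (use n0 in auto)
  ultimately have "((\<lambda>s. of_real y powr s / (s - 0) - of_real y powr s / (s - (-1)))
      has_contour_integral 2*pi*\<i> * of_real y powr 0 - 2*pi*\<i> * of_real y powr (-1)) (rectpath a b)"
    using has_contour_integral_diff unfolding w by fastforce
  moreover have "2*pi*\<i> * of_real y powr 0 - 2*pi*\<i> * of_real y powr (-1) = 2 * pi * \<i> * of_real (1 - 1 / y)"
    using y by (simp add: powr_minus field_simps)
  ultimately have "((\<lambda>s. of_real y powr s / (s - 0) - of_real y powr s / (s - (-1)))
      has_contour_integral 2 * pi * \<i> * of_real (1 - 1 / y)) (rectpath a b)" by (simp only:)
  hence "(f has_contour_integral 2 * pi * \<i> * of_real (1 - 1 / y)) (rectpath a b)"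
  proof (rule has_contour_integral_eq)
    fix s assume "s \<in> path_image (rectpath a b)"
    hence "s \<noteq> 0" "s + 1 \<noteq> 0" using n0 by (auto simp: add_eq_0_iff2)
    thus "of_real y powr s / (s - 0) - of_real y powr s / (s - (-1)) = f s"
      unfolding f_def by (simp add: field_simps)
  qed
  hence eq: "2 * pi * \<i> * of_real (1 - 1 / y) = contour_integral (linepath a (Complex 2 (-T))) f
      + contour_integral (linepath (Complex 2 (-T)) b) f
      + contour_integral (linepath b (Complex (-T) T)) f
      + contour_integral (linepath (Complex (-T) T) a) f"
    using contour_integral_rectpath[OF contf] contour_integral_unique by (fastforce simp: a_def b_def)
  have pw: "y powr Re s \<le> y^2" if "Re s \<le> 2" for s
    using powr_mono[of "Re s" 2 y] that y by simp
  have bnd: "norm (f s) \<le> y^2 / (T * (T / 2))" if "Re s \<le> 2" "\<bar>Im s\<bar> \<ge> T \<or> Re s = - T" for s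
    unfolding f_def
  proof (rule norm_perron_integrand_le[OF y0 pw[OF that(1)]])
    show "T \<le> norm s" using that T abs_Im_le_cmod[of s] abs_Re_le_cmod[of s] by auto
    show "T / 2 \<le> norm (s + 1)" using that T abs_Im_le_cmod[of "s+1"] abs_Re_le_cmod[of "s+1"] by auto
  qed (use T in auto)
  have seg: "f contour_integrable_on linepath c d" if "closed_segment c d \<subseteq> path_image (rectpath a b)" for c d
    using that contf continuous_on_subset by (intro contour_integrable_continuous_linepath) blast
  have segs: "closed_segment a (Complex 2 (-T)) \<subseteq> path_image (rectpath a b)"
     "closed_segment b (Complex (-T) T) \<subseteq> path_image (rectpath a b)"
     "closed_segment (Complex (-T) T) a \<subseteq> path_image (rectpath a b)"
    by (auto simp: rectpath_def Let_def path_image_join a_def b_def)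
  have b1: "norm (contour_integral (linepath a (Complex 2 (-T))) f) \<le> y^2 / (T * (T / 2)) * norm (Complex 2 (-T) - a)"
    by (intro contour_integral_bound_linepath seg segs bnd)
       (use T in \<open>auto simp: a_def closed_segment_same_Im closed_segment_eq_real_ivl\<close>)
  have b2: "norm (contour_integral (linepath b (Complex (-T) T)) f) \<le> y^2 / (T * (T / 2)) * norm (Complex (-T) T - b)"
    by (intro contour_integral_bound_linepath seg segs bnd)
       (use T in \<open>auto simp: b_def closed_segment_same_Im closed_segment_eq_real_ivl\<close>)
  have b3: "norm (contour_integral (linepath (Complex (-T) T) a) f) \<le> y^2 / (T * (T / 2)) * norm (a - Complex (-T) T)"
    by (intro contour_integral_bound_linepath seg segs bnd)
       (use T in \<open>auto simp: a_def closed_segment_same_Re closed_segment_eq_real_ivl\<close>)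
  have n: "norm (Complex 2 (-T) - a) = T + 2" "norm (Complex (-T) T - b) = T + 2" "norm (a - Complex (-T) T) = 2 * T"
    using T by (auto simp: a_def b_def cmod_def real_sqrt_mult)
  have "contour_integral (linepath (Complex 2 (-T)) b) f - 2 * pi * \<i> * of_real (1 - 1 / y) =
     - (contour_integral (linepath a (Complex 2 (-T))) f
      + contour_integral (linepath b (Complex (-T) T)) f
      + contour_integral (linepath (Complex (-T) T) a) f)"
    unfolding eq by simp
  hence "norm (contour_integral (linepath (Complex 2 (-T)) b) f - 2 * pi * \<i> * of_real (1 - 1 / y))
     = norm (contour_integral (linepath a (Complex 2 (-T))) f
      + contour_integral (linepath b (Complex (-T) T)) f
      + contour_integral (linepath (Complex (-T) T) a) f)" by (simp only: norm_minus_cancel)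
  also have "\<dots> \<le> y^2/(T * (T / 2)) * (T + 2) + y^2/(T * (T / 2)) * (T + 2) + y^2/(T * (T / 2)) * (2 * T)"
    using b1 b2 b3 unfolding n by (intro order_trans[OF norm_triangle_ineq] add_mono) auto
  also have "\<dots> \<le> y^2/(T * (T / 2)) * (2 * T) + y^2/(T * (T / 2)) * (2 * T) + y^2/(T * (T / 2)) * (2 * T)"
    using T by (intro add_mono mult_left_mono) auto
  also have "\<dots> = 12 * y^2 / T" using T by (simp add: field_simps)
  finally show ?thesis by (simp add: f_def b_def)
qed

lemma perron_kernel:
  assumes "y > 0" "T \<ge> 2"
  shows "norm (contour_integral (linepath (Complex 2 (-T)) (Complex 2 T)) (\<lambda>s. of_real y powr s / (s * (s + 1)))
           - 2 * pi * \<i> * of_real (max 0 (1 - 1 / y))) \<le> 12 * y^2 / T"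
proof (cases "y \<le> 1")
  case True
  hence "max 0 (1 - 1 / y) = 0" using assms by (simp add: max_def field_simps)
  thus ?thesis using perron_kernel_le_1[OF assms(1) True assms(2)] by simp
next
  case False
  hence "max 0 (1 - 1 / y) = 1 - 1 / y" by (simp add: max_def field_simps)
  thus ?thesis using perron_kernel_ge_1[of y T] False assms by simp
qed

text \<open>The Mellin transform of the weight \<open>smooth_weight\<close>: the difference quotient
  in x of x^(s+1) / (s (s + 1)).\<close>

definition smooth_kernel :: "real \<Rightarrow> real \<Rightarrow> complex \<Rightarrow> complex" where
  "smooth_kernel x h s = (of_real (x + h) powr (s + 1) - of_real x powr (s + 1)) / (of_real h * s * (s + 1))"

text \<open>A trapezoid: 1 for n \<le> x, decreasing linearly to 0 at x + h, and 0 from there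
  on.\<close>

definition smooth_weight :: "real \<Rightarrow> real \<Rightarrow> nat \<Rightarrow> real" where
  "smooth_weight x h n = (max 0 (x + h - real n) - max 0 (x - real n)) / h"

definition smooth_count :: "real \<Rightarrow> real \<Rightarrow> real" where
  "smooth_count x h = (\<Sum>n\<in>{1..nat \<lfloor>x + h\<rfloor>}. of_bool (n \<in> sum2sq) * smooth_weight x h n)"

lemma Re_linepath_2: "s \<in> closed_segment (Complex 2 (-T)) (Complex 2 T) \<Longrightarrow> Re s = 2"
  by (simp add: closed_segment_same_Re)

lemma nat_powr_mult_smooth_kernel:
  assumes "n > 0" "x > 0" "h > 0"
  shows "of_nat n powr (-s) * smooth_kernel x h s =
    of_real ((x + h) / h) * (of_real ((x + h) / real n) powr s / (s * (s + 1)))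
    - of_real (x / h) * (of_real (x / real n) powr s / (s * (s + 1)))"
proof -
  have pw: "of_nat n powr (-s) * of_real y powr (s + 1) = of_real y * of_real (y / real n) powr s" if "y > 0" for y
  proof -
    have "of_real y powr s = (of_real (y / real n) powr s) * (of_real (real n) powr s)"
      using powr_times_real[of "of_real (y / real n)" "of_real (real n)" s] that assms by simp
    moreover have "of_real y powr (s + 1) = of_real y powr s * complex_of_real y" using that by (simp add: powr_add)
    moreover have "of_nat n powr (-s) * of_nat n powr s = (1::complex)" using assms by (simp flip: powr_add)
    ultimately show ?thesis by (simp add: mult_ac)
  qed
  have "of_nat n powr (-s) * smooth_kernel x h s =
      (of_nat n powr (-s) * of_real (x + h) powr (s + 1) - of_nat n powr (-s) * of_real x powr (s + 1)) / (of_real h * s * (s + 1))"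
    unfolding smooth_kernel_def by (simp add: right_diff_distrib)
  also have "\<dots> = (of_real (x + h) * of_real ((x + h) / real n) powr s - of_real x * of_real (x / real n) powr s) / (of_real h * s * (s + 1))"
    using pw[of "x + h"] pw[of x] assms by simp
  also have "\<dots> = of_real ((x + h) / h) * (of_real ((x + h) / real n) powr s / (s * (s + 1)))
    - of_real (x / h) * (of_real (x / real n) powr s / (s * (s + 1)))"
    by (simp add: diff_divide_distrib mult.assoc)
  finally show ?thesis .
qed

lemma continuous_on_perron_integrand:
  assumes "y > 0"
  shows "continuous_on {s. Re s > 0} (\<lambda>s. of_real y powr s / (s * (s + 1)))"
proof -
  have "s * (s + 1) \<noteq> 0" if "Re s > 0" for s :: complex
  proof -
    have "s \<noteq> 0" "s + 1 \<noteq> 0" using that by (auto simp: complex_eq_iff)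
    thus ?thesis by simp
  qed
  hence "(\<lambda>s. of_real y powr s / (s * (s + 1))) holomorphic_on {s. Re s > 0}"
    by (intro holomorphic_intros) (use assms in auto)
  thus ?thesis by (rule holomorphic_on_imp_continuous_on)
qed

text \<open>\<open>perron_kernel\<close> at (x + h)/n and at x/n. The square of y in its error
  becomes the factor 1/n^2, which makes the errors summable over n.\<close>

lemma perron_term:
  assumes n: "n > 0" and x: "x > 0" and h: "h > 0" and T: "T \<ge> 2"
  shows "(\<lambda>s. of_nat n powr (-s) * smooth_kernel x h s) contour_integrable_on linepath (Complex 2 (-T)) (Complex 2 T)"
    and "norm (contour_integral (linepath (Complex 2 (-T)) (Complex 2 T)) (\<lambda>s. of_nat n powr (-s) * smooth_kernel x h s)
       - 2 * pi * \<i> * of_real (smooth_weight x h n)) \<le> 24 * (x + h)^3 / h / T * (1 / real n ^ 2)"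
proof -
  let ?\<gamma> = "linepath (Complex 2 (-T)) (Complex 2 T)"
  define Y X where "Y = (x + h) / real n" and "X = x / real n"
  have YX: "Y > 0" "X > 0" "X \<le> Y" using n x h by (auto simp: Y_def X_def divide_right_mono)
  let ?f = "\<lambda>y s. complex_of_real y powr s / (s * (s + 1))"
  have int: "?f y contour_integrable_on ?\<gamma>" if "y > 0" for y
    by (intro contour_integrable_continuous_linepath continuous_on_subset[OF continuous_on_perron_integrand[OF that]])
       (auto dest: Re_linepath_2)
  have eq: "(\<lambda>s. of_nat n powr (-s) * smooth_kernel x h s) = (\<lambda>s. of_real ((x + h) / h) * ?f Y s - of_real (x / h) * ?f X s)"
    using nat_powr_mult_smooth_kernel[OF n x h] by (simp add: Y_def X_def)
  show "(\<lambda>s. of_nat n powr (-s) * smooth_kernel x h s) contour_integrable_on ?\<gamma>"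
    unfolding eq by (intro contour_integrable_diff contour_integrable_lmul int YX)
  define IY where "IY = contour_integral ?\<gamma> (?f Y) - 2 * pi * \<i> * of_real (max 0 (1 - 1 / Y))"
  define IX where "IX = contour_integral ?\<gamma> (?f X) - 2 * pi * \<i> * of_real (max 0 (1 - 1 / X))"
  have I: "contour_integral ?\<gamma> (\<lambda>s. of_nat n powr (-s) * smooth_kernel x h s) =
      of_real ((x + h) / h) * contour_integral ?\<gamma> (?f Y) - of_real (x / h) * contour_integral ?\<gamma> (?f X)"
    unfolding eq using int YX
    by (simp only: contour_integral_diff contour_integral_lmul contour_integrable_lmul)
  have m: "y / h * max 0 (1 - 1 / (y / real n)) = max 0 (y - real n) / h" if "y > 0" for y
  proof (cases "y \<ge> real n")
    case True
    hence "1 - 1 / (y / real n) \<ge> 0" using that by (simp add: field_simps)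
    hence "max 0 (1 - 1 / (y / real n)) = 1 - real n / y" by simp
    thus ?thesis using True that h by (simp add: field_simps)
  next
    case False
    hence "1 - 1 / (y / real n) \<le> 0" using that by (simp add: field_simps)
    thus ?thesis using False by simp
  qed
  have "smooth_weight x h n = (x + h) / h * max 0 (1 - 1 / Y) - x / h * max 0 (1 - 1 / X)"
    unfolding smooth_weight_def Y_def X_def using m[of "x + h"] m[of x] x h by (simp add: diff_divide_distrib)
  hence "contour_integral ?\<gamma> (\<lambda>s. of_nat n powr (-s) * smooth_kernel x h s) - 2 * pi * \<i> * of_real (smooth_weight x h n)
     = of_real ((x + h) / h) * IY - of_real (x / h) * IX"
    unfolding I IY_def IX_def by (simp only: of_real_diff of_real_mult right_diff_distrib) (simp add: mult_ac)
  also have "norm \<dots> \<le> (x + h) / h * norm IY + x / h * norm IX"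
  proof -
    have n: "norm (complex_of_real c * z) = c * norm z" if "c \<ge> 0" for c z using that by (simp add: norm_mult)
    have "(x + h) / h \<ge> 0" "x / h \<ge> 0" using x h by auto
    from norm_triangle_ineq4[of "of_real ((x + h) / h) * IY" "of_real (x / h) * IX"] this
    show ?thesis by (simp only: n)
  qed
  also have "\<dots> \<le> (x + h) / h * (12 * Y^2 / T) + (x + h) / h * (12 * Y^2 / T)"
  proof (intro add_mono mult_mono)
    show "norm IY \<le> 12 * Y^2 / T" unfolding IY_def by (rule perron_kernel[OF YX(1) T])
    have "norm IX \<le> 12 * X^2 / T" unfolding IX_def by (rule perron_kernel[OF YX(2) T])
    also have "\<dots> \<le> 12 * Y^2 / T" using YX T by (intro divide_right_mono mult_left_mono power_mono) auto
    finally show "norm IX \<le> 12 * Y^2 / T" .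
  qed (use x h T in \<open>auto simp: divide_right_mono\<close>)
  also have "\<dots> = 24 * (x + h)^3 / h / T * (1 / real n ^ 2)"
    by (simp add: Y_def power_divide power2_eq_square power3_eq_cube mult_ac)
  finally show "norm (contour_integral ?\<gamma> (\<lambda>s. of_nat n powr (-s) * smooth_kernel x h s)
       - 2 * pi * \<i> * of_real (smooth_weight x h n)) \<le> 24 * (x + h)^3 / h / T * (1 / real n ^ 2)" .
qed

lemma continuous_on_smooth_kernel:
  assumes "x > 0" "h > 0"
  shows "continuous_on {s. Re s > 0} (smooth_kernel x h)"
proof -
  have "smooth_kernel x h = (\<lambda>s. of_real ((x + h) / h) * (of_real ((x + h) / real 1) powr s / (s * (s + 1)))
    - of_real (x / h) * (of_real (x / real 1) powr s / (s * (s + 1))))"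
  proof (intro ext)
    fix s
    have "smooth_kernel x h s = of_nat 1 powr (-s) * smooth_kernel x h s" by simp
    also note nat_powr_mult_smooth_kernel[OF zero_less_one assms]
    finally show "smooth_kernel x h s = of_real ((x + h) / h) * (of_real ((x + h) / real 1) powr s / (s * (s + 1)))
      - of_real (x / h) * (of_real (x / real 1) powr s / (s * (s + 1)))" .
  qed
  moreover have "continuous_on {s. Re s > 0} \<dots>"
    by (intro continuous_on_diff continuous_on_mult continuous_on_const continuous_on_perron_integrand)
       (use assms in auto)
  ultimately show ?thesis by (simp only:)
qed

text \<open>Summation and integration are exchanged on the segment Re s = 2, where the series
  converges uniformly. C may depend on x and h in any way, since T tends to infinity with both
  fixed.\<close>

lemma perron_smooth_count:
  assumes x: "x > 0" and h: "h > 0"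
  shows "\<exists>C. \<forall>T\<ge>2. norm (contour_integral (linepath (Complex 2 (-T)) (Complex 2 T)) (\<lambda>s. E_sum s * smooth_kernel x h s)
     - 2 * pi * \<i> * of_real (smooth_count x h)) \<le> C / T"
proof (intro exI allI impI)
  fix T :: real assume T: "T \<ge> 2"
  let ?\<gamma> = "linepath (Complex 2 (-T)) (Complex 2 T)"
  let ?e = "\<lambda>n. of_bool (n \<in> sum2sq) :: complex"
  let ?f = "\<lambda>n s. ?e n * (of_nat n powr (-s) * smooth_kernel x h s)"
  have int: "?f n contour_integrable_on ?\<gamma>" for n
    using perron_term(1)[OF _ x h T, of n] by (cases "n = 0") (auto intro: contour_integrable_lmul)
  have "compact (smooth_kernel x h ` closed_segment (Complex 2 (-T)) (Complex 2 T))"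
    by (intro compact_continuous_image continuous_on_subset[OF continuous_on_smooth_kernel[OF x h]])
       (auto dest: Re_linepath_2)
  from compact_imp_bounded[OF this] obtain B where B: "\<And>s. s \<in> closed_segment (Complex 2 (-T)) (Complex 2 T) \<Longrightarrow> norm (smooth_kernel x h s) \<le> B"
    unfolding bounded_iff by blast
  have s2: "summable (\<lambda>n. real n powr (-2))" by (simp add: summable_real_powr_iff)
  have "uniform_limit (closed_segment (Complex 2 (-T)) (Complex 2 T)) (\<lambda>N s. \<Sum>n<N. ?f n s) (\<lambda>s. \<Sum>n. ?f n s) sequentially"
  proof (rule Weierstrass_m_test)
    show "summable (\<lambda>n. real n powr (-2) * B)" by (rule summable_mult2[OF s2])
    fix n s assume s: "s \<in> closed_segment (Complex 2 (-T)) (Complex 2 T)"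
    have "norm (?f n s) \<le> norm (of_nat n powr (-s) :: complex) * norm (smooth_kernel x h s)" by (simp add: norm_mult)
    also have "norm (of_nat n powr (-s) :: complex) = real n powr (-2)" using Re_linepath_2[OF s] by (simp add: norm_powr_real_powr)
    finally show "norm (?f n s) \<le> real n powr (-2) * B" using B[OF s] by (meson mult_left_mono order_trans powr_ge_zero)
  qed
  moreover have "(\<Sum>n. ?f n s) = E_sum s * smooth_kernel x h s" if "s \<in> closed_segment (Complex 2 (-T)) (Complex 2 T)" for s
  proof -
    have "1 < Re s" using Re_linepath_2[OF that] by simp
    from suminf_mult2[OF summable_norm_cancel[OF summable_E_sum[OF this]], of "smooth_kernel x h s"]
    show ?thesis unfolding E_sum_def by (simp add: mult.assoc)
  qed
  ultimately have ul: "uniform_limit (path_image ?\<gamma>) (\<lambda>N s. \<Sum>n<N. ?f n s) (\<lambda>s. E_sum s * smooth_kernel x h s) sequentially"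
    using uniform_limit_cong'[of "closed_segment (Complex 2 (-T)) (Complex 2 T)" "\<lambda>N s. \<Sum>n<N. ?f n s" "\<lambda>N s. \<Sum>n<N. ?f n s" "\<lambda>s. \<Sum>n. ?f n s" "\<lambda>s. E_sum s * smooth_kernel x h s"]
    by simp
  have "(\<lambda>N. contour_integral ?\<gamma> (\<lambda>s. \<Sum>n<N. ?f n s)) \<longlonglongrightarrow> contour_integral ?\<gamma> (\<lambda>s. E_sum s * smooth_kernel x h s)"
  proof (rule contour_integral_uniform_limit(2)[OF _ ul])
    show "\<forall>\<^sub>F N in sequentially. (\<lambda>s. \<Sum>n<N. ?f n s) contour_integrable_on ?\<gamma>"
      by (intro always_eventually allI contour_integrable_sum int) auto
    show "norm (vector_derivative ?\<gamma> (at t)) \<le> norm (Complex 2 T - Complex 2 (-T))" for t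
      by (simp add: vector_derivative_linepath_at)
  qed auto
  moreover have "contour_integral ?\<gamma> (\<lambda>s. \<Sum>n<N. ?f n s) = (\<Sum>n<N. contour_integral ?\<gamma> (?f n))" for N
    using int by (intro contour_integral_sum) auto
  ultimately have sums1: "(\<lambda>n. contour_integral ?\<gamma> (?f n)) sums contour_integral ?\<gamma> (\<lambda>s. E_sum s * smooth_kernel x h s)"
    by (simp add: sums_def)
  let ?w = "\<lambda>n. 2 * pi * \<i> * of_real (of_bool (n \<in> sum2sq \<and> n > 0) * smooth_weight x h n)"
  have "?w sums (\<Sum>n\<in>{1..nat \<lfloor>x + h\<rfloor>}. ?w n)"
  proof (rule sums_finite)
    fix n assume n: "n \<notin> {1..nat \<lfloor>x + h\<rfloor>}"
    show "?w n = 0"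
    proof (cases "n = 0")
      case False
      hence "nat \<lfloor>x + h\<rfloor> < n" using n by simp
      hence "real n > x + h" by linarith
      thus ?thesis using h by (simp add: smooth_weight_def)
    qed auto
  qed simp
  also have "(\<Sum>n\<in>{1..nat \<lfloor>x + h\<rfloor>}. ?w n) = 2 * pi * \<i> * of_real (smooth_count x h)"
    unfolding smooth_count_def of_real_sum sum_distrib_left by (intro sum.cong) auto
  finally have sums2: "?w sums (2 * pi * \<i> * of_real (smooth_count x h))" .
  define D where "D = 24 * (x + h)^3 / h / T"
  have D: "D \<ge> 0" unfolding D_def using x h T by simp
  have le: "norm (contour_integral ?\<gamma> (?f n) - ?w n) \<le> D * real n powr (-2)" for n
  proof (cases "n = 0 \<or> n \<notin> sum2sq")
    case True
    hence "?f n = (\<lambda>_. 0)" by auto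
    thus ?thesis using True D by (auto simp: contour_integral_0)
  next
    case False
    have "real n powr (-2) = 1 / real n ^ 2" using False by (simp add: powr_minus_divide)
    thus ?thesis using perron_term(2)[OF _ x h T, of n] False by (simp add: D_def)
  qed
  have "contour_integral ?\<gamma> (\<lambda>s. E_sum s * smooth_kernel x h s) - 2 * pi * \<i> * of_real (smooth_count x h)
     = (\<Sum>n. contour_integral ?\<gamma> (?f n) - ?w n)"
    using sums_diff[OF sums1 sums2] by (rule sums_unique)
  also have "norm \<dots> \<le> (\<Sum>n. D * real n powr (-2))"
    by (rule norm_suminf_le[OF le summable_mult[OF s2]])
  also have "\<dots> = D * (\<Sum>n. real n powr (-2))" by (rule suminf_mult[OF s2])
  also have "\<dots> = 24 * (x + h)^3 / h * (\<Sum>n. real n powr (-2)) / T" by (simp add: D_def)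
  finally show "norm (contour_integral ?\<gamma> (\<lambda>s. E_sum s * smooth_kernel x h s) - 2 * pi * \<i> * of_real (smooth_count x h))
      \<le> 24 * (x + h)^3 / h * (\<Sum>n. real n powr (-2)) / T" .
qed

text \<open>The weights are 1 up to x and lie in [0, 1] beyond, and (x, x + h] contains at most h +
  1 integers.\<close>

lemma smooth_count_near_countE:
  assumes x: "x \<ge> 1" and h: "h > 0"
  shows "\<bar>smooth_count x h - countE x\<bar> \<le> h + 1"
proof -
  define m M where "m = nat \<lfloor>x\<rfloor>" and "M = nat \<lfloor>x + h\<rfloor>"
  let ?e = "\<lambda>n. of_bool (n \<in> sum2sq) :: real"
  have mM: "m \<le> M" unfolding m_def M_def using h by (intro nat_mono floor_mono) auto
  have rm: "real m > x - 1" "real m \<le> x" unfolding m_def using x by linarith+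
  have rM: "real M \<le> x + h" unfolding M_def using x h by linarith
  have w1: "smooth_weight x h n = 1" if "n \<le> m" for n
  proof -
    have "real n \<le> x" using that rm by linarith
    thus ?thesis using h by (simp add: smooth_weight_def)
  qed
  have w01: "0 \<le> smooth_weight x h n" "smooth_weight x h n \<le> 1" for n
    using h by (auto simp: smooth_weight_def max_def field_simps)
  have "{1..M} = {1..m} \<union> {m+1..M}" using mM by auto
  hence "smooth_count x h = (\<Sum>n\<in>{1..m} \<union> {m+1..M}. ?e n * smooth_weight x h n)"
    unfolding smooth_count_def M_def[symmetric] by simp
  also have "\<dots> = (\<Sum>n\<in>{1..m}. ?e n * smooth_weight x h n) + (\<Sum>n\<in>{m+1..M}. ?e n * smooth_weight x h n)"
    by (rule sum.union_disjoint) auto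
  also have "(\<Sum>n\<in>{1..m}. ?e n * smooth_weight x h n) = (\<Sum>n\<in>{1..m}. ?e n)"
    using w1 by (intro sum.cong) auto
  also have "\<dots> = countE x" unfolding countE_def m_def
    by (simp add: sum_of_bool_eq Int_def)
  finally have eq: "smooth_count x h - countE x = (\<Sum>n\<in>{m+1..M}. ?e n * smooth_weight x h n)" by simp
  have "(\<Sum>n\<in>{m+1..M}. ?e n * smooth_weight x h n) \<ge> 0" using w01 by (intro sum_nonneg) auto
  moreover have "(\<Sum>n\<in>{m+1..M}. ?e n * smooth_weight x h n) \<le> (\<Sum>n\<in>{m+1..M}. 1)"
    using w01 by (intro sum_mono) auto
  moreover have "(\<Sum>n\<in>{m+1..M}. 1::real) = real M - real m" using mM by simp
  ultimately show ?thesis unfolding eq using rm rM by linarith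
qed

section \<open>Moving the contour\<close>

lemma holomorphic_smooth_kernel:
  assumes "x > 0" "h > 0"
  shows "smooth_kernel x h holomorphic_on {s. Re s > 0}"
proof -
  have "of_real h * s * (s + 1) \<noteq> 0" if "Re s > 0" for s :: complex
  proof -
    have "s \<noteq> 0" "s + 1 \<noteq> 0" using that by (auto simp: complex_eq_iff)
    thus ?thesis using assms by simp
  qed
  thus ?thesis unfolding smooth_kernel_def[abs_def]
    by (intro holomorphic_intros) (use assms in auto)
qed

text \<open>Off the real axis this rewrites the root of s - 1 through the root of 1 - s. The latter
  is continuous across the cut, so the right-hand side extends to t = 0 from either side.\<close>

lemma csqrt_minus_one_eq:
  assumes "e = 1 \<or> e = (-1::real)" "t > 0" "b < 1"
  shows "csqrt (Complex b (e * t) - 1) = of_real e * \<i> * csqrt (1 - Complex b (e * t))"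
proof -
  let ?z = "1 - Complex b (e * t)"
  have z: "Complex b (e * t) - 1 = - ?z" by simp
  from assms(1) show ?thesis
  proof
    assume e: "e = 1"
    hence "Im ?z < 0" using assms by simp
    hence "csqrt (- ?z) = \<i> * csqrt ?z" by (intro csqrt_minus) auto
    thus ?thesis unfolding z using e by simp
  next
    assume e: "e = -1"
    hence "Im (- ?z) < 0" using assms by simp
    hence "csqrt (- (- ?z)) = \<i> * csqrt (- ?z)" by (intro csqrt_minus) auto
    hence "\<i> * csqrt ?z = - csqrt (- ?z)" by simp
    thus ?thesis unfolding z using e by simp
  qed
qed

definition smooth_kernel_real :: "real \<Rightarrow> real \<Rightarrow> real \<Rightarrow> real" where
  "smooth_kernel_real x h \<sigma> = ((x + h) powr (\<sigma> + 1) - x powr (\<sigma> + 1)) / (h * \<sigma> * (\<sigma> + 1))"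

lemma smooth_kernel_of_real:
  assumes "x > 0" "h > 0"
  shows "smooth_kernel x h (of_real \<sigma>) = of_real (smooth_kernel_real x h \<sigma>)"
proof -
  have "complex_of_real y powr (of_real \<sigma> + 1) = of_real (y powr (\<sigma> + 1))" if "y > 0" for y
    using powr_of_real[of y "\<sigma> + 1"] that by simp
  from this[of "x + h"] this[of x] assms show ?thesis
    by (simp add: smooth_kernel_def smooth_kernel_real_def)
qed

text \<open>The curves \<open>b(t) \<plusminus> it\<close> start on the two sides of the cut at \<open>b(0)\<close>. The function \<open>\<psi>\<close> majorises
  the integral along them and \<open>H\<close> the integrand on the horizontal segments.\<close>

theorem smooth_count_contour:
  fixes Gh :: "complex \<Rightarrow> complex" and b b' \<psi> \<psi>' H :: "real \<Rightarrow> real"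
  assumes star: "\<And>s. s \<in> \<Omega> \<Longrightarrow> closed_segment 1 s \<subseteq> \<Omega>" and op: "open \<Omega>"
    and half: "{s. Re s > 1} \<subseteq> \<Omega>" "\<Omega> \<subseteq> {s. Re s > 1/2}"
    and holG: "Gh holomorphic_on \<Omega>"
    and Gh_real: "\<And>\<sigma>. of_real \<sigma> \<in> \<Omega> \<Longrightarrow> \<sigma> \<le> 1 \<Longrightarrow> Gh (of_real \<sigma>) = of_real (G \<sigma>)"
    and E: "\<And>s. Re s > 1 \<Longrightarrow> E_sum s = Gh s / csqrt (s - 1)"
    and x: "x > 0" and h: "h > 0"
    and b_cont: "continuous_on {0..} b" and b_deriv: "\<And>t. t > 0 \<Longrightarrow> (b has_real_derivative b' t) (at t)"
    and b_less: "\<And>t. t \<ge> 0 \<Longrightarrow> b t < 1"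
    and b_mem: "\<And>t \<sigma>. b \<bar>t\<bar> \<le> \<sigma> \<Longrightarrow> Complex \<sigma> t \<in> \<Omega>"
    and \<psi>_cont: "continuous_on {0..} \<psi>" and \<psi>_deriv: "\<And>t. t > 0 \<Longrightarrow> (\<psi> has_real_derivative \<psi>' t) (at t)"
    and \<psi>_bound: "\<And>t. norm (Gh (Complex (b \<bar>t\<bar>) t) * smooth_kernel x h (Complex (b \<bar>t\<bar>) t) / csqrt (Complex (b \<bar>t\<bar>) t - 1)) * (\<bar>b' \<bar>t\<bar>\<bar> + 1) \<le> \<psi>' \<bar>t\<bar>" 
    and B: "\<And>t. t \<ge> 0 \<Longrightarrow> \<psi> t - \<psi> 0 \<le> B"
    and H_bound: "\<And>\<sigma> t. \<bar>t\<bar> \<ge> 1 \<Longrightarrow> b \<bar>t\<bar> \<le> \<sigma> \<Longrightarrow> \<sigma> \<le> 2 \<Longrightarrow>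
        norm (Gh (Complex \<sigma> t) * smooth_kernel x h (Complex \<sigma> t) / csqrt (Complex \<sigma> t - 1)) \<le> H \<bar>t\<bar>"
    and H_lim: "(H \<longlongrightarrow> 0) at_top"
  shows "\<exists>I. ((\<lambda>\<sigma>. G \<sigma> * smooth_kernel_real x h \<sigma> / sqrt (1 - \<sigma>)) has_integral I) {b 0..1}
           \<and> \<bar>smooth_count x h - I / pi\<bar> \<le> B"
proof -
  \<comment> \<open>The w-plane is again starlike, now about 0, because 1 + (u w)^2 is the point
    with parameter u^2 on the segment from 1 to 1 + w^2.\<close>
  define \<Omega>w where "\<Omega>w = {w::complex. 1 + w^2 \<in> \<Omega>}"
  \<comment> \<open>Under s = 1 + w^2 the factor 2w of ds cancels the denominator w = csqrt (s - 1),
    and what remains is holomorphic at w = 0.\<close>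
  define Hw where "Hw = (\<lambda>w. 2 * Gh (1 + w^2) * smooth_kernel x h (1 + w^2))"
  have Re_pos: "Re s > 0" "Re s > 1/2" if "s \<in> \<Omega>" for s using half(2) that by auto
  have opw: "open \<Omega>w"
  proof -
    have "\<Omega>w = (\<lambda>w. 1 + w^2) -` \<Omega>" by (auto simp: \<Omega>w_def)
    thus ?thesis using continuous_open_vimage[OF op, of "\<lambda>w. 1 + w^2"] by (auto intro!: continuous_intros)
  qed
  have "closed_segment 0 w \<subseteq> \<Omega>w" if w: "w \<in> \<Omega>w" for w
  proof
    fix v assume "v \<in> closed_segment 0 w"
    then obtain u where u: "0 \<le> u" "u \<le> 1" "v = u *\<^sub>R w" by (auto simp: in_segment)
    have "1 + v^2 = (1 - u^2) *\<^sub>R 1 + u^2 *\<^sub>R (1 + w^2)"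
      using u(3) by (simp add: scaleR_conv_of_real algebra_simps power_mult_distrib)
    moreover have "0 \<le> u^2" "u^2 \<le> 1" using u by (auto simp: power_le_one)
    ultimately have "1 + v^2 \<in> closed_segment 1 (1 + w^2)" unfolding in_segment by blast
    thus "v \<in> \<Omega>w" using star[of "1 + w^2"] w by (auto simp: \<Omega>w_def)
  qed
  moreover have "0 \<in> \<Omega>w"
  proof -
    have "2 \<in> \<Omega>" using half(1) by auto
    from star[OF this] show ?thesis by (auto simp: \<Omega>w_def)
  qed
  ultimately have starw: "starlike \<Omega>w" unfolding starlike_def by blast
  have holK: "smooth_kernel x h holomorphic_on \<Omega>"
    by (rule holomorphic_on_subset[OF holomorphic_smooth_kernel[OF x h]]) (use Re_pos in auto)
  have sqh: "(\<lambda>w. 1 + w^2) holomorphic_on \<Omega>w" by (intro holomorphic_intros)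
  have holH: "Hw holomorphic_on \<Omega>w"
    unfolding Hw_def
    by (intro holomorphic_intros holomorphic_on_compose_gen[OF sqh holG, unfolded o_def]
         holomorphic_on_compose_gen[OF sqh holK, unfolded o_def]) (auto simp: \<Omega>w_def)
  obtain P where P: "\<And>w. w \<in> \<Omega>w \<Longrightarrow> (P has_field_derivative Hw w) (at w)"
    using holomorphic_starlike_primitive[OF holomorphic_on_imp_continuous_on[OF holH] starw opw, of "{}"]
      holH opw holomorphic_on_imp_differentiable_at by fastforce
  define F where "F = (\<lambda>s. Gh s * smooth_kernel x h s / csqrt (s - 1))"
  define Q where "Q = (\<lambda>s. P (csqrt (s - 1)))"
  have Q: "(Q has_field_derivative F s) (at s)" if s: "s \<in> \<Omega>" "s - 1 \<notin> \<real>\<^sub>\<le>\<^sub>0" for s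
  proof -
    have w: "1 + (csqrt (s - 1))^2 = s" by simp
    have "csqrt (s - 1) \<noteq> 0" using s by auto
    have "((\<lambda>s. csqrt (s - 1)) has_field_derivative 1 / (2 * csqrt (s - 1))) (at s)"
      using s by (auto intro!: derivative_eq_intros)
    moreover have "csqrt (s - 1) \<in> \<Omega>w" using s w by (simp add: \<Omega>w_def)
    ultimately have "((\<lambda>s. P (csqrt (s - 1))) has_field_derivative Hw (csqrt (s - 1)) * (1 / (2 * csqrt (s - 1)))) (at s)"
      by (intro DERIV_chain2[OF P])
    moreover have "Hw (csqrt (s - 1)) * (1 / (2 * csqrt (s - 1))) = F s"
      unfolding Hw_def w F_def by simp
    ultimately show ?thesis by (simp add: Q_def)
  qed
  have nonreal: "Complex \<sigma> t - 1 \<notin> \<real>\<^sub>\<le>\<^sub>0" if "t \<noteq> 0" for \<sigma> t using that by (simp add: complex_nonpos_Reals_iff)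
  have line: "contour_integral (linepath (Complex 2 (-T)) (Complex 2 T)) (\<lambda>s. E_sum s * smooth_kernel x h s)
      = Q (Complex 2 T) - Q (Complex 2 (-T))" for T
  proof -
    have "((\<lambda>s. E_sum s * smooth_kernel x h s) has_contour_integral
        Q (pathfinish (linepath (Complex 2 (-T)) (Complex 2 T))) - Q (pathstart (linepath (Complex 2 (-T)) (Complex 2 T))))
        (linepath (Complex 2 (-T)) (Complex 2 T))"
    proof (rule contour_integral_primitive[of "{s. Re s > 1}"])
      fix s assume s: "s \<in> {s. Re s > 1}"
      have "(Q has_field_derivative F s) (at s)" using s half(1) by (intro Q) (auto simp: complex_nonpos_Reals_iff)
      moreover have "F s = E_sum s * smooth_kernel x h s" using E[of s] s by (simp add: F_def)
      ultimately show "(Q has_field_derivative E_sum s * smooth_kernel x h s) (at s within {s. Re s > 1})"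
        by (simp add: has_field_derivative_at_within)
    qed (auto dest: Re_linepath_2)
    thus ?thesis by (simp add: contour_integral_unique)
  qed
  \<comment> \<open>The lifts of the two curves to the w-plane. They are written with the root of 1
    - s so that t = 0 is included, where they start at the two distinct points \<plusminus> i sqrt
    (1 - b 0).\<close>
  define w where "w = (\<lambda>e t. of_real e * \<i> * csqrt (1 - Complex (b t) (e * t)))"
  have e_abs: "\<bar>e * t\<bar> = t" if "e = 1 \<or> e = (-1::real)" "t \<ge> 0" for e t using that by auto
  have w_sq: "1 + (w e t)^2 = Complex (b t) (e * t)" if "e = 1 \<or> e = -1" for e t
    using that by (auto simp: w_def power_mult_distrib)
  have w_mem: "w e t \<in> \<Omega>w" if "e = 1 \<or> e = -1" "t \<ge> 0" for e t
    using b_mem[of "e * t" "b t"] w_sq[OF that(1)] e_abs[OF that] by (simp add: \<Omega>w_def)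
  have w_csqrt: "w e t = csqrt (Complex (b t) (e * t) - 1)" if "e = 1 \<or> e = -1" "t > 0" for e t
    unfolding w_def using csqrt_minus_one_eq[OF that, of "b t"] b_less[of t] that by simp
  have Pcont: "continuous_on \<Omega>w P"
    using P by (intro continuous_at_imp_continuous_on ballI DERIV_isCont)
  have curve: "norm (P (w e T) - P (w e 0)) \<le> B" if e: "e = 1 \<or> e = -1" and T: "T > 0" for e T
  proof -
    define w' where "w' = (\<lambda>t. of_real e * \<i> * (- Complex (b' t) e / (2 * csqrt (1 - Complex (b t) (e * t)))))"
    have arg: "1 - Complex (b t) (e * t) \<notin> \<real>\<^sub>\<le>\<^sub>0" if "t \<ge> 0" for t
      using b_less[OF that] by (simp add: complex_nonpos_Reals_iff)
    \<comment> \<open>The mean value inequality with majorant \<psi> bounds the increment of the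
      primitive along the curve, in place of an improper integral over t.\<close>
    have "norm (P (w e T) - P (w e 0)) \<le> \<psi> T - \<psi> 0"
    proof (rule differentiable_bound_general[OF T, where f = "\<lambda>t. P (w e t)" and f' = "\<lambda>t. w' t * Hw (w e t)"])
      have cc: "continuous_on {0..T} (\<lambda>t. 1 - Complex (b t) (e * t))"
        unfolding Complex_eq by (intro continuous_intros continuous_on_subset[OF b_cont]) auto
      have "continuous_on {0..T} (\<lambda>t. csqrt (1 - Complex (b t) (e * t)))"
      proof (rule continuous_on_compose2[of "- \<real>\<^sub>\<le>\<^sub>0" csqrt, OF _ cc])
        show "continuous_on (- \<real>\<^sub>\<le>\<^sub>0) csqrt" by (rule holomorphic_on_imp_continuous_on[OF holomorphic_on_csqrt])
      qed (use arg in auto)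
      hence "continuous_on {0..T} (w e)" unfolding w_def by (intro continuous_intros)
      thus "continuous_on {0..T} (\<lambda>t. P (w e t))"
        by (rule continuous_on_compose2[OF Pcont]) (use w_mem[OF e] in auto)
      show "continuous_on {0..T} \<psi>" by (rule continuous_on_subset[OF \<psi>_cont]) auto
      fix t assume t: "0 < t" "t < T"
      show "(\<psi> has_vector_derivative \<psi>' t) (at t)"
        using \<psi>_deriv[OF t(1)] by (simp add: has_real_derivative_iff_has_vector_derivative)
      have "((\<lambda>t. complex_of_real (b t)) has_vector_derivative of_real (b' t)) (at t)"
        using b_deriv[OF t(1)] by (intro has_vector_derivative_of_real) (simp add: has_real_derivative_iff_has_vector_derivative)
      hence "((\<lambda>t. 1 - (complex_of_real (b t) + \<i> * of_real (e * t))) has_vector_derivative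
          0 - (of_real (b' t) + \<i> * of_real (e * 1))) (at t)"
        by (intro derivative_intros has_vector_derivative_diff has_vector_derivative_add has_vector_derivative_const
             has_vector_derivative_mult_right has_vector_derivative_of_real)
           (use b_deriv[OF t(1)] in \<open>auto intro!: derivative_eq_intros\<close>)
      hence d1: "((\<lambda>t. 1 - Complex (b t) (e * t)) has_vector_derivative - Complex (b' t) e) (at t)"
        by (simp add: Complex_eq)
      have "(csqrt has_field_derivative inverse (2 * csqrt (1 - Complex (b t) (e * t)))) (at (1 - Complex (b t) (e * t)))"
        using arg[of t] t by (intro has_field_derivative_csqrt) auto
      from field_vector_diff_chain_at[OF d1 this]
      have "((\<lambda>t. csqrt (1 - Complex (b t) (e * t))) has_vector_derivative - Complex (b' t) e / (2 * csqrt (1 - Complex (b t) (e * t)))) (at t)"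
        by (simp only: o_def divide_inverse)
      hence "((w e) has_vector_derivative w' t) (at t)"
        unfolding w_def w'_def by (rule has_vector_derivative_mult_right)
      from field_vector_diff_chain_at[OF this P[OF w_mem[OF e]]] t
      show "((\<lambda>t. P (w e t)) has_vector_derivative w' t * Hw (w e t)) (at t)" by (simp add: o_def)
      have "norm (w' t) = norm (Complex (b' t) e) / (2 * norm (csqrt (1 - Complex (b t) (e * t))))"
        using e by (auto simp: w'_def norm_mult norm_divide)
      also have "norm (csqrt (1 - Complex (b t) (e * t))) = norm (w e t)" using e by (auto simp: w_def norm_mult)
      finally have "norm (w' t * Hw (w e t)) = norm (F (Complex (b t) (e * t))) * norm (Complex (b' t) e)"
        unfolding norm_mult Hw_def w_sq[OF e] F_def norm_divide using w_csqrt[OF e t(1)] by simp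
      also have "\<dots> \<le> norm (F (Complex (b t) (e * t))) * (\<bar>b' t\<bar> + 1)"
        using cmod_le[of "Complex (b' t) e"] e by (intro mult_left_mono) auto
      also have "\<dots> \<le> \<psi>' t" using \<psi>_bound[of "e * t"] e_abs[OF e, of t] t by (simp add: F_def)
      finally show "norm (w' t * Hw (w e t)) \<le> \<psi>' t" .
    qed
    thus ?thesis using B[of T] T by simp
  qed
  have horiz: "norm (Q (Complex 2 (e * T)) - P (w e T)) \<le> 2 * H T" if e: "e = 1 \<or> e = -1" and T: "T \<ge> 1" for e T
  proof -
    let ?S = "closed_segment (Complex 2 (e * T)) (Complex (b T) (e * T))"
    have bT: "b T < 1" using b_less T by simp
    have mem: "Im s = e * T \<and> b T \<le> Re s \<and> Re s \<le> 2" if "s \<in> ?S" for s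
      using that bT by (auto simp: closed_segment_same_Im closed_segment_eq_real_ivl)
    have abs: "\<bar>e * T\<bar> = T" "e * T \<noteq> 0" using e T by auto
    have "norm (Q (Complex 2 (e * T)) - Q (Complex (b T) (e * T))) \<le> H T * norm (Complex 2 (e * T) - Complex (b T) (e * T))"
    proof (rule field_differentiable_bound[of ?S])
      fix s assume "s \<in> ?S"
      then obtain \<sigma> where s: "s = Complex \<sigma> (e * T)" "b T \<le> \<sigma>" "\<sigma> \<le> 2" using mem by (metis complex.collapse)
      have "(Q has_field_derivative F s) (at s)"
        unfolding s using s abs by (intro Q b_mem nonreal) auto
      thus "(Q has_field_derivative F s) (at s within ?S)" by (rule has_field_derivative_at_within)
      show "norm (F s) \<le> H T" using H_bound[of "e * T" \<sigma>] s abs T by (simp add: F_def)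
    qed auto
    also have "Complex 2 (e * T) - Complex (b T) (e * T) = of_real (2 - b T)" by (simp add: complex_eq_iff)
    also have "H T * norm (complex_of_real (2 - b T)) \<le> H T * 2"
    proof (rule mult_left_mono)
      \<comment> \<open>Keeps the horizontal segment from Re s = b T to 2 of length at most
        2.\<close>
      have "b T \<ge> 0" using b_mem[of T "b T"] Re_pos[of "Complex (b T) T"] T by simp
      thus "norm (complex_of_real (2 - b T)) \<le> 2" using bT by (simp only: norm_of_real)
      have "0 \<le> norm (F (Complex (b T) (e * T)))" by simp
      also have "\<dots> \<le> H T" using H_bound[of "e * T" "b T"] abs T bT by (simp add: F_def)
      finally show "0 \<le> H T" .
    qed
    finally show ?thesis using w_csqrt[OF e, of T] T by (simp add: Q_def mult.commute)
  qed
  define a where "a = b 0"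
  have a: "a < 1" using b_less by (simp add: a_def)
  have seg: "of_real \<sigma> \<in> \<Omega>" if "a \<le> \<sigma>" for \<sigma>
    using b_mem[of 0 \<sigma>] that by (simp add: a_def complex_of_real_def)
  \<comment> \<open>The difference of the primitive between the two sides of the cut above \<sigma>.
    It vanishes at the branch point \<sigma> = 1.\<close>
  define \<Psi> where "\<Psi> = (\<lambda>\<sigma>. P (\<i> * of_real (sqrt (1 - \<sigma>))) - P (- \<i> * of_real (sqrt (1 - \<sigma>))))"
  have sq: "1 + (\<i> * complex_of_real (sqrt (1 - \<sigma>)))^2 = of_real \<sigma>" "1 + (- \<i> * complex_of_real (sqrt (1 - \<sigma>)))^2 = of_real \<sigma>" if "\<sigma> \<le> 1" for \<sigma>
    using that by (auto simp: power_mult_distrib simp flip: of_real_power)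
  have memw: "\<i> * complex_of_real (sqrt (1 - \<sigma>)) \<in> \<Omega>w" "- \<i> * complex_of_real (sqrt (1 - \<sigma>)) \<in> \<Omega>w" if "a \<le> \<sigma>" "\<sigma> \<le> 1" for \<sigma>
    using seg[OF that(1)] sq[OF that(2)] by (simp_all add: \<Omega>w_def)
  define g where "g = (\<lambda>\<sigma>. G \<sigma> * smooth_kernel_real x h \<sigma> / sqrt (1 - \<sigma>))"
  \<comment> \<open>The two sides contribute equally, whence the factor 2. The integrand is singular
    at \<sigma> = 1, but \<Psi> is continuous there, so a derivative in the open interval suffices
    for the improper integral.\<close>
  have "((\<lambda>\<sigma>. - 2 * \<i> * of_real (g \<sigma>)) has_integral (\<Psi> 1 - \<Psi> a)) {a..1}"
  proof (rule fundamental_theorem_of_calculus_interior)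
    show "continuous_on {a..1} \<Psi>" unfolding \<Psi>_def
      by (intro continuous_intros continuous_on_compose2[OF Pcont]) (use memw in auto)
    fix \<sigma> assume s: "\<sigma> \<in> {a<..<1}"
    define u where "u = sqrt (1 - \<sigma>)"
    have u: "u > 0" using s by (simp add: u_def)
    have "((\<lambda>\<sigma>. sqrt (1 - \<sigma>)) has_real_derivative - 1 / (2 * u)) (at \<sigma>)"
      using s by (auto intro!: derivative_eq_intros simp: u_def field_simps)
    hence d: "((\<lambda>\<sigma>. complex_of_real (sqrt (1 - \<sigma>))) has_vector_derivative of_real (- 1 / (2 * u))) (at \<sigma>)"
      by (intro has_vector_derivative_of_real) (simp add: has_real_derivative_iff_has_vector_derivative)
    have Hu: "Hw (\<i> * of_real u) = 2 * of_real (G \<sigma> * smooth_kernel_real x h \<sigma>)" "Hw (- \<i> * of_real u) = 2 * of_real (G \<sigma> * smooth_kernel_real x h \<sigma>)"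
      unfolding Hw_def u_def using sq[of \<sigma>] s Gh_real[OF seg, of \<sigma>] smooth_kernel_of_real[OF x h, of \<sigma>] by simp_all
    have "((\<lambda>\<sigma>. P (\<i> * of_real (sqrt (1 - \<sigma>)))) has_vector_derivative \<i> * of_real (- 1 / (2 * u)) * Hw (\<i> * of_real u)) (at \<sigma>)"
      using field_vector_diff_chain_at[OF has_vector_derivative_mult_right[OF d, of "\<i>"] P[OF memw(1)]] s by (simp add: o_def u_def)
    moreover have "((\<lambda>\<sigma>. P (- \<i> * of_real (sqrt (1 - \<sigma>)))) has_vector_derivative - \<i> * of_real (- 1 / (2 * u)) * Hw (- \<i> * of_real u)) (at \<sigma>)"
      using field_vector_diff_chain_at[OF has_vector_derivative_mult_right[OF d, of "- \<i>"] P[OF memw(2)]] s by (simp add: o_def u_def)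
    ultimately have "(\<Psi> has_vector_derivative \<i> * of_real (- 1 / (2 * u)) * Hw (\<i> * of_real u) - (- \<i> * of_real (- 1 / (2 * u)) * Hw (- \<i> * of_real u))) (at \<sigma>)"
      unfolding \<Psi>_def by (rule has_vector_derivative_diff)
    moreover have "\<i> * of_real (- 1 / (2 * u)) * Hw (\<i> * of_real u) - (- \<i> * of_real (- 1 / (2 * u)) * Hw (- \<i> * of_real u)) = - 2 * \<i> * of_real (g \<sigma>)"
      unfolding Hu using u by (simp add: g_def u_def[symmetric] field_simps)
    ultimately show "(\<Psi> has_vector_derivative - 2 * \<i> * of_real (g \<sigma>)) (at \<sigma>)" by simp
  qed (use a in auto)
  moreover have "\<Psi> 1 = 0" by (simp add: \<Psi>_def)
  ultimately have hi: "((\<lambda>\<sigma>. - 2 * \<i> * of_real (g \<sigma>)) has_integral (- \<Psi> a)) {a..1}" by simp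
  define I where "I = Im (\<Psi> a) / 2"
  have "((\<lambda>\<sigma>. Im (- 2 * \<i> * of_real (g \<sigma>))) has_integral Im (- \<Psi> a)) {a..1}"
    using has_integral_linear[OF hi bounded_linear_Im] by (simp add: o_def)
  hence "((\<lambda>\<sigma>. (-1/2) * (- 2 * g \<sigma>)) has_integral (-1/2) * (- Im (\<Psi> a))) {a..1}"
    by (intro has_integral_mult_right) simp
  hence gI: "(g has_integral I) {a..1}" by (simp add: I_def)
  have "((\<lambda>\<sigma>. Re (- 2 * \<i> * of_real (g \<sigma>))) has_integral Re (- \<Psi> a)) {a..1}"
    using has_integral_linear[OF hi bounded_linear_Re] by (simp add: o_def)
  hence "((\<lambda>\<sigma>. 0) has_integral Re (- \<Psi> a)) {a..1}" by simp
  hence "Re (\<Psi> a) = 0" using has_integral_unique[OF _ has_integral_0] by fastforce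
  hence \<Psi>I: "\<Psi> a = 2 * \<i> * of_real I" by (simp add: I_def complex_eq_iff)
  have w0: "P (w 1 0) - P (w (-1) 0) = \<Psi> a"
  proof -
    have "1 - Complex (b 0) 0 = of_real (1 - a)" by (simp add: a_def complex_eq_iff)
    hence "csqrt (1 - Complex (b 0) 0) = csqrt (of_real (1 - a))" by (simp only:)
    also have "\<dots> = of_real (sqrt (1 - a))" using a by (subst csqrt_of_real') simp
    finally show ?thesis by (simp add: w_def \<Psi>_def)
  qed
  obtain C where C: "\<And>T. T \<ge> 2 \<Longrightarrow> norm (contour_integral (linepath (Complex 2 (-T)) (Complex 2 T)) (\<lambda>s. E_sum s * smooth_kernel x h s)
     - 2 * pi * \<i> * of_real (smooth_count x h)) \<le> C / T"
    using perron_smooth_count[OF x h] by blast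
  define L where "L = norm (2 * pi * \<i> * of_real (smooth_count x h) - \<Psi> a)"
  have "L \<le> 2 * B + 4 * H T + C / T" if T: "T \<ge> 2" for T
  proof -
    define c where "c = contour_integral (linepath (Complex 2 (-T)) (Complex 2 T)) (\<lambda>s. E_sum s * smooth_kernel x h s)"
    have "c = Q (Complex 2 T) - Q (Complex 2 (-T))" unfolding c_def by (rule line)
    \<comment> \<open>The vertical line is deformed into a horizontal segment, one curve down to the
      cut, the jump across it, the other curve, and the second horizontal segment. As T tends to
      infinity only the two curves, bounded by B each, remain as error.\<close>
    hence dec: "2 * pi * \<i> * of_real (smooth_count x h) - \<Psi> a = - (c - 2 * pi * \<i> * of_real (smooth_count x h))
       + (Q (Complex 2 (1 * T)) - P (w 1 T)) + (P (w 1 T) - P (w 1 0)) - (P (w (-1) T) - P (w (-1) 0)) - (Q (Complex 2 (-1 * T)) - P (w (-1) T))"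
      unfolding w0[symmetric] by simp
    have "L \<le> norm (c - 2 * pi * \<i> * of_real (smooth_count x h)) + norm (Q (Complex 2 (1 * T)) - P (w 1 T))
       + norm (P (w 1 T) - P (w 1 0)) + norm (P (w (-1) T) - P (w (-1) 0)) + norm (Q (Complex 2 (-1 * T)) - P (w (-1) T))"
    proof -
      have tri: "norm (- z1 + z2 + z3 - z4 - z5) \<le> norm z1 + norm z2 + norm z3 + norm z4 + norm z5" for z1 z2 z3 z4 z5 :: complex
        using norm_triangle_ineq4[of "-z1+z2+z3-z4" z5] norm_triangle_ineq4[of "-z1+z2+z3" z4]
          norm_triangle_ineq[of "-z1+z2" z3] norm_triangle_ineq[of "-z1" z2] by simp
      show ?thesis unfolding L_def dec by (rule tri)
    qed
    also have "\<dots> \<le> C / T + 2 * H T + B + B + 2 * H T"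
    proof -
      have "norm (c - 2 * pi * \<i> * of_real (smooth_count x h)) \<le> C / T" unfolding c_def by (rule C[OF T])
      thus ?thesis using T by (intro add_mono horiz curve) auto
    qed
    finally show ?thesis by simp
  qed
  hence ev: "\<forall>\<^sub>F T in at_top. L \<le> 2 * B + 4 * H T + C / T"
    by (rule eventually_mono[OF eventually_ge_at_top[of 2]])
  have "((\<lambda>T. 2 * B + 4 * H T + C / T) \<longlongrightarrow> 2 * B + 4 * 0 + 0) at_top"
    by (intro tendsto_intros H_lim tendsto_divide_0[OF tendsto_const filterlim_at_top_imp_at_infinity[OF filterlim_ident]])
  from tendsto_lowerbound[OF this ev] have "L \<le> 2 * B" by simp
  moreover have "2 * pi * \<i> * of_real (smooth_count x h) - \<Psi> a = of_real (2 * pi * (smooth_count x h - I / pi)) * \<i>"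
    unfolding \<Psi>I by (simp add: field_simps)
  hence "L = 2 * pi * \<bar>smooth_count x h - I / pi\<bar>" unfolding L_def
    by (simp only: norm_mult norm_of_real norm_ii) (simp add: abs_mult)
  ultimately have "pi * \<bar>smooth_count x h - I / pi\<bar> \<le> B" by simp
  moreover have "1 * \<bar>smooth_count x h - I / pi\<bar> \<le> pi * \<bar>smooth_count x h - I / pi\<bar>"
    using pi_ge_two by (intro mult_right_mono) auto
  ultimately have "\<bar>smooth_count x h - I / pi\<bar> \<le> B" by simp
  thus ?thesis using gI by (auto simp: g_def a_def)
qed

section \<open>The main term\<close>

lemma continuous_on_G:
  assumes c: "c > 1/2"
  shows "continuous_on {c..1} G"
proof -
  have co: "continuous_on {c..1} (\<lambda>\<sigma>. f (complex_of_real \<sigma>))" if "f holomorphic_on {s. Re s > 1/2}" for f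
    by (rule continuous_on_compose2[OF holomorphic_on_imp_continuous_on[OF that]]) (use c in \<open>auto intro!: continuous_intros\<close>)
  have "continuous_on {c..1} (\<lambda>\<sigma>. sqrt (Re (zeta_reg (of_real \<sigma>))) * sqrt (Re (L_chi4 (of_real \<sigma>)))
      * (1 - 2 powr (- \<sigma>)) powr (-1/2) * exp (Re (log_prod3 (of_real \<sigma>)) / 2))"
  proof (intro continuous_on_mult continuous_on_real_sqrt continuous_on_Re co holomorphic_zeta_reg
      holomorphic_L_chi4 holomorphic_log_prod3 continuous_on_exp continuous_on_divide continuous_on_powr continuous_on_diff continuous_on_const continuous_on_minus continuous_on_id)
    show "\<forall>\<sigma>\<in>{c..1}. 1 - 2 powr (- \<sigma>) \<noteq> 0"
    proof
      fix \<sigma> assume "\<sigma> \<in> {c..1}"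
      hence "2 powr (-\<sigma>) < 1" using c by (intro powr_less_one) auto
      thus "1 - 2 powr (-\<sigma>) \<noteq> 0" by linarith
    qed
  qed auto
  moreover have "sqrt (Re (zeta_reg (of_real \<sigma>))) * sqrt (Re (L_chi4 (of_real \<sigma>)))
      * (1 - 2 powr (- \<sigma>)) powr (-1/2) * exp (Re (log_prod3 (of_real \<sigma>)) / 2) = G \<sigma>" if "\<sigma> \<in> {c..1}" for \<sigma>
  proof -
    have \<sigma>: "\<sigma> > 1/2" "\<sigma> \<le> 1" using that c by auto
    show ?thesis unfolding G_def zeta_sm1_eq[OF \<sigma>] log_prod3_of_real(3)[OF \<sigma>(1)] log_prod3_of_real(1)[OF \<sigma>(1)] by simp
  qed
  ultimately show ?thesis by (rule continuous_on_eq)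
qed

lemma has_integral_inverse_sqrt:
  assumes "c \<le> 1"
  shows "((\<lambda>\<sigma>. 1 / sqrt (1 - \<sigma>)) has_integral 2 * sqrt (1 - c)) {c..1}"
proof -
  have "((\<lambda>\<sigma>. 1 / sqrt (1 - \<sigma>)) has_integral ((-2) * sqrt (1 - 1) - (-2) * sqrt (1 - c))) {c..1}"
  proof (rule fundamental_theorem_of_calculus_interior[OF assms])
    show "continuous_on {c..1} (\<lambda>\<sigma>. (-2) * sqrt (1 - \<sigma>))" by (intro continuous_intros)
    fix \<sigma> assume "\<sigma> \<in> {c<..<1}"
    hence "((\<lambda>\<sigma>. (-2) * sqrt (1 - \<sigma>)) has_real_derivative 1 / sqrt (1 - \<sigma>)) (at \<sigma>)"
      by (auto intro!: derivative_eq_intros simp: field_simps)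
    thus "((\<lambda>\<sigma>. (-2) * sqrt (1 - \<sigma>)) has_vector_derivative 1 / sqrt (1 - \<sigma>)) (at \<sigma>)"
      by (simp add: has_real_derivative_iff_has_vector_derivative)
  qed
  thus ?thesis by simp
qed

lemma absolutely_integrable_div_sqrt:
  fixes f :: "real \<Rightarrow> real"
  assumes "c \<le> 1" and f: "continuous_on {c..1} f"
  shows "(\<lambda>\<sigma>. f \<sigma> / sqrt (1 - \<sigma>)) absolutely_integrable_on {c..1}"
proof -
  have g: "(\<lambda>\<sigma>. 1 / sqrt (1 - \<sigma>)) absolutely_integrable_on {c..1}"
    using has_integral_inverse_sqrt[OF assms(1)] by (intro nonnegative_absolutely_integrable_1) auto
  have "(\<lambda>\<sigma>. f \<sigma> * (1 / sqrt (1 - \<sigma>))) absolutely_integrable_on {c..1}"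
  proof (rule absolutely_integrable_bounded_measurable_product_real[OF _ _ _ g])
    show "f \<in> borel_measurable (lebesgue_on {c..1})" using f by (intro continuous_imp_measurable_on_sets_lebesgue) auto
    show "bounded (f ` {c..1})" using f by (intro compact_imp_bounded compact_continuous_image) auto
  qed auto
  thus ?thesis by simp
qed

text \<open>Two mean value steps: the difference quotient equals z^\<sigma>/\<sigma> for some z in
  (x, x + h), and z^\<sigma>/\<sigma> - x^\<sigma>/\<sigma> = (z - x) y^(\<sigma>-1) with y > x
  \<ge> 1, so the last factor is at most 1.\<close>

lemma smooth_kernel_real_near:
  assumes x: "x \<ge> 1" and h: "h > 0" and \<sigma>: "0 < \<sigma>" "\<sigma> \<le> 1"
  shows "\<bar>smooth_kernel_real x h \<sigma> - x powr \<sigma> / \<sigma>\<bar> \<le> h"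
proof -
  have mvt: "\<exists>z>u. z < v \<and> v powr r - u powr r = (v - u) * (r * z powr (r - 1))" if "0 < u" "u < v" for u v r :: real
    using that by (intro MVT2) (auto intro!: derivative_eq_intros)
  obtain z where z: "z > x" "z < x + h" "(x + h) powr (\<sigma> + 1) - x powr (\<sigma> + 1) = h * ((\<sigma> + 1) * z powr \<sigma>)"
    using mvt[of x "x + h" "\<sigma> + 1"] x h by auto
  obtain y where y: "y > x" "y < z" "z powr \<sigma> - x powr \<sigma> = (z - x) * (\<sigma> * y powr (\<sigma> - 1))"
    using mvt[of x z \<sigma>] x z by auto
  have "y powr (\<sigma> - 1) \<le> y powr 0" using y x \<sigma> by (intro powr_mono) auto
  hence y1: "y powr (\<sigma> - 1) \<le> 1" using y x by simp
  have "smooth_kernel_real x h \<sigma> = z powr \<sigma> / \<sigma>" unfolding smooth_kernel_real_def z(3) using h \<sigma> by simp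
  hence "smooth_kernel_real x h \<sigma> - x powr \<sigma> / \<sigma> = (z - x) * y powr (\<sigma> - 1)"
    using y(3) \<sigma> by (simp add: diff_divide_distrib[symmetric])
  moreover have "(z - x) * y powr (\<sigma> - 1) \<le> h * 1" using z y1 by (intro mult_mono) auto
  moreover have "(z - x) * y powr (\<sigma> - 1) \<ge> 0" using z by simp
  ultimately show ?thesis by simp
qed

text \<open>The lower end is a parameter because the contour meets the cut at a point other than 1/2
  + \<epsilon>.\<close>

definition main_integral :: "real \<Rightarrow> real \<Rightarrow> real" where
  "main_integral c x = integral {c..1} (\<lambda>\<sigma>. G \<sigma> * x powr \<sigma> / \<sigma> / sqrt (1 - \<sigma>))"

lemma mainterm_eq: "\<epsilon> > 0 \<Longrightarrow> mainterm \<epsilon> x = main_integral (1/2 + \<epsilon>) x / pi"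
proof -
  have "integral {1/2 + \<epsilon>..1} (\<lambda>\<sigma>. G \<sigma> * x powr \<sigma> / (\<sigma> * sqrt \<bar>\<sigma> - 1\<bar>))
      = integral {1/2 + \<epsilon>..1} (\<lambda>\<sigma>. G \<sigma> * x powr \<sigma> / \<sigma> / sqrt (1 - \<sigma>))"
    by (intro integral_cong) auto
  thus ?thesis by (simp add: mainterm_def main_integral_def)
qed

lemma integrable_main_integrand:
  assumes "c > 1/2" "c \<le> 1" "x > 0"
  shows "(\<lambda>\<sigma>. G \<sigma> * x powr \<sigma> / \<sigma> / sqrt (1 - \<sigma>)) integrable_on {c..1}"
proof -
  have "continuous_on {c..1} (\<lambda>\<sigma>. G \<sigma> * x powr \<sigma> / \<sigma>)"
    by (intro continuous_intros continuous_on_G[OF assms(1)]) (use assms in auto)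
  from absolutely_integrable_div_sqrt[OF assms(2) this] show ?thesis
    by (rule set_lebesgue_integral_eq_integral(1))
qed

text \<open>The constant 4 collects 1/\<sigma> \<le> 2 and the integral of (1 - \<sigma>)^(-1/2),
  which is at most 2.\<close>

lemma main_integral_diff:
  assumes c: "c > 1/2" and C: "\<And>\<sigma>. \<sigma> \<in> {c..1} \<Longrightarrow> \<bar>G \<sigma>\<bar> \<le> C" and a: "c \<le> a" "a \<le> d" "d \<le> 1" and x: "x \<ge> 1"
  shows "\<bar>main_integral a x - main_integral d x\<bar> \<le> 4 * C * x powr d"
proof -
  let ?g = "\<lambda>\<sigma>. G \<sigma> * x powr \<sigma> / \<sigma> / sqrt (1 - \<sigma>)"
  have "1 \<in> {c..1}" using a by auto
  from C[OF this] have C0: "C \<ge> 0" by simp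
  have int: "?g integrable_on {a..1}" using c a x by (intro integrable_main_integrand) auto
  have intd: "?g integrable_on {a..d}" using int a by (intro integrable_on_subinterval[OF int]) auto
  have "integral {a..d} ?g + integral {d..1} ?g = integral {a..1} ?g"
    using a by (intro Henstock_Kurzweil_Integration.integral_combine int) auto
  hence eq: "main_integral a x - main_integral d x = integral {a..d} ?g" by (simp add: main_integral_def)
  have s1: "(\<lambda>\<sigma>. 1 / sqrt (1 - \<sigma>)) integrable_on {a..1}" "integral {a..1} (\<lambda>\<sigma>. 1 / sqrt (1 - \<sigma>)) = 2 * sqrt (1 - a)"
    using has_integral_inverse_sqrt[of a] a by (auto intro: integral_unique)
  have s2: "(\<lambda>\<sigma>. 1 / sqrt (1 - \<sigma>)) integrable_on {a..d}" using a by (intro integrable_on_subinterval[OF s1(1)]) auto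
  have "norm (integral {a..d} ?g) \<le> integral {a..d} (\<lambda>\<sigma>. 2 * C * x powr d * (1 / sqrt (1 - \<sigma>)))"
  proof (rule integral_norm_bound_integral[OF intd])
    show "(\<lambda>\<sigma>. 2 * C * x powr d * (1 / sqrt (1 - \<sigma>))) integrable_on {a..d}" using s2 by (rule integrable_on_mult_right)
    fix \<sigma> assume s: "\<sigma> \<in> {a..d}"
    have "\<bar>G \<sigma>\<bar> * x powr \<sigma> * (1 / \<sigma>) \<le> C * x powr d * 2"
      using s a c x C0 by (intro mult_mono C powr_mono) (auto simp: field_simps)
    hence "\<bar>G \<sigma>\<bar> * x powr \<sigma> / \<sigma> * (1 / sqrt (1 - \<sigma>)) \<le> 2 * C * x powr d * (1 / sqrt (1 - \<sigma>))"
      using s a by (intro mult_right_mono) (auto simp: mult_ac)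
    thus "norm (?g \<sigma>) \<le> 2 * C * x powr d * (1 / sqrt (1 - \<sigma>))" using s a c by (simp add: abs_mult)
  qed
  also have "\<dots> = 2 * C * x powr d * integral {a..d} (\<lambda>\<sigma>. 1 / sqrt (1 - \<sigma>))" by (rule integral_mult_right)
  also have "\<dots> \<le> 2 * C * x powr d * 2"
  proof (rule mult_left_mono)
    have "integral {a..d} (\<lambda>\<sigma>. 1 / sqrt (1 - \<sigma>)) \<le> integral {a..1} (\<lambda>\<sigma>. 1 / sqrt (1 - \<sigma>))"
      using a by (intro integral_subset_le s1 s2) auto
    also have "\<dots> \<le> 2" unfolding s1(2) using a c by simp
    finally show "integral {a..d} (\<lambda>\<sigma>. 1 / sqrt (1 - \<sigma>)) \<le> 2" .
  qed (use C0 in auto)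
  finally show ?thesis unfolding eq by simp
qed

lemma smooth_integral_diff:
  assumes c: "c > 1/2" and C: "\<And>\<sigma>. \<sigma> \<in> {c..1} \<Longrightarrow> \<bar>G \<sigma>\<bar> \<le> C" and a: "c \<le> a" "a \<le> 1" and x: "x \<ge> 1" and h: "h > 0"
    and I: "((\<lambda>\<sigma>. G \<sigma> * smooth_kernel_real x h \<sigma> / sqrt (1 - \<sigma>)) has_integral I) {a..1}"
  shows "\<bar>I - main_integral a x\<bar> \<le> 2 * C * h"
proof -
  let ?g = "\<lambda>\<sigma>. G \<sigma> * x powr \<sigma> / \<sigma> / sqrt (1 - \<sigma>)"
  let ?k = "\<lambda>\<sigma>. G \<sigma> * smooth_kernel_real x h \<sigma> / sqrt (1 - \<sigma>)"
  have "1 \<in> {c..1}" using a by auto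
  from C[OF this] have C0: "C \<ge> 0" by simp
  have int: "?g integrable_on {a..1}" using c a x by (intro integrable_main_integrand) auto
  have eq: "I - main_integral a x = integral {a..1} (\<lambda>\<sigma>. ?k \<sigma> - ?g \<sigma>)"
    unfolding main_integral_def using I int by (subst integral_diff) (auto simp: integral_unique)
  have s1: "(\<lambda>\<sigma>. 1 / sqrt (1 - \<sigma>)) integrable_on {a..1}" "integral {a..1} (\<lambda>\<sigma>. 1 / sqrt (1 - \<sigma>)) = 2 * sqrt (1 - a)"
    using has_integral_inverse_sqrt[of a] a by (auto intro: integral_unique)
  have "norm (integral {a..1} (\<lambda>\<sigma>. ?k \<sigma> - ?g \<sigma>)) \<le> integral {a..1} (\<lambda>\<sigma>. C * h * (1 / sqrt (1 - \<sigma>)))"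
  proof (rule integral_norm_bound_integral)
    show "(\<lambda>\<sigma>. ?k \<sigma> - ?g \<sigma>) integrable_on {a..1}" using I int by (intro integrable_diff) auto
    show "(\<lambda>\<sigma>. C * h * (1 / sqrt (1 - \<sigma>))) integrable_on {a..1}" using s1(1) by (rule integrable_on_mult_right)
    fix \<sigma> assume s: "\<sigma> \<in> {a..1}"
    have "\<bar>G \<sigma>\<bar> * \<bar>smooth_kernel_real x h \<sigma> - x powr \<sigma> / \<sigma>\<bar> \<le> C * h"
      using s a c x h C0 by (intro mult_mono C smooth_kernel_real_near) auto
    hence "\<bar>G \<sigma>\<bar> * \<bar>smooth_kernel_real x h \<sigma> - x powr \<sigma> / \<sigma>\<bar> * (1 / sqrt (1 - \<sigma>)) \<le> C * h * (1 / sqrt (1 - \<sigma>))"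
      using s by (intro mult_right_mono) auto
    moreover have "?k \<sigma> - ?g \<sigma> = G \<sigma> * (smooth_kernel_real x h \<sigma> - x powr \<sigma> / \<sigma>) * (1 / sqrt (1 - \<sigma>))"
      by (simp add: algebra_simps diff_divide_distrib)
    ultimately show "norm (?k \<sigma> - ?g \<sigma>) \<le> C * h * (1 / sqrt (1 - \<sigma>))" using s by (simp add: abs_mult)
  qed
  also have "\<dots> = C * h * (2 * sqrt (1 - a))" using s1 by (simp only: integral_mult_right)
  also have "\<dots> \<le> C * h * 2" using C0 h a c by (intro mult_left_mono) auto
  finally show ?thesis unfolding eq by simp
qed

lemma G_bounded: "c > 1/2 \<Longrightarrow> \<exists>C. \<forall>\<sigma>\<in>{c..1}. \<bar>G \<sigma>\<bar> \<le> C"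
  using compact_imp_bounded[OF compact_continuous_image[OF continuous_on_G compact_Icc]]
  unfolding bounded_iff by auto

text \<open>The mean value bound loses nothing in h but decays only like 1/|s|; the trivial bound
  decays like |s|^(-2) at the price of a factor (x + h)/h.\<close>

lemma norm_smooth_kernel_le:
  assumes x: "x > 0" and h: "h > 0" and s: "Re s > 0"
  shows "norm (smooth_kernel x h s) \<le> (x + h) powr Re s / norm s"
    and "norm (smooth_kernel x h s) \<le> 2 * (x + h) powr (Re s + 1) / (h * norm s * norm (s + 1))"
proof -
  have nz: "s \<noteq> 0" "s + 1 \<noteq> 0" using s by (auto simp: complex_eq_iff)
  have n: "norm (smooth_kernel x h s) = norm (complex_of_real (x + h) powr (s + 1) - of_real x powr (s + 1)) / (h * norm s * norm (s + 1))"
    unfolding smooth_kernel_def using h by (simp add: norm_divide norm_mult)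
  have "norm (complex_of_real (x + h) powr (s + 1) - of_real x powr (s + 1)) \<le> norm (s + 1) * (x + h) powr Re s * ((x + h) - x)"
    using x h s by (intro norm_powr_diff_le) (auto intro!: powr_mono2)
  hence "norm (smooth_kernel x h s) \<le> (norm (s + 1) * (x + h) powr Re s * ((x + h) - x)) / (h * norm s * norm (s + 1))"
    unfolding n using h by (intro divide_right_mono) auto
  also have "\<dots> = (x + h) powr Re s / norm s" using h nz by simp
  finally show "norm (smooth_kernel x h s) \<le> (x + h) powr Re s / norm s" .
  have "norm (complex_of_real (x + h) powr (s + 1) - of_real x powr (s + 1)) \<le> (x + h) powr (Re s + 1) + x powr (Re s + 1)"
    using x h norm_powr_real_powr[of "of_real (x + h)" "s + 1"] norm_powr_real_powr[of "of_real x" "s + 1"]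
    by (intro order_trans[OF norm_triangle_ineq4]) auto
  also have "x powr (Re s + 1) \<le> (x + h) powr (Re s + 1)" using x h s by (intro powr_mono2) auto
  finally have "norm (complex_of_real (x + h) powr (s + 1) - of_real x powr (s + 1)) \<le> 2 * (x + h) powr (Re s + 1)" by simp
  thus "norm (smooth_kernel x h s) \<le> 2 * (x + h) powr (Re s + 1) / (h * norm s * norm (s + 1))"
    unfolding n using h by (intro divide_right_mono) auto
qed

lemma norm_ge_third:
  assumes "Re s \<ge> 1/2" shows "norm s \<ge> (1 + \<bar>Im s\<bar>) / 3" "norm (s + 1) \<ge> (1 + \<bar>Im s\<bar>) / 3"
  using assms abs_Re_le_cmod[of s] abs_Im_le_cmod[of s] abs_Re_le_cmod[of "s + 1"] abs_Im_le_cmod[of "s + 1"] by auto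

lemma norm_smooth_kernel_le':
  assumes x: "x > 0" and h: "h > 0" and s: "Re s \<ge> 1/2"
  shows "norm (smooth_kernel x h s) \<le> 18 * (x + h) powr (Re s + 1) / (h * (1 + \<bar>Im s\<bar>)^2)"
proof -
  define u where "u = 1 + \<bar>Im s\<bar>"
  have u: "u > 0" by (simp add: u_def)
  have "norm (smooth_kernel x h s) \<le> 2 * (x + h) powr (Re s + 1) / (h * norm s * norm (s + 1))"
    using s by (intro norm_smooth_kernel_le x h) auto
  also have "\<dots> \<le> 2 * (x + h) powr (Re s + 1) / (h * (u / 3) * (u / 3))"
    using u h norm_ge_third[OF s, folded u_def] by (intro divide_left_mono mult_mono mult_pos_pos) auto
  also have "\<dots> = 18 * (x + h) powr (Re s + 1) / (h * u^2)" by (simp add: power2_eq_square)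
  finally show ?thesis by (simp add: u_def)
qed

text \<open>The geometric mean of the two kernel bounds: the extra decay |t|^(-\<delta>) costs only
  ((x + h)/h)^\<delta>. This is what permits h = x^(1/2) under the Riemann hypothesis.\<close>

lemma norm_smooth_kernel_interpolate:
  assumes x: "x > 0" and h: "h > 0" and s: "Re s \<ge> 1/2" and \<delta>: "0 \<le> \<delta>" "\<delta> \<le> 1"
  shows "norm (smooth_kernel x h s) \<le> 3 * (x + h) powr Re s * (6 * (x + h) / h) powr \<delta> * (1 + \<bar>Im s\<bar>) powr (-1 - \<delta>)"
proof -
  define u where "u = 1 + \<bar>Im s\<bar>"
  have u: "u > 0" by (simp add: u_def)
  define A where "A = 3 * (x + h) powr Re s / u"
  define q where "q = 6 * (x + h) / (h * u)"
  have q: "q > 0" using x h u by (simp add: q_def)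
  have A: "A \<ge> 0" using u by (simp add: A_def)
  have "norm (smooth_kernel x h s) \<le> (x + h) powr Re s / norm s"
    using s by (intro norm_smooth_kernel_le x h) auto
  also have "\<dots> \<le> (x + h) powr Re s / (u / 3)"
    using u norm_ge_third[OF s, folded u_def] by (intro divide_left_mono mult_pos_pos) auto
  finally have 1: "norm (smooth_kernel x h s) \<le> A * 1" by (simp add: A_def mult.commute)
  have "norm (smooth_kernel x h s) \<le> 18 * (x + h) powr (Re s + 1) / (h * u^2)"
    using norm_smooth_kernel_le'[OF x h s] by (simp add: u_def)
  also have "\<dots> = A * q" using x h u by (simp add: A_def q_def powr_add power2_eq_square field_simps)
  finally have 2: "norm (smooth_kernel x h s) \<le> A * q" .
  have "norm (smooth_kernel x h s) \<le> A * q powr \<delta>"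
  proof (cases "q \<le> 1")
    case True
    hence "q \<le> q powr \<delta>" using q \<delta> powr_mono'[of \<delta> 1 q] by simp
    thus ?thesis using 2 A by (meson mult_left_mono order_trans)
  next
    case False
    hence "1 \<le> q powr \<delta>" using \<delta> by (simp add: ge_one_powr_ge_zero)
    thus ?thesis using 1 A by (meson mult_left_mono order_trans)
  qed
  also have "A * q powr \<delta> = 3 * (x + h) powr Re s * (6 * (x + h) / h) powr \<delta> * u powr (-1 - \<delta>)"
  proof -
    have "q powr \<delta> = (6 * (x + h) / h) powr \<delta> * u powr (-\<delta>)"
    proof -
      define N where "N = 6 * (x + h) / h"
      have "N > 0" "q = N / u" using x h by (auto simp: N_def q_def)
      hence "q powr \<delta> = N powr \<delta> / u powr \<delta>" by (simp only: powr_divide)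
      thus ?thesis unfolding N_def[symmetric] by (simp add: powr_minus_divide)
    qed
    moreover have "u powr (-1 - \<delta>) = u powr (-\<delta>) / u" using u by (simp add: powr_diff powr_minus divide_inverse)
    ultimately show ?thesis by (simp add: A_def)
  qed
  finally show ?thesis by (simp add: u_def)
qed

text \<open>Phrased for an arbitrary square root z, so that it applies to the branch on any region.
  The first estimate transfers bounds for \<open>Zreg\<close> and serves under the Riemann
  hypothesis; the second is unconditional, two factors |s|^(3/4) under a square root. The distance
  \<delta> from s = 1 avoids the singularity.\<close>

lemma F_bound:
  assumes c: "c > 1/2" and \<delta>: "\<delta> > 0"
  shows "\<exists>C>0. \<forall>s z. Re s \<ge> c \<longrightarrow> Re s \<le> 2 \<longrightarrow> norm (s - 1) \<ge> \<delta> \<longrightarrow>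
     z ^ 2 = Zreg s * exp (log_prod3 s) / (1 - 2 powr (-s)) \<longrightarrow>
     norm (z / csqrt (s - 1)) ^ 2 \<le> C * norm (Zreg s / (s - 1)) \<and> norm (z / csqrt (s - 1)) \<le> C * (1 + \<bar>Im s\<bar>) powr (3/4)"
proof -
  obtain A where A: "A > 0" "\<And>s. Re s \<ge> 1/2 \<Longrightarrow> norm (zeta_reg s) \<le> 1 + A * norm (s - 1) * norm s powr (3/4)"
    using zeta_reg_bound by blast
  obtain D where D: "D > 0" "\<And>s. Re s > 1/2 \<Longrightarrow> norm (L_chi4 s) \<le> D * norm s powr (3/4)"
    using L_chi4_bound by blast
  obtain M where M: "\<And>s. Re s \<ge> c \<Longrightarrow> norm (log_prod3 s) \<le> M" using log_prod3_bound[OF c] by blast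
  \<comment> \<open>Lower bound for |1 - 2^(-s)| on Re s \<ge> 1/2.\<close>
  define q where "q = 1 - 2 powr (-1/2::real)"
  have q: "q > 0" unfolding q_def using powr_less_one[of 2 "-1/2"] by simp
  define C1 where "C1 = exp M / q"
  have C1: "C1 > 0" using q by (simp add: C1_def)
  define C2 where "C2 = C1 * ((2 / \<delta> + A) * D) * 4"
  have C2: "C2 > 0" using C1 A D \<delta> by (simp add: C2_def add_pos_pos)
  define C where "C = max C1 (sqrt C2)"
  have "norm (z / csqrt (s - 1)) ^ 2 \<le> C * norm (Zreg s / (s - 1)) \<and> norm (z / csqrt (s - 1)) \<le> C * (1 + \<bar>Im s\<bar>) powr (3/4)"
    if s: "Re s \<ge> c" "Re s \<le> 2" "norm (s - 1) \<ge> \<delta>" and z: "z ^ 2 = Zreg s * exp (log_prod3 s) / (1 - 2 powr (-s))" for s z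
  proof -
    have "norm (z / csqrt (s - 1)) ^ 2 = norm (z^2) / norm ((csqrt (s - 1))^2)" by (simp add: norm_divide norm_power power_divide)
    also have "\<dots> = norm (Zreg s / (s - 1)) * (norm (exp (log_prod3 s)) / norm (1 - 2 powr (-s)))"
      unfolding z by (simp add: norm_mult norm_divide)
    also have "\<dots> \<le> norm (Zreg s / (s - 1)) * C1"
      unfolding C1_def
    proof (intro mult_left_mono frac_le)
      have "norm (exp (log_prod3 s)) = exp (Re (log_prod3 s))" by simp
      also have "\<dots> \<le> exp M" using M[OF s(1)] complex_Re_le_cmod[of "log_prod3 s"] by simp
      finally show "norm (exp (log_prod3 s)) \<le> exp M" .
      have "q \<le> 1 - 2 powr (- Re s)" unfolding q_def using s c by (intro diff_left_mono powr_mono) auto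
      also have "\<dots> \<le> norm (1 - 2 powr (-s))" using norm_triangle_ineq2[of 1 "2 powr (-s)"] by (simp add: two_powr_minus_norm)
      finally show "q \<le> norm (1 - 2 powr (-s))" .
    qed (use q in auto)
    finally have 1: "norm (z / csqrt (s - 1)) ^ 2 \<le> C1 * norm (Zreg s / (s - 1))" by (simp add: mult.commute)
    have "C1 * norm (Zreg s / (s - 1)) \<le> C * norm (Zreg s / (s - 1))" unfolding C_def by (intro mult_right_mono) auto
    with 1 have c1: "norm (z / csqrt (s - 1)) ^ 2 \<le> C * norm (Zreg s / (s - 1))" by simp
    define v where "v = norm s powr (3/4)"
    have ns: "norm s \<ge> 1/2" using abs_Re_le_cmod[of s] s c by simp
    have v: "v \<ge> 1/2"
    proof (cases "norm s \<le> 1")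
      case True
      have "norm s powr 1 \<le> v" unfolding v_def using True ns by (intro powr_mono') auto
      thus ?thesis using ns by simp
    next
      case False
      hence "1 \<le> v" unfolding v_def by (intro ge_one_powr_ge_zero) auto
      thus ?thesis by simp
    qed
    have "norm (zeta_reg s / (s - 1)) \<le> (1 + A * norm (s - 1) * v) / norm (s - 1)"
      unfolding norm_divide v_def using A(2)[of s] s c by (intro divide_right_mono) auto
    also have "\<dots> = 1 / norm (s - 1) + A * v"
    proof -
      have "norm (s - 1) \<noteq> 0" using s(3) \<delta> by linarith
      thus ?thesis by (simp add: add_divide_distrib)
    qed
    also have "\<dots> \<le> 1 / \<delta> + A * v" using s \<delta> by (intro add_right_mono frac_le) auto
    also have "1 / \<delta> \<le> 2 / \<delta> * v" using v \<delta> by (simp add: field_simps)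
    finally have z1: "norm (zeta_reg s / (s - 1)) \<le> (2 / \<delta> + A) * v" by (simp add: algebra_simps)
    have "norm (Zreg s / (s - 1)) = norm (zeta_reg s / (s - 1)) * norm (L_chi4 s)" by (simp add: Zreg_def norm_mult norm_divide)
    also have "\<dots> \<le> ((2 / \<delta> + A) * v) * (D * v)"
      using z1 D(2)[of s] s c A \<delta> v by (intro mult_mono) (auto simp: v_def)
    finally have "C1 * norm (Zreg s / (s - 1)) \<le> C1 * (((2 / \<delta> + A) * v) * (D * v))" using C1 by (intro mult_left_mono) auto
    also have "\<dots> = C1 * ((2 / \<delta> + A) * D) * v^2" by (simp add: power2_eq_square)
    also have "v \<le> 2 * (1 + \<bar>Im s\<bar>) powr (3/4)"
    proof -
      have "norm s \<le> 2 * (1 + \<bar>Im s\<bar>)" using cmod_le[of s] s c by simp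
      hence "v \<le> (2 * (1 + \<bar>Im s\<bar>)) powr (3/4)" unfolding v_def by (intro powr_mono2) auto
      also have "\<dots> = 2 powr (3/4) * (1 + \<bar>Im s\<bar>) powr (3/4)" by (rule powr_mult)
      also have "\<dots> \<le> 2 * (1 + \<bar>Im s\<bar>) powr (3/4)" using powr_mono[of "3/4" 1 "2::real"] by (intro mult_right_mono) auto
      finally show ?thesis .
    qed
    hence "C1 * ((2 / \<delta> + A) * D) * v^2 \<le> C1 * ((2 / \<delta> + A) * D) * (2 * (1 + \<bar>Im s\<bar>) powr (3/4))^2"
      using C1 A D \<delta> v by (intro mult_left_mono power_mono) auto
    also have "\<dots> = (sqrt C2 * (1 + \<bar>Im s\<bar>) powr (3/4))^2"
      using C2 by (simp add: C2_def power_mult_distrib)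
    finally have "norm (z / csqrt (s - 1)) ^ 2 \<le> (sqrt C2 * (1 + \<bar>Im s\<bar>) powr (3/4))^2" using 1 by simp
    hence "norm (z / csqrt (s - 1)) \<le> sqrt C2 * (1 + \<bar>Im s\<bar>) powr (3/4)"
      by (rule power2_le_imp_le) (use C2 in simp)
    also have "\<dots> \<le> C * (1 + \<bar>Im s\<bar>) powr (3/4)" unfolding C_def by (intro mult_right_mono) auto
    finally show ?thesis using c1 by blast
  qed
  moreover have "C > 0" using C1 by (simp add: C_def less_max_iff_disj)
  ultimately show ?thesis by blast
qed

text \<open>Collects the errors: h + 1 from smoothing, B from the contour, 2 C h from replacing the
  kernel by x^\<sigma>/\<sigma>, and the last term from moving the lower end from a to 1/2 +
  \<epsilon>.\<close>

lemma countE_mainterm_bound: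
  assumes \<epsilon>: "0 < \<epsilon>" "\<epsilon> < 1/2" and c: "c > 1/2" "c \<le> 1/2 + \<epsilon>" and C: "\<And>\<sigma>. \<sigma> \<in> {c..1} \<Longrightarrow> \<bar>G \<sigma>\<bar> \<le> C"
    and a: "c \<le> a" "a \<le> 1" and x: "x \<ge> 1" and h: "h > 0"
    and I: "((\<lambda>\<sigma>. G \<sigma> * smooth_kernel_real x h \<sigma> / sqrt (1 - \<sigma>)) has_integral I) {a..1}"
    and B: "\<bar>smooth_count x h - I / pi\<bar> \<le> B"
  shows "\<bar>countE x - mainterm \<epsilon> x\<bar> \<le> (h + 1) + B + (2 * C * h + 4 * C * x powr max a (1/2 + \<epsilon>))"
proof -
  define d where "d = 1/2 + \<epsilon>"
  have d: "c \<le> d" "d \<le> 1" using c \<epsilon> by (auto simp: d_def)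
  have "\<bar>main_integral a x - main_integral d x\<bar> \<le> 4 * C * x powr max a d"
  proof (cases "a \<le> d")
    case True
    thus ?thesis using main_integral_diff[OF c(1) C a(1) True d(2) x] by (simp add: max_def)
  next
    case False
    thus ?thesis using main_integral_diff[OF c(1) C d(1) _ a(2) x] by (simp add: max_def abs_minus_commute)
  qed
  hence 1: "\<bar>I - main_integral d x\<bar> \<le> 2 * C * h + 4 * C * x powr max a d"
    using smooth_integral_diff[OF c(1) C a x h I] by linarith
  have "mainterm \<epsilon> x = main_integral d x / pi" unfolding d_def by (rule mainterm_eq[OF \<epsilon>(1)])
  hence "\<bar>I / pi - mainterm \<epsilon> x\<bar> = \<bar>I - main_integral d x\<bar> / pi"
    by (simp add: abs_divide flip: diff_divide_distrib)
  also have "\<dots> \<le> \<bar>I - main_integral d x\<bar> / 1" using pi_ge_two by (intro divide_left_mono) auto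
  finally have "\<bar>I / pi - mainterm \<epsilon> x\<bar> \<le> 2 * C * h + 4 * C * x powr max a d" using 1 by simp
  thus ?thesis using smooth_count_near_countE[OF x h] B unfolding d_def by linarith
qed

section \<open>Error terms\<close>

text \<open>Supplies the majorant of \<open>smooth_count_contour\<close> when the integrand decays
  like (1 + t)^(-1 - \<delta>); its total increase is at most D/\<delta>.\<close>

lemma power_majorant:
  fixes D \<delta> :: real
  assumes "\<delta> > 0" "D \<ge> 0"
  defines "\<psi> \<equiv> \<lambda>t. - (D / \<delta>) * (1 + t) powr (-\<delta>)"
  shows "continuous_on {0..} \<psi>" "t > 0 \<Longrightarrow> (\<psi> has_real_derivative D * (1 + t) powr (-1 - \<delta>)) (at t)"
    "t \<ge> 0 \<Longrightarrow> \<psi> t - \<psi> 0 \<le> D / \<delta>"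
proof -
  show "continuous_on {0..} \<psi>" unfolding \<psi>_def by (intro continuous_intros) auto
  show "(\<psi> has_real_derivative D * (1 + t) powr (-1 - \<delta>)) (at t)" if "t > 0"
  proof -
    have "((\<lambda>t. (1 + t) powr (-\<delta>)) has_real_derivative (-\<delta>) * (1 + t) powr (-\<delta> - 1)) (at t)"
      using that by (auto intro!: derivative_eq_intros simp: powr_diff)
    hence "(\<psi> has_real_derivative - (D / \<delta>) * ((-\<delta>) * (1 + t) powr (-\<delta> - 1))) (at t)"
      unfolding \<psi>_def by (rule DERIV_cmult)
    moreover have "- (D / \<delta>) * ((-\<delta>) * (1 + t) powr (-\<delta> - 1)) = D * (1 + t) powr (-1 - \<delta>)"
    proof -
      have e: "-\<delta> - 1 = -1 - \<delta>" by simp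
      show ?thesis unfolding e using assms(1) by simp
    qed
    ultimately show ?thesis by simp
  qed
  show "\<psi> t - \<psi> 0 \<le> D / \<delta>" if "t \<ge> 0" unfolding \<psi>_def using assms by simp
qed

lemma tendsto_power_majorant: "((\<lambda>T::real. K * (1 + T) powr (-5/4)) \<longlongrightarrow> 0) at_top"
proof -
  have "((\<lambda>T::real. (1 + T) powr (-5/4)) \<longlongrightarrow> 0) at_top"
    by (intro tendsto_neg_powr filterlim_tendsto_add_at_top[OF tendsto_const filterlim_ident]) auto
  from tendsto_mult_right_zero[OF this] show ?thesis .
qed

lemma F_kernel_bound:
  assumes x: "x > 0" and h: "h > 0" and s: "Re s \<ge> 1/2" and F: "norm (z / csqrt (s - 1)) \<le> C * (1 + \<bar>Im s\<bar>) powr (3/4)"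
    and X: "(x + h) powr (Re s + 1) \<le> X" and C: "C \<ge> 0"
  shows "norm (z * smooth_kernel x h s / csqrt (s - 1)) \<le> 18 * C * X / h * (1 + \<bar>Im s\<bar>) powr (-5/4)"
proof -
  define u where "u = 1 + \<bar>Im s\<bar>"
  have u: "u > 0" by (simp add: u_def)
  have "norm (smooth_kernel x h s) \<le> 18 * (x + h) powr (Re s + 1) / (h * u^2)"
    using norm_smooth_kernel_le'[OF x h s] by (simp add: u_def)
  also have "\<dots> \<le> 18 * X / (h * u^2)" using X h by (intro divide_right_mono) auto
  finally have k: "norm (smooth_kernel x h s) \<le> 18 * X / (h * u^2)" .
  have "norm (z * smooth_kernel x h s / csqrt (s - 1)) = norm (z / csqrt (s - 1)) * norm (smooth_kernel x h s)"
    by (simp add: norm_mult norm_divide)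
  also have "\<dots> \<le> (C * u powr (3/4)) * (18 * X / (h * u^2))"
    using F k C u by (intro mult_mono) (auto simp: u_def)
  also have "\<dots> = 18 * C * X / h * (u powr (3/4) / u^2)" by simp
  also have "u powr (3/4) / u^2 = u powr (-5/4)"
  proof -
    have "u^2 = u powr 2" using u by simp
    thus ?thesis by (simp flip: powr_diff)
  qed
  finally show ?thesis by (simp add: u_def)
qed

text \<open>By the inequality of arithmetic and geometric means c L / l + l / 8 \<ge> sqrt (c L /
  2), where l = ln (4 + 2 \<tau>). With L = ln x it turns the saving x^(-c/l), which weakens with
  the height, into a uniform one at the cost of \<tau>^(1/8), and so stands in for optimising a
  truncation height.\<close>

lemma zero_free_tradeoff:
  assumes "c > 0" "L \<ge> 0" "\<tau> \<ge> 0"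
  shows "exp (- (c / ln (4 + 2 * \<tau>)) * L) \<le> 2 * exp (- sqrt (c / 2) * sqrt L) * (1 + \<tau>) powr (1/8)"
proof -
  define l where "l = ln (4 + 2 * \<tau>)"
  have l: "l > 0" unfolding l_def using assms by (intro ln_gt_zero) auto
  have "0 \<le> (sqrt (c * L / l) - sqrt (l / 8))^2" by simp
  also have "\<dots> = c * L / l + l / 8 - 2 * (sqrt (c * L / l) * sqrt (l / 8))"
    using assms l by (simp add: power2_diff)
  also have "sqrt (c * L / l) * sqrt (l / 8) = sqrt (c * L / 8)" using l by (simp flip: real_sqrt_mult)
  also have "2 * sqrt (c * L / 8) = sqrt 4 * sqrt (c * L / 8)" by simp
  also have "\<dots> = sqrt (4 * (c * L / 8))" by (rule real_sqrt_mult[symmetric])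
  also have "4 * (c * L / 8) = c / 2 * L" by simp
  also have "sqrt (c / 2 * L) = sqrt (c / 2) * sqrt L" by (rule real_sqrt_mult)
  finally have "- (c / l) * L \<le> l / 8 - sqrt (c / 2) * sqrt L" by simp
  hence "exp (- (c / l) * L) \<le> exp (l / 8 - sqrt (c / 2) * sqrt L)" by simp
  also have "\<dots> = exp (l / 8) * exp (- sqrt (c / 2) * sqrt L)" by (simp flip: exp_add)
  finally have 1: "exp (- (c / l) * L) \<le> exp (l / 8) * exp (- sqrt (c / 2) * sqrt L)" .
  have "exp (l / 8) = (4 + 2 * \<tau>) powr (1/8)" using assms by (simp add: powr_def l_def)
  also have "\<dots> \<le> (4 * (1 + \<tau>)) powr (1/8)" using assms by (intro powr_mono2) auto
  also have "\<dots> = 4 powr (1/8) * (1 + \<tau>) powr (1/8)" by (rule powr_mult)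
  also have "\<dots> \<le> 2 * (1 + \<tau>) powr (1/8)"
    using powr_mono[of "1/8" "1/2" "4::real"] by (intro mult_right_mono) (auto simp: powr_half_sqrt)
  finally have "exp (l / 8) * exp (- sqrt (c / 2) * sqrt L) \<le> 2 * (1 + \<tau>) powr (1/8) * exp (- sqrt (c / 2) * sqrt L)"
    by (rule mult_right_mono) simp
  with 1 have "exp (- (c / l) * L) \<le> 2 * (1 + \<tau>) powr (1/8) * exp (- sqrt (c / 2) * sqrt L)" by (rule order_trans)
  thus ?thesis by (simp only: l_def mult_ac)
qed

text \<open>The contour is the boundary curve of a zero-free region of half the width. The exponents
  of 1 + |t| add up to 3/4 - 2 + 1/8 = -1 - 1/8, so the integral converges.\<close>

lemma countE_unconditional:
  assumes \<epsilon>: "0 < \<epsilon>" "\<epsilon> < 1/2"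
  shows "\<exists>\<kappa>>0. \<exists>K m. m < 1 \<and> (\<forall>x\<ge>1. \<bar>countE x - mainterm \<epsilon> x\<bar> \<le> K * (x * exp (- \<kappa> * sqrt (ln x))) + 1 + K * x powr m)"
proof -
  obtain c0 where c0: "c0 > 0" "c0 \<le> 1/8" "\<And>s. Re s > 1 - c0 / ln (4 + 2 * \<bar>Im s\<bar>) \<Longrightarrow> Zreg s \<noteq> 0"
    using Zreg_zero_free_region by blast
  define \<Omega> where "\<Omega> = {s. Re s > 1 - c0 / ln (4 + 2 * \<bar>Im s\<bar>)}"
  have ln1: "ln (4 + 2 * t) \<ge> 1" if "t \<ge> 0" for t :: real
  proof -
    have "exp 1 \<le> 4 + 2 * t" using exp_le that by simp
    thus ?thesis using that by (subst ln_ge_iff) auto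
  qed
  have star: "closed_segment 1 s \<subseteq> \<Omega>" if s: "s \<in> \<Omega>" for s
  proof
    fix z assume "z \<in> closed_segment 1 s"
    then obtain u where u: "0 \<le> u" "u \<le> 1" "z = (1 - u) *\<^sub>R 1 + u *\<^sub>R s" by (auto simp: in_segment)
    have Rz: "Re z = 1 - u * (1 - Re s)" "\<bar>Im z\<bar> = u * \<bar>Im s\<bar>" using u(1) unfolding u(3) by (simp_all add: algebra_simps abs_mult)
    have uI: "u * \<bar>Im s\<bar> \<le> \<bar>Im s\<bar>" "u * \<bar>Im s\<bar> \<ge> 0" using u by (auto simp: mult_left_le_one_le)
    have pos: "c0 / ln (4 + 2 * \<bar>Im z\<bar>) > 0" using ln1[of "\<bar>Im z\<bar>"] c0 by simp
    have "u * (1 - Re s) < c0 / ln (4 + 2 * \<bar>Im z\<bar>)"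
    proof (cases "Re s \<ge> 1")
      case True
      hence "u * (1 - Re s) \<le> 0" using u by (simp add: mult_nonneg_nonpos)
      thus ?thesis using pos by simp
    next
      case False
      have "u * (1 - Re s) \<le> 1 - Re s" using u False by (simp add: mult_left_le_one_le)
      also have "\<dots> < c0 / ln (4 + 2 * \<bar>Im s\<bar>)" using s by (simp add: \<Omega>_def)
      also have "\<dots> \<le> c0 / ln (4 + 2 * \<bar>Im z\<bar>)"
        using c0 ln1[of "\<bar>Im z\<bar>"] ln1[of "\<bar>Im s\<bar>"] uI unfolding Rz
        by (intro divide_left_mono mult_pos_pos) (auto intro!: ln_mono)
      finally show ?thesis .
    qed
    thus "z \<in> \<Omega>" by (simp add: \<Omega>_def Rz)
  qed
  have op: "open \<Omega>" unfolding \<Omega>_def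
  proof (intro open_Collect_less continuous_intros)
    show "\<forall>s\<in>UNIV. 4 + 2 * \<bar>Im s\<bar> \<noteq> 0" by auto
    show "\<forall>s\<in>UNIV. ln (4 + 2 * \<bar>Im s\<bar>) \<noteq> 0" using ln1 by (smt (verit) abs_ge_zero)
  qed
  have half: "{s. Re s > 1} \<subseteq> \<Omega>" "\<Omega> \<subseteq> {s. Re s > 1/2}"
  proof -
    have "c0 / ln (4 + 2 * \<bar>Im s\<bar>) > 0" "c0 / ln (4 + 2 * \<bar>Im s\<bar>) \<le> 1/8" for s
    proof -
      have l: "ln (4 + 2 * \<bar>Im s\<bar>) \<ge> 1" by (rule ln1) simp
      show "c0 / ln (4 + 2 * \<bar>Im s\<bar>) > 0" using l c0 by simp
      have "c0 / ln (4 + 2 * \<bar>Im s\<bar>) \<le> c0 / 1" using l c0 by (intro divide_left_mono) auto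
      thus "c0 / ln (4 + 2 * \<bar>Im s\<bar>) \<le> 1/8" using c0(2) by linarith
    qed
    note * = this
    show "{s. Re s > 1} \<subseteq> \<Omega>"
    proof
      fix s :: complex assume "s \<in> {s. Re s > 1}"
      thus "s \<in> \<Omega>" using *(1)[of s] by (simp add: \<Omega>_def)
    qed
    show "\<Omega> \<subseteq> {s. Re s > 1/2}"
    proof
      fix s :: complex assume "s \<in> \<Omega>"
      hence "Re s > 1 - c0 / ln (4 + 2 * \<bar>Im s\<bar>)" by (simp add: \<Omega>_def)
      hence "Re s > 1/2" using *(2)[of s] by linarith
      thus "s \<in> {s. Re s > 1/2}" by simp
    qed
  qed
  obtain Gh where Gh: "Gh holomorphic_on \<Omega>"
    "\<And>s. s \<in> \<Omega> \<Longrightarrow> Gh s ^ 2 = Zreg s * exp (log_prod3 s) / (1 - 2 powr (-s))"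
    "\<And>\<sigma>. of_real \<sigma> \<in> \<Omega> \<Longrightarrow> \<sigma> \<le> 1 \<Longrightarrow> Gh (of_real \<sigma>) = of_real (G \<sigma>)"
    "\<And>s. Re s > 1 \<Longrightarrow> E_sum s = Gh s / csqrt (s - 1)"
    using exists_holomorphic_G[OF star op half] c0(3) unfolding \<Omega>_def by blast
  \<comment> \<open>Half the width keeps the contour strictly inside the open region
    \<Omega>.\<close>
  define c where "c = c0 / 2"
  have c: "c > 0" "c \<le> 1/16" "c < c0" using c0 by (auto simp: c_def)
  define b where "b = (\<lambda>t::real. 1 - c / ln (4 + 2 * t))"
  define b' where "b' = (\<lambda>t::real. c * (2 / (4 + 2 * t)) / (ln (4 + 2 * t))^2)"
  have cl: "c / ln (4 + 2 * t) \<le> c" "c / ln (4 + 2 * t) > 0" if "t \<ge> 0" for t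
  proof -
    have "c / ln (4 + 2 * t) \<le> c / 1" using ln1[OF that] c by (intro divide_left_mono) auto
    thus "c / ln (4 + 2 * t) \<le> c" by simp
    show "c / ln (4 + 2 * t) > 0" using ln1[OF that] c by simp
  qed
  have b78: "b t \<ge> 7/8" "b t < 1" if "t \<ge> 0" for t using cl[OF that] c by (auto simp: b_def)
  have b_deriv: "(b has_real_derivative b' t) (at t)" if "t > 0" for t
    unfolding b_def b'_def using that ln1[of t]
    by (auto intro!: derivative_eq_intros simp: power2_eq_square)
  have b'_bound: "\<bar>b' t\<bar> \<le> 1" if "t \<ge> 0" for t
  proof -
    have "2 / (4 + 2 * t) \<le> 1" using that by simp
    moreover have "(ln (4 + 2 * t))^2 \<ge> 1" using ln1[OF that] by (simp add: one_le_power)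
    ultimately have "c * (2 / (4 + 2 * t)) / (ln (4 + 2 * t))^2 \<le> (1 * 1) / 1"
      using c that by (intro frac_le mult_mono) auto
    thus ?thesis using c that by (simp add: b'_def abs_mult)
  qed
  have b_mem: "Complex \<sigma> t \<in> \<Omega>" if "b \<bar>t\<bar> \<le> \<sigma>" for t \<sigma>
  proof -
    have "c / ln (4 + 2 * \<bar>t\<bar>) < c0 / ln (4 + 2 * \<bar>t\<bar>)" using c ln1[of "\<bar>t\<bar>"] by (intro divide_strict_right_mono) auto
    thus ?thesis using that by (simp add: \<Omega>_def b_def)
  qed
  \<comment> \<open>A lower bound for the distance of the contour from 1: at heights |t| < 1 the
    horizontal offset is at least c / ln 6, and for |t| \<ge> 1 the imaginary part alone is at least
    1.\<close>
  define \<delta> where "\<delta> = min 1 (c / ln 6)"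
  have \<delta>: "\<delta> > 0" using c by (simp add: \<delta>_def)
  have dist1: "norm (Complex (b \<bar>t\<bar>) t - 1) \<ge> \<delta>" for t
  proof (cases "\<bar>t\<bar> \<ge> 1")
    case True
    thus ?thesis using abs_Im_le_cmod[of "Complex (b \<bar>t\<bar>) t - 1"] by (simp add: \<delta>_def)
  next
    case False
    have "c / ln 6 \<le> c / ln (4 + 2 * \<bar>t\<bar>)"
      using False c ln1[of "\<bar>t\<bar>"] by (intro divide_left_mono mult_pos_pos) auto
    also have "\<dots> = \<bar>Re (Complex (b \<bar>t\<bar>) t - 1)\<bar>" using cl(2)[of "\<bar>t\<bar>"] c(1) by (simp add: b_def)
    also have "\<dots> \<le> norm (Complex (b \<bar>t\<bar>) t - 1)" by (rule abs_Re_le_cmod)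
    finally show ?thesis by (simp add: \<delta>_def)
  qed
  obtain C where C: "C > 0" "\<And>s z. Re s \<ge> 7/8 \<Longrightarrow> Re s \<le> 2 \<Longrightarrow> norm (s - 1) \<ge> \<delta> \<Longrightarrow>
     z ^ 2 = Zreg s * exp (log_prod3 s) / (1 - 2 powr (-s)) \<Longrightarrow> norm (z / csqrt (s - 1)) \<le> C * (1 + \<bar>Im s\<bar>) powr (3/4)"
    using F_bound[of "7/8" \<delta>] \<delta> by auto
  \<comment> \<open>A common point to the left of both lower ends, b 0 \<ge> 7/8 and 1/2 +
    \<epsilon>, so that one bound for \<open>G\<close> serves both.\<close>
  define cc where "cc = min (7/8) (1/2 + \<epsilon>)"
  have cc: "cc > 1/2" "cc \<le> 7/8" "cc \<le> 1/2 + \<epsilon>" using \<epsilon> by (auto simp: cc_def min_def)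
  obtain CG where CG: "\<And>\<sigma>. \<sigma> \<in> {cc..1} \<Longrightarrow> \<bar>G \<sigma>\<bar> \<le> CG" using G_bounded[OF cc(1)] by blast
  have "1 \<in> {cc..1}" using cc by auto
  from CG[OF this] have CG0: "CG \<ge> 0" by simp
  define k where "k = sqrt (c / 2)"
  \<comment> \<open>Balances the smoothing error h against the contour error x^2 exp (-k sqrt L) /
    h: with this \<kappa> the latter equals h.\<close>
  define \<kappa> where "\<kappa> = k / 2"
  have \<kappa>: "\<kappa> > 0" using c by (simp add: \<kappa>_def k_def)
  define m where "m = max (b 0) (1/2 + \<epsilon>)"
  have m: "m < 1" using b78[of 0] \<epsilon> by (simp add: m_def)
  define K where "K = 1 + 2304 * C + 4 * CG"
  have "\<bar>countE x - mainterm \<epsilon> x\<bar> \<le> K * (x * exp (- \<kappa> * sqrt (ln x))) + 1 + K * x powr m" if x: "x \<ge> 1" for x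
  proof -
    define L where "L = ln x"
    have L: "L \<ge> 0" using x by (simp add: L_def)
    define h where "h = x * exp (- \<kappa> * sqrt L)"
    have h: "h > 0" using x by (simp add: h_def)
    have "exp (- \<kappa> * sqrt L) \<le> 1" using \<kappa> L by simp
    hence hx: "h \<le> x" unfolding h_def using x by (simp add: mult_left_le)
    \<comment> \<open>288 = 18 * 4 * 2 * 2: the kernel constant, (x + h)^(b+1) \<le> 4 x^(b+1), the
      constant of \<open>zero_free_tradeoff\<close>, and |b'| + 1 \<le> 2. Division by the exponent
      1/8 later gives 2304.\<close>
    define D where "D = 288 * C * x^2 / h * exp (- k * sqrt L)"
    have D: "D \<ge> 0" using C h by (simp add: D_def)
    have Dh: "D = 288 * C * h"
    proof -
      have "exp (- k * sqrt L) = exp (- \<kappa> * sqrt L) * exp (- \<kappa> * sqrt L)" by (simp add: \<kappa>_def flip: exp_add)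
      thus ?thesis using x by (simp add: D_def h_def power2_eq_square)
    qed
    define H where "H = (\<lambda>T. 18 * C * (x + h)^3 / h * (1 + T) powr (-5/4))"
    have "\<exists>I. ((\<lambda>\<sigma>. G \<sigma> * smooth_kernel_real x h \<sigma> / sqrt (1 - \<sigma>)) has_integral I) {b 0..1}
           \<and> \<bar>smooth_count x h - I / pi\<bar> \<le> D / (1/8)"
    proof (rule smooth_count_contour[where \<Omega> = \<Omega> and Gh = Gh and b = b and b' = b' and H = H
          and \<psi> = "\<lambda>t. - (D / (1/8)) * (1 + t) powr (-(1/8))" and \<psi>' = "\<lambda>t. D * (1 + t) powr (-1 - 1/8)"])
      show "continuous_on {0..} b" unfolding b_def
      proof (intro continuous_intros ballI)
        fix t :: real assume t: "t \<in> {0..}"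
        thus "4 + 2 * t \<noteq> 0" by simp
        show "ln (4 + 2 * t) \<noteq> 0" using ln1[of t] t by force
      qed
      show "continuous_on {0..} (\<lambda>t. - (D / (1/8)) * (1 + t) powr (-(1/8)))" using D by (intro power_majorant(1)) auto
      show "((\<lambda>t. - (D / (1/8)) * (1 + t) powr (-(1/8))) has_real_derivative D * (1 + t) powr (-1 - 1/8)) (at t)" if "t > 0" for t
        using D that by (intro power_majorant(2)) auto
      show "- (D / (1/8)) * (1 + t) powr (-(1/8)) - - (D / (1/8)) * (1 + 0) powr (-(1/8)) \<le> D / (1/8)" if "t \<ge> 0" for t
        using D that by (intro power_majorant(3)) auto
      show "(H \<longlongrightarrow> 0) at_top" unfolding H_def by (rule tendsto_power_majorant)
      show "norm (Gh (Complex \<sigma> t) * smooth_kernel x h (Complex \<sigma> t) / csqrt (Complex \<sigma> t - 1)) \<le> H \<bar>t\<bar>"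
        if t: "\<bar>t\<bar> \<ge> 1" and \<sigma>: "b \<bar>t\<bar> \<le> \<sigma>" "\<sigma> \<le> 2" for \<sigma> t
      proof -
        have s: "\<sigma> \<ge> 7/8" using b78[of "\<bar>t\<bar>"] \<sigma> by simp
        have "norm (Complex \<sigma> t - 1) \<ge> \<delta>" using abs_Im_le_cmod[of "Complex \<sigma> t - 1"] t by (simp add: \<delta>_def)
        hence F: "norm (Gh (Complex \<sigma> t) / csqrt (Complex \<sigma> t - 1)) \<le> C * (1 + \<bar>Im (Complex \<sigma> t)\<bar>) powr (3/4)"
          using s \<sigma> by (intro C(2) Gh(2) b_mem) auto
        have "(x + h) powr (Re (Complex \<sigma> t) + 1) \<le> (x + h) powr 3" using x h \<sigma> by (intro powr_mono) auto
        hence "(x + h) powr (Re (Complex \<sigma> t) + 1) \<le> (x + h)^3" using x h by simp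
        from F_kernel_bound[OF _ h _ F this] show ?thesis using s x C by (simp add: H_def)
      qed
      show "norm (Gh (Complex (b \<bar>t\<bar>) t) * smooth_kernel x h (Complex (b \<bar>t\<bar>) t) / csqrt (Complex (b \<bar>t\<bar>) t - 1)) * (\<bar>b' \<bar>t\<bar>\<bar> + 1)
          \<le> D * (1 + \<bar>t\<bar>) powr (-1 - 1/8)" for t
      proof -
        define \<tau> where "\<tau> = \<bar>t\<bar>"
        have \<tau>: "\<tau> \<ge> 0" by (simp add: \<tau>_def)
        define s where "s = Complex (b \<tau>) t"
        have sb: "Re s = b \<tau>" "Im s = t" "b \<tau> \<ge> 7/8" "b \<tau> < 1" using b78[OF \<tau>] by (auto simp: s_def)
        define E where "E = exp (- k * sqrt L)"
        have F: "norm (Gh s / csqrt (s - 1)) \<le> C * (1 + \<bar>Im s\<bar>) powr (3/4)"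
          using sb dist1[of t] by (intro C(2) Gh(2)) (auto simp: s_def \<tau>_def intro!: b_mem)
        have "(x + h) powr (b \<tau> + 1) \<le> (2 * x) powr (b \<tau> + 1)" using hx x h sb by (intro powr_mono2) auto
        also have "\<dots> = 2 powr (b \<tau> + 1) * x powr (b \<tau> + 1)" by (rule powr_mult)
        also have "\<dots> \<le> 4 * x powr (b \<tau> + 1)"
        proof (rule mult_right_mono)
          have "(2::real) powr (b \<tau> + 1) \<le> 2 powr 2" using sb by (intro powr_mono) auto
          thus "(2::real) powr (b \<tau> + 1) \<le> 4" by simp
        qed simp
        also have "x powr (b \<tau> + 1) = x^2 * exp (- (c / ln (4 + 2 * \<tau>)) * L)"
        proof -
          have "x powr (b \<tau> + 1) = exp (2 * L + - (c / ln (4 + 2 * \<tau>)) * L)"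
            using x by (simp add: powr_def b_def L_def algebra_simps)
          also have "\<dots> = exp (2 * L) * exp (- (c / ln (4 + 2 * \<tau>)) * L)" by (rule exp_add)
          also have "exp (2 * L) = x^2" using x by (simp add: L_def exp_double)
          finally show ?thesis .
        qed
        finally have X0: "(x + h) powr (Re s + 1) \<le> 4 * (x^2 * exp (- (c / ln (4 + 2 * \<tau>)) * L))" using sb(1) by (simp only:)
        have "exp (- (c / ln (4 + 2 * \<tau>)) * L) \<le> 2 * E * (1 + \<tau>) powr (1/8)"
          unfolding E_def k_def by (rule zero_free_tradeoff[OF c(1) L \<tau>])
        hence "4 * (x^2 * exp (- (c / ln (4 + 2 * \<tau>)) * L)) \<le> 4 * (x^2 * (2 * E * (1 + \<tau>) powr (1/8)))"
          by (intro mult_left_mono) auto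
        with X0 have X: "(x + h) powr (Re s + 1) \<le> 4 * (x^2 * (2 * E * (1 + \<tau>) powr (1/8)))" by (rule order_trans)
        have "norm (Gh s * smooth_kernel x h s / csqrt (s - 1)) \<le> 18 * C * (4 * (x^2 * (2 * E * (1 + \<tau>) powr (1/8)))) / h * (1 + \<bar>Im s\<bar>) powr (-5/4)"
          using sb x C by (intro F_kernel_bound[OF _ h _ F X]) auto
        also have "\<dots> = 144 * C * x^2 / h * E * ((1 + \<tau>) powr (1/8) * (1 + \<tau>) powr (-5/4))" using sb by (simp add: \<tau>_def)
        also have "(1 + \<tau>) powr (1/8) * (1 + \<tau>) powr (-5/4) = (1 + \<tau>) powr (-1 - 1/8)" by (simp flip: powr_add)
        finally have "norm (Gh s * smooth_kernel x h s / csqrt (s - 1)) * (\<bar>b' \<tau>\<bar> + 1) \<le> 144 * C * x^2 / h * E * (1 + \<tau>) powr (-1 - 1/8) * 2"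
          using b'_bound[OF \<tau>] by (intro mult_mono) (use C h in \<open>auto simp: E_def\<close>)
        thus ?thesis by (simp add: D_def E_def s_def \<tau>_def)
      qed
    qed (use star op half Gh x h b_deriv b78 b_mem in auto)
    then obtain I where I: "((\<lambda>\<sigma>. G \<sigma> * smooth_kernel_real x h \<sigma> / sqrt (1 - \<sigma>)) has_integral I) {b 0..1}"
        "\<bar>smooth_count x h - I / pi\<bar> \<le> D / (1/8)" by blast
    have "\<bar>countE x - mainterm \<epsilon> x\<bar> \<le> (h + 1) + D / (1/8) + (2 * CG * h + 4 * CG * x powr m)"
      unfolding m_def
      by (rule countE_mainterm_bound[OF \<epsilon> cc(1,3) CG _ _ x h I]) (use b78[of 0] cc in auto)
    also have "\<dots> = (1 + 2304 * C + 2 * CG) * h + 1 + 4 * CG * x powr m" unfolding Dh by (simp add: algebra_simps)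
    also have "\<dots> \<le> K * h + 1 + K * x powr m"
      using h C CG0 by (intro add_mono mult_right_mono) (auto simp: K_def)
    finally show ?thesis by (simp add: h_def L_def)
  qed
  thus ?thesis using \<kappa> m by blast
qed

text \<open>On the line Re s = 1/2 + \<epsilon>/2 the interpolated kernel with exponent \<epsilon>
  costs (x/h)^\<epsilon>, of order x^(\<epsilon>/2), which gives x^(1/2 + \<epsilon>) in total. Its
  decay |t|^(-1 - \<epsilon>) against F of order |t|^(\<epsilon>/2) leaves an integrable
  power.\<close>

lemma countE_under_RH:
  assumes \<epsilon>: "0 < \<epsilon>" "\<epsilon> < 1/2" and RH: "RH_zeta_L4"
  shows "\<exists>K. \<forall>x\<ge>1. \<bar>countE x - mainterm \<epsilon> x\<bar> \<le> K * x powr (1/2 + \<epsilon>)"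
proof -
  define \<Omega> where "\<Omega> = {s. Re s > 1/2}"
  have convex: "convex \<Omega>" unfolding \<Omega>_def by (rule convex_halfspace_Re_gt)
  have star: "closed_segment 1 s \<subseteq> \<Omega>" if "s \<in> \<Omega>" for s
    using that by (intro closed_segment_subset convex) (auto simp: \<Omega>_def)
  have op: "open \<Omega>" unfolding \<Omega>_def by (rule open_halfspace_Re_gt)
  have half: "{s. Re s > 1} \<subseteq> \<Omega>" "\<Omega> \<subseteq> {s. Re s > 1/2}" by (auto simp: \<Omega>_def)
  obtain Gh where Gh: "Gh holomorphic_on \<Omega>"
    "\<And>s. s \<in> \<Omega> \<Longrightarrow> Gh s ^ 2 = Zreg s * exp (log_prod3 s) / (1 - 2 powr (-s))"
    "\<And>\<sigma>. of_real \<sigma> \<in> \<Omega> \<Longrightarrow> \<sigma> \<le> 1 \<Longrightarrow> Gh (of_real \<sigma>) = of_real (G \<sigma>)"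
    "\<And>s. Re s > 1 \<Longrightarrow> E_sum s = Gh s / csqrt (s - 1)"
    using exists_holomorphic_G[OF star op half] RH_Zreg_nonzero[OF RH] unfolding \<Omega>_def by blast
  define a where "a = 1/2 + \<epsilon> / 2"
  have a: "1/2 < a" "a < 3/4" using \<epsilon> by (auto simp: a_def)
  define \<delta> where "\<delta> = \<epsilon> / 2"
  have \<delta>: "\<delta> > 0" "2 * \<delta> \<le> 1" "2 * \<delta> = \<epsilon>" using \<epsilon> by (auto simp: \<delta>_def)
  obtain C where C: "C > 0" "\<And>s z. Re s \<ge> a \<Longrightarrow> Re s \<le> 2 \<Longrightarrow> norm (s - 1) \<ge> 1/4 \<Longrightarrow>
     z ^ 2 = Zreg s * exp (log_prod3 s) / (1 - 2 powr (-s)) \<Longrightarrow>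
     norm (z / csqrt (s - 1)) ^ 2 \<le> C * norm (Zreg s / (s - 1)) \<and> norm (z / csqrt (s - 1)) \<le> C * (1 + \<bar>Im s\<bar>) powr (3/4)"
    using F_bound[of a "1/4"] a by auto
  obtain M where M: "M > 0" "\<And>s. a \<le> Re s \<Longrightarrow> Re s \<le> 2 \<Longrightarrow> \<bar>Im s\<bar> \<ge> 3 \<Longrightarrow> norm (Zreg s / (s - 1)) \<le> M * \<bar>Im s\<bar> powr (2 * \<delta>)"
    using RH_Zreg_bound[OF RH a(1), of "2 * \<delta>"] a \<delta> by auto
  \<comment> \<open>4 C handles |t| < 3, where (1 + |t|)^(3/4) \<le> 4, and sqrt (C M) the larger
    heights, where the bound under the Riemann hypothesis holds.\<close>
  define A where "A = max (4 * C) (sqrt (C * M))"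
  have A: "A > 0" using C by (simp add: A_def less_max_iff_disj)
  have F: "norm (Gh (Complex a t) / csqrt (Complex a t - 1)) \<le> A * (1 + \<bar>t\<bar>) powr \<delta>" for t
  proof -
    define s where "s = Complex a t"
    have s: "Re s = a" "Im s = t" "s \<in> \<Omega>" using a by (auto simp: s_def \<Omega>_def)
    have "norm (s - 1) \<ge> 1/4" using abs_Re_le_cmod[of "s - 1"] s a by simp
    with C(2)[of s "Gh s"] s a Gh(2)[OF s(3)]
    have F: "norm (Gh s / csqrt (s - 1)) ^ 2 \<le> C * norm (Zreg s / (s - 1))" "norm (Gh s / csqrt (s - 1)) \<le> C * (1 + \<bar>t\<bar>) powr (3/4)"
      by auto
    have one: "(1 + \<bar>t\<bar>) powr \<delta> \<ge> 1" using \<delta> by (intro ge_one_powr_ge_zero) auto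
    have "norm (Gh s / csqrt (s - 1)) \<le> A * (1 + \<bar>t\<bar>) powr \<delta>"
    proof (cases "\<bar>t\<bar> \<ge> 3")
      case True
      have "norm (Zreg s / (s - 1)) \<le> M * \<bar>t\<bar> powr (2 * \<delta>)" using M(2)[of s] s a True by simp
      hence "C * norm (Zreg s / (s - 1)) \<le> C * (M * \<bar>t\<bar> powr (2 * \<delta>))" using C(1) by (intro mult_left_mono) auto
      with F(1) have "norm (Gh s / csqrt (s - 1)) ^ 2 \<le> C * (M * \<bar>t\<bar> powr (2 * \<delta>))" by (rule order_trans)
      also have "\<dots> \<le> C * (M * (1 + \<bar>t\<bar>) powr (2 * \<delta>))" using C M \<delta> by (intro mult_left_mono powr_mono2) auto
      also have "(1 + \<bar>t\<bar>) powr (2 * \<delta>) = ((1 + \<bar>t\<bar>) powr \<delta>)^2" by (simp add: power2_eq_square flip: powr_add)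
      also have "C * (M * ((1 + \<bar>t\<bar>) powr \<delta>)^2) = (sqrt (C * M) * (1 + \<bar>t\<bar>) powr \<delta>)^2"
        using C M by (simp add: power_mult_distrib)
      finally have "norm (Gh s / csqrt (s - 1)) \<le> sqrt (C * M) * (1 + \<bar>t\<bar>) powr \<delta>"
        by (rule power2_le_imp_le) (use C M in simp)
      also have "\<dots> \<le> A * (1 + \<bar>t\<bar>) powr \<delta>" unfolding A_def by (intro mult_right_mono) auto
      finally show ?thesis .
    next
      case False
      have "(1 + \<bar>t\<bar>) powr (3/4) \<le> 4 powr (3/4)" using False by (intro powr_mono2) auto
      also have "\<dots> \<le> 4 powr 1" by (intro powr_mono) auto
      finally have "C * (1 + \<bar>t\<bar>) powr (3/4) \<le> C * 4" using C by (intro mult_left_mono) auto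
      hence "norm (Gh s / csqrt (s - 1)) \<le> A * 1" using F(2) by (simp add: A_def mult.commute)
      also have "\<dots> \<le> A * (1 + \<bar>t\<bar>) powr \<delta>" using A one by (intro mult_left_mono) auto
      finally show ?thesis .
    qed
    thus ?thesis by (simp add: s_def)
  qed
  obtain CG where CG: "\<And>\<sigma>. \<sigma> \<in> {a..1} \<Longrightarrow> \<bar>G \<sigma>\<bar> \<le> CG" using G_bounded[OF a(1)] by blast
  have "1 \<in> {a..1}" using a by auto
  from CG[OF this] have CG0: "CG \<ge> 0" by simp
  define K where "K = 2 + 72 * A / \<delta> + 6 * CG"
  have "\<bar>countE x - mainterm \<epsilon> x\<bar> \<le> K * x powr (1/2 + \<epsilon>)" if x: "x \<ge> 1" for x
  proof -
    define h where "h = x powr (1/2)"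
    have h: "h > 0" using x by (simp add: h_def)
    have hx: "h \<le> x" unfolding h_def using x powr_mono[of "1/2" 1 x] by simp
    \<comment> \<open>72 = 3 * 2 * 12: the constant of the interpolated kernel, (x + h)^a \<le> 2
      x^a, and (6 (x + h) / h)^\<epsilon> \<le> 12 x^(\<epsilon>/2), where h \<le> x is
      used.\<close>
    define D where "D = 72 * A * x powr (1/2 + \<epsilon>)"
    have D: "D \<ge> 0" using A by (simp add: D_def)
    define H where "H = (\<lambda>T. 18 * C * (x + h)^3 / h * (1 + T) powr (-5/4))"
    have "\<exists>I. ((\<lambda>\<sigma>. G \<sigma> * smooth_kernel_real x h \<sigma> / sqrt (1 - \<sigma>)) has_integral I) {a..1}
           \<and> \<bar>smooth_count x h - I / pi\<bar> \<le> D / \<delta>"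
    proof (rule smooth_count_contour[where \<Omega> = \<Omega> and Gh = Gh and b = "\<lambda>_. a" and b' = "\<lambda>_. 0" and H = H
          and \<psi> = "\<lambda>t. - (D / \<delta>) * (1 + t) powr (-\<delta>)" and \<psi>' = "\<lambda>t. D * (1 + t) powr (-1 - \<delta>)"])
      show "continuous_on {0..} (\<lambda>t. - (D / \<delta>) * (1 + t) powr (-\<delta>))" using D \<delta> by (intro power_majorant(1)) auto
      show "((\<lambda>t. - (D / \<delta>) * (1 + t) powr (-\<delta>)) has_real_derivative D * (1 + t) powr (-1 - \<delta>)) (at t)" if "t > 0" for t
        using D \<delta> that by (intro power_majorant(2)) auto
      show "- (D / \<delta>) * (1 + t) powr (-\<delta>) - - (D / \<delta>) * (1 + 0) powr (-\<delta>) \<le> D / \<delta>" if "t \<ge> 0" for t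
        using D \<delta> that by (intro power_majorant(3)) auto
      show "(H \<longlongrightarrow> 0) at_top" unfolding H_def by (rule tendsto_power_majorant)
      show "norm (Gh (Complex \<sigma> t) * smooth_kernel x h (Complex \<sigma> t) / csqrt (Complex \<sigma> t - 1)) \<le> H \<bar>t\<bar>"
        if t: "\<bar>t\<bar> \<ge> 1" and \<sigma>: "a \<le> \<sigma>" "\<sigma> \<le> 2" for \<sigma> t
      proof -
        have "norm (Complex \<sigma> t - 1) \<ge> 1/4" using abs_Im_le_cmod[of "Complex \<sigma> t - 1"] t by simp
        moreover have "Complex \<sigma> t \<in> \<Omega>" using \<sigma> a by (simp add: \<Omega>_def)
        ultimately have F: "norm (Gh (Complex \<sigma> t) / csqrt (Complex \<sigma> t - 1)) \<le> C * (1 + \<bar>Im (Complex \<sigma> t)\<bar>) powr (3/4)"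
          using \<sigma> C(2)[of "Complex \<sigma> t" "Gh (Complex \<sigma> t)"] Gh(2)[of "Complex \<sigma> t"] by simp
        have "(x + h) powr (Re (Complex \<sigma> t) + 1) \<le> (x + h) powr 3" using x h \<sigma> by (intro powr_mono) auto
        hence "(x + h) powr (Re (Complex \<sigma> t) + 1) \<le> (x + h)^3" using x h by simp
        from F_kernel_bound[OF _ h _ F this] show ?thesis using \<sigma> a x C by (simp add: H_def)
      qed
      show "norm (Gh (Complex a t) * smooth_kernel x h (Complex a t) / csqrt (Complex a t - 1)) * (\<bar>0\<bar> + 1)
          \<le> D * (1 + \<bar>t\<bar>) powr (-1 - \<delta>)" for t
      proof -
        define u where "u = 1 + \<bar>t\<bar>"
        have "norm (smooth_kernel x h (Complex a t)) \<le> 3 * (x + h) powr a * (6 * (x + h) / h) powr (2 * \<delta>) * u powr (-1 - 2 * \<delta>)"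
          using norm_smooth_kernel_interpolate[of x h "Complex a t" "2 * \<delta>"] x h a \<delta> by (simp add: u_def)
        also have "\<dots> \<le> 3 * (2 * x powr a) * (12 * x powr \<delta>) * u powr (-1 - 2 * \<delta>)"
        proof (intro mult_mono order_refl)
          have "(x + h) powr a \<le> (2 * x) powr a" using x h hx a by (intro powr_mono2) auto
          also have "\<dots> = 2 powr a * x powr a" by (rule powr_mult)
          also have "\<dots> \<le> 2 * x powr a" using powr_mono[of a 1 "2::real"] a by (intro mult_right_mono) auto
          finally show "(x + h) powr a \<le> 2 * x powr a" .
          have "6 * (x + h) / h \<le> 12 * x / h" using hx h by (intro divide_right_mono) auto
          also have "12 * x / h = 12 * x powr (1/2)"
          proof -
            have "x = x powr (1/2) * x powr (1/2)" using x by (simp flip: powr_add)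
            hence "12 * x = 12 * x powr (1/2) * h" unfolding h_def by simp
            thus ?thesis using h by (simp add: nonzero_divide_eq_eq)
          qed
          finally have "(6 * (x + h) / h) powr (2 * \<delta>) \<le> (12 * x powr (1/2)) powr (2 * \<delta>)"
            using x h \<delta> by (intro powr_mono2) auto
          also have "\<dots> = 12 powr (2 * \<delta>) * x powr \<delta>" by (simp add: powr_mult powr_powr)
          also have "\<dots> \<le> 12 * x powr \<delta>" using powr_mono[of "2 * \<delta>" 1 "12::real"] \<delta> by (intro mult_right_mono) auto
          finally show "(6 * (x + h) / h) powr (2 * \<delta>) \<le> 12 * x powr \<delta>" .
        qed auto
        also have "\<dots> = 72 * (x powr a * x powr \<delta>) * u powr (-1 - 2 * \<delta>)" by simp
        also have "x powr a * x powr \<delta> = x powr (1/2 + \<epsilon>)" by (simp add: a_def \<delta>_def add.commute flip: powr_add)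
        finally have k: "norm (smooth_kernel x h (Complex a t)) \<le> 72 * x powr (1/2 + \<epsilon>) * u powr (-1 - 2 * \<delta>)" .
        have "norm (Gh (Complex a t) * smooth_kernel x h (Complex a t) / csqrt (Complex a t - 1)) =
            norm (Gh (Complex a t) / csqrt (Complex a t - 1)) * norm (smooth_kernel x h (Complex a t))"
          by (simp add: norm_mult norm_divide)
        also have "\<dots> \<le> (A * u powr \<delta>) * (72 * x powr (1/2 + \<epsilon>) * u powr (-1 - 2 * \<delta>))"
          using F[of t] k A by (intro mult_mono) (auto simp: u_def)
        also have "\<dots> = D * (u powr \<delta> * u powr (-1 - 2 * \<delta>))" by (simp add: D_def)
        also have "u powr \<delta> * u powr (-1 - 2 * \<delta>) = u powr (\<delta> + (-1 - 2 * \<delta>))" by (rule powr_add[symmetric])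
        also have "\<delta> + (-1 - 2 * \<delta>) = -1 - \<delta>" by simp
        finally show ?thesis by (simp add: u_def)
      qed
      show "Complex \<sigma> t \<in> \<Omega>" if "a \<le> \<sigma>" for t \<sigma> using that a by (simp add: \<Omega>_def)
    qed (use star op half Gh x h a in auto)
    then obtain I where I: "((\<lambda>\<sigma>. G \<sigma> * smooth_kernel_real x h \<sigma> / sqrt (1 - \<sigma>)) has_integral I) {a..1}"
        "\<bar>smooth_count x h - I / pi\<bar> \<le> D / \<delta>" by blast
    have "\<bar>countE x - mainterm \<epsilon> x\<bar> \<le> (h + 1) + D / \<delta> + (2 * CG * h + 4 * CG * x powr max a (1/2 + \<epsilon>))"
      by (rule countE_mainterm_bound[OF \<epsilon> a(1) _ CG _ _ x h I]) (use a \<epsilon> in \<open>auto simp: a_def\<close>)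
    also have "max a (1/2 + \<epsilon>) = 1/2 + \<epsilon>" using \<epsilon> by (simp add: a_def)
    also have "(h + 1) + D / \<delta> + (2 * CG * h + 4 * CG * x powr (1/2 + \<epsilon>)) \<le> K * x powr (1/2 + \<epsilon>)"
    proof -
      define X where "X = x powr (1/2 + \<epsilon>)"
      have "h \<le> X" unfolding h_def X_def using x \<epsilon> by (intro powr_mono) auto
      moreover have "1 \<le> X" unfolding X_def using x \<epsilon> by (intro ge_one_powr_ge_zero) auto
      moreover have "2 * CG * h \<le> 2 * CG * X" using \<open>h \<le> X\<close> CG0 by (intro mult_left_mono) auto
      moreover have "D / \<delta> = 72 * A / \<delta> * X" by (simp add: D_def X_def)
      moreover have "K * X = 2 * X + 72 * A / \<delta> * X + 2 * CG * X + 4 * CG * X" unfolding K_def by (simp add: algebra_simps)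
      ultimately show ?thesis unfolding X_def[symmetric] by linarith
    qed
    finally show ?thesis .
  qed
  thus ?thesis by blast
qed

text \<open>After taking logarithms the claim is \<kappa> sqrt (ln x) \<le> (1 - m) ln x, which
  holds as soon as sqrt (ln x) \<ge> \<kappa> / (1 - m).\<close>

lemma powr_bigo_exp_sqrt:
  assumes "m < 1" "\<kappa> > 0"
  shows "\<forall>\<^sub>F x in at_top. x powr m \<le> x * exp (- \<kappa> * sqrt (ln x))"
proof -
  define q where "q = \<kappa> / (1 - m)"
  have q: "q > 0" using assms by (simp add: q_def)
  show ?thesis using eventually_ge_at_top[of "exp (q^2)"]
  proof eventually_elim
    case (elim x)
    have x: "x > 0" using elim by (meson exp_gt_zero less_le_trans)
    hence "q^2 \<le> ln x" using elim by (simp add: ln_ge_iff)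
    hence l: "q \<le> sqrt (ln x)" using q by (intro real_le_rsqrt) auto
    have l0: "ln x \<ge> 0" using \<open>q^2 \<le> ln x\<close> by (meson order_trans zero_le_power2)
    have "\<kappa> * sqrt (ln x) = (1 - m) * (q * sqrt (ln x))" using assms by (simp add: q_def)
    also have "\<dots> \<le> (1 - m) * (sqrt (ln x) * sqrt (ln x))"
      using l l0 assms q by (intro mult_left_mono mult_right_mono) auto
    also have "\<dots> = (1 - m) * ln x" using l0 by simp
    finally have "m * ln x \<le> ln x + - \<kappa> * sqrt (ln x)" by (simp add: algebra_simps)
    hence "exp (m * ln x) \<le> exp (ln x + - \<kappa> * sqrt (ln x))" by simp
    also have "\<dots> = x * exp (- \<kappa> * sqrt (ln x))" using x by (simp only: exp_add exp_ln)
    finally show ?case using x by (simp add: powr_def)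
  qed
qed

theorem theorem2p4:
  fixes \<epsilon> :: real
  assumes "0 < \<epsilon>" and "\<epsilon> < 1/2"
  shows "(\<exists>c>0. (\<lambda>x. countE x - mainterm \<epsilon> x)
             \<in> O[at_top](\<lambda>x. x * exp (- c * sqrt (ln x))))
       \<and> (RH_zeta_L4 \<longrightarrow>
             (\<lambda>x. countE x - mainterm \<epsilon> x) \<in> O[at_top](\<lambda>x. x powr (1/2 + \<epsilon>)))"
proof (intro conjI impI)
  obtain \<kappa> K m where k: "\<kappa> > 0" "m < 1"
    "\<And>x. x \<ge> 1 \<Longrightarrow> \<bar>countE x - mainterm \<epsilon> x\<bar> \<le> K * (x * exp (- \<kappa> * sqrt (ln x))) + 1 + K * x powr m"
    using countE_unconditional[OF assms] by blast
  have "\<forall>\<^sub>F x in at_top. norm (countE x - mainterm \<epsilon> x) \<le> (2 * \<bar>K\<bar> + 1) * norm (x * exp (- \<kappa> * sqrt (ln x)))"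
    using powr_bigo_exp_sqrt[OF k(2,1)] powr_bigo_exp_sqrt[OF zero_less_one k(1)] eventually_ge_at_top[of 1]
  proof eventually_elim
    case (elim x)
    define g where "g = x * exp (- \<kappa> * sqrt (ln x))"
    \<comment> \<open>The second bound is the case of exponent 0 of
      \<open>powr_bigo_exp_sqrt\<close>; it absorbs the additive constant 1.\<close>
    have g: "x powr m \<le> g" "1 \<le> g" using elim by (auto simp: g_def)
    have "K * x powr m \<le> \<bar>K\<bar> * g" using g(1) by (intro mult_mono) auto
    moreover have "K * g \<le> \<bar>K\<bar> * g" using g by (intro mult_right_mono) auto
    ultimately have "\<bar>countE x - mainterm \<epsilon> x\<bar> \<le> (2 * \<bar>K\<bar> + 1) * g"
    proof -
      have e: "(2 * \<bar>K\<bar> + 1) * g = \<bar>K\<bar> * g + \<bar>K\<bar> * g + g" by (simp add: algebra_simps)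
      show ?thesis if "K * x powr m \<le> \<bar>K\<bar> * g" "K * g \<le> \<bar>K\<bar> * g"
        unfolding e using k(3)[OF elim(3)] g(2) that unfolding g_def[symmetric] by linarith
    qed
    thus ?case using g unfolding g_def[symmetric] by simp
  qed
  hence "(\<lambda>x. countE x - mainterm \<epsilon> x) \<in> O[at_top](\<lambda>x. x * exp (- \<kappa> * sqrt (ln x)))" by (rule bigoI)
  thus "\<exists>c>0. (\<lambda>x. countE x - mainterm \<epsilon> x) \<in> O[at_top](\<lambda>x. x * exp (- c * sqrt (ln x)))" using k(1) by blast
next
  assume RH: "RH_zeta_L4"
  obtain K where K: "\<And>x. x \<ge> 1 \<Longrightarrow> \<bar>countE x - mainterm \<epsilon> x\<bar> \<le> K * x powr (1/2 + \<epsilon>)"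
    using countE_under_RH[OF assms RH] by blast
  have "\<forall>\<^sub>F x in at_top. norm (countE x - mainterm \<epsilon> x) \<le> K * norm (x powr (1/2 + \<epsilon>))"
    using eventually_ge_at_top[of 1] by eventually_elim (use K in simp)
  thus "(\<lambda>x. countE x - mainterm \<epsilon> x) \<in> O[at_top](\<lambda>x. x powr (1/2 + \<epsilon>))" by (rule bigoI)
qed

end
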